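(* Suppose that $\check{M}_n$ and $M_n^s$, $s\in\{f,c\}$, are Feller for every $n\geq 1$ and that $G_n\in\mathcal{C}_b(\mathsf{X})$ for every $n\geq 0$. Then for any $n\geq 0$ and any $(\varphi,\psi)\in\mathcal{C}_b(\mathsf{X})\times\mathcal{C}_b(\mathsf{X})$, as $N\to\infty$, $$\sqrt{N}\,[\check{\eta}_{n}^{N,W}-\check{\eta}_{n}^{W}](\varphi\otimes 1 - 1 \otimes \psi) \Rightarrow \mathcal{N}(0,\sigma_n^{2,W}(\varphi,\psi)),$$ where $\Rightarrow$ denotes convergence in distribution and $$\sigma_n^{2,W}(\varphi,\psi) = \sum_{p=0}^n \check{\eta}_p^W\big([D_{p,n}^f(\varphi)\otimes 1- 1\otimes D_{p,n}^c(\psi)]^2\big).$$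
   Context: Notation. $\mathsf{X}=\mathbb{R}$ with its Borel $\sigma$-field $\mathcal{X}$; $\mathcal{B}_b$ and $\mathcal{C}_b$ denote bounded measurable and bounded continuous real functions. $\mu(\varphi)=\int\varphi\,d\mu$; for a kernel $K$, $K(\varphi)(x)=\int\varphi(y)K(x,dy)$; $(\varphi\otimes\psi)(x,y)=\varphi(x)\psi(y)$. A Markov kernel is Feller if it maps $\mathcal{C}_b$ into $\mathcal{C}_b$. $\mathcal N(0,\sigma^2)$ is the (possibly degenerate) centred Gaussian law. Model. For $n\ge 0$, $G_n:\mathsf{X}\to(0,\infty)$ is in $\mathcal{B}_b(\mathsf{X})$. For $s\in\{f,c\}$, $\eta_0^s$ is a probability measure on $\mathsf{X}$ and $(M_n^s)_{n\ge1}$ are Markov kernels on $\mathsf{X}$. Set $\gamma_n^s(\varphi)=\int_{\mathsf{X}^{n+1}}\varphi(x_n)\big(\prod_{p=0}^{n-1}G_p(x_p)\big)\eta_0^s(dx_0)\prod_{p=1}^nM_p^s(x_{p-1},dx_p)$, $\eta_n^s(\varphi)=\gamma_n^s(\varphi)/\gamma_n^s(1)$, and $\overline{\eta}_n^s(\varphi)=\eta_n^s(G_n\varphi)/\eta_n^s(G_n)$. For a probability $\mu$ on $\mathsf{X}$, $F_\mu$ is its CDF and $F_\mu^{-1}(w)=\inf\{x:F_\mu(x)\ge w\}$ its generalized inverse. Standing assumption: for all $n\ge0$, $s\in\{f,c\}$, $F_{\overline{\eta}_n^s}$ and $F_{\overline{\eta}_n^s}^{-1}$ exist and are continuous functions.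 Couplings. $\check\eta_0$ is a given coupling of $(\eta_0^f,\eta_0^c)$ on $\mathsf{X}\times\mathsf{X}$, and for $n\ge1$, $\check M_n$ is a given Markov kernel on $\mathsf{X}\times\mathsf{X}$ with $\check M_n(A\times\mathsf{X})(x,x')=M_n^f(A)(x)$ and $\check M_n(\mathsf{X}\times A)(x,x')=M_n^c(A)(x')$ for all $A\in\mathcal{X}$, $x,x'\in\mathsf{X}$. For probabilities $\mu,\nu$ on $\mathsf{X}$ and $\varphi\in\mathcal{B}_b(\mathsf{X}\times\mathsf{X})$, $\check{\Phi}_n^W(\mu,\nu)(\varphi)=\int_0^1\check M_n(\varphi)(F_\mu^{-1}(w),F_\nu^{-1}(w))\,dw$. Set $\check\eta_0^W=\check\eta_0$ and, for $n\ge1$, $\check\eta_n^W=\check\Phi_n^W(\overline\eta_{n-1}^f,\overline\eta_{n-1}^c)$. Algorithm. For each $N\ge1$, particles $u_p^i=(x_p^{i,f},x_p^{i,c})$, $1\le i\le N$, have joint law $\big(\prod_{i=1}^N\check\eta_0(du_0^i)\big)\prod_{p=1}^n\prod_{i=1}^N\check\Phi_p^W(\overline\eta_{p-1}^{N,f},\overline\eta_{p-1}^{N,c})(du_p^i)$, where $\overline\eta_{p}^{N,s}=\sum_{i=1}^N\frac{G_p(x_p^{i,s})}{\sum_{j=1}^NG_p(x_p^{j,s})}\delta_{x_p^{i,s}}$. Set $\check\eta_p^{N,W}=\frac1N\sum_{i=1}^N\delta_{u_p^i}$. Operators. $Q_n^s(x,dy)=G_{n-1}(x)M_n^s(x,dy)$;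 for $0\le p<n$, $Q_{p,n}^s(\varphi)(x_p)=\int\varphi(x_n)\prod_{q=p}^{n-1}Q_{q+1}^s(x_q,dx_{q+1})$, and $Q_{n,n}^s(\varphi)=\varphi$. For $0\le p<n$, $D_{p,n}^s(\varphi)(x)=\frac{Q_{p,n}^s(\varphi-\eta_n^s(\varphi))(x)}{\eta_p^s(Q_{p,n}^s(1))}$, and $D_{n,n}^s(\varphi)=\varphi-\eta_n^s(\varphi)$. *)

theory Defs
  imports "HOL-Probability.Probability"
begin

text \<open>A Markov kernel from \<open>X\<close> to \<open>Y\<close> is an element of
  \<open>X \<rightarrow>\<^sub>M prob_algebra Y\<close>, and \<open>\<mu>(\<phi>)\<close> is \<open>\<integral>x. \<phi> x \<partial>\<mu>\<close>.\<close>

definition bounded_continuous :: "('a::topological_space \<Rightarrow> real) \<Rightarrow> bool" where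
  "bounded_continuous f \<longleftrightarrow> continuous_on UNIV f \<and> bounded (range f)"

definition kernel_op :: "('a \<Rightarrow> 'b measure) \<Rightarrow> ('b \<Rightarrow> real) \<Rightarrow> 'a \<Rightarrow> real" where
  "kernel_op K \<phi> x = (\<integral>y. \<phi> y \<partial>K x)"

definition feller :: "('a::topological_space \<Rightarrow> 'a measure) \<Rightarrow> bool" where
  "feller K \<longleftrightarrow> (\<forall>\<phi>. bounded_continuous \<phi> \<longrightarrow> bounded_continuous (kernel_op K \<phi>))"

definition tensor :: "('a \<Rightarrow> real) \<Rightarrow> ('b \<Rightarrow> real) \<Rightarrow> 'a \<times> 'b \<Rightarrow> real" where
  "tensor \<phi> \<psi> = (\<lambda>(x, y). \<phi> x * \<psi> y)"

definition centred_gaussian :: "real \<Rightarrow> real measure" where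
  "centred_gaussian v =
     (if v = 0 then return borel 0 else density lborel (normal_density 0 (sqrt v)))"

text \<open>The superscript \<open>s \<in> {f, c}\<close>.\<close>

datatype level = Fine | Coarse


text \<open>The law of \<open>(x\<^sub>0, \<dots>, x\<^sub>n)\<close> on coordinates \<open>{0..<Suc n}\<close>, where \<open>x\<^sub>0 \<sim> \<mu>\<close> and
  \<open>x\<^sub>p \<sim> K p x\<^bsub>p-1\<^esub>\<close> for \<open>1 \<le> p \<le> n\<close>; \<open>Ionescu_Tulcea.C\<close> is the library's iterated product of
  kernels, started here from the empty path.\<close>

definition chain_law ::
    "'a measure \<Rightarrow> 'a measure \<Rightarrow> (nat \<Rightarrow> 'a \<Rightarrow> 'a measure) \<Rightarrow> nat \<Rightarrow> (nat \<Rightarrow> 'a) measure" where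
  "chain_law S \<mu> K n =
     Ionescu_Tulcea.C (\<lambda>p x. if p = 0 then \<mu> else K p (x (p - 1))) (\<lambda>_. S)
       0 (Suc n) (\<lambda>_. undefined)"


definition fk_gamma ::
    "(nat \<Rightarrow> real \<Rightarrow> real) \<Rightarrow> real measure \<Rightarrow> (nat \<Rightarrow> real \<Rightarrow> real measure) \<Rightarrow> nat \<Rightarrow> real measure" where
  "fk_gamma G \<eta>0 M n =
     distr (density (chain_law borel \<eta>0 M n) (\<lambda>x. ennreal (\<Prod>p<n. G p (x p)))) borel (\<lambda>x. x n)"

definition normalize_measure :: "'a measure \<Rightarrow> 'a measure" where
  "normalize_measure \<mu> = density \<mu> (\<lambda>_. 1 / emeasure \<mu> (space \<mu>))"

definition fk_eta ::
    "(nat \<Rightarrow> real \<Rightarrow> real) \<Rightarrow> real measure \<Rightarrow> (nat \<Rightarrow> real \<Rightarrow> real measure) \<Rightarrow> nat \<Rightarrow> real measure" where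
  "fk_eta G \<eta>0 M n = normalize_measure (fk_gamma G \<eta>0 M n)"

definition fk_eta_bar ::
    "(nat \<Rightarrow> real \<Rightarrow> real) \<Rightarrow> real measure \<Rightarrow> (nat \<Rightarrow> real \<Rightarrow> real measure) \<Rightarrow> nat \<Rightarrow> real measure" where
  "fk_eta_bar G \<eta>0 M n = normalize_measure (density (fk_eta G \<eta>0 M n) (\<lambda>x. ennreal (G n x)))"

text \<open>Only meaningful for \<open>0 < w < 1\<close>; at the endpoints the infimum may be infinite.\<close>

definition quantile :: "real measure \<Rightarrow> real \<Rightarrow> real" where
  "quantile \<mu> w = Inf {x. cdf \<mu> x \<ge> w}"


text \<open>\<open>wasserstein_step K \<mu> \<nu>\<close> is the measure \<open>\<phi> \<mapsto> \<integral>\<^sub>0\<^sup>1 K(\<phi>)(F\<^sub>\<mu>\<^sup>-\<^sup>1(w), F\<^sub>\<nu>\<^sup>-\<^sup>1(w)) dw\<close>.\<close>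

definition wasserstein_step ::
    "(real \<times> real \<Rightarrow> (real \<times> real) measure) \<Rightarrow> real measure \<Rightarrow> real measure \<Rightarrow> (real \<times> real) measure" where
  "wasserstein_step K \<mu> \<nu> =
     restrict_space lborel {0<..<1} \<bind> (\<lambda>w. K (quantile \<mu> w, quantile \<nu> w))"

fun eta_check ::
    "(nat \<Rightarrow> real \<Rightarrow> real) \<Rightarrow> (level \<Rightarrow> real measure) \<Rightarrow> (level \<Rightarrow> nat \<Rightarrow> real \<Rightarrow> real measure) \<Rightarrow>
     (real \<times> real) measure \<Rightarrow> (nat \<Rightarrow> real \<times> real \<Rightarrow> (real \<times> real) measure) \<Rightarrow>
     nat \<Rightarrow> (real \<times> real) measure" where
  "eta_check G \<eta>0 M \<eta>c0 Mc 0 = \<eta>c0"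
| "eta_check G \<eta>0 M \<eta>c0 Mc (Suc n) =
     wasserstein_step (Mc (Suc n))
       (fk_eta_bar G (\<eta>0 Fine) (M Fine) n) (fk_eta_bar G (\<eta>0 Coarse) (M Coarse) n)"


text \<open>A configuration of \<open>N\<close> points is a function on \<open>{1..N}\<close>.\<close>

definition weighted_empirical :: "('a::topological_space \<Rightarrow> real) \<Rightarrow> nat \<Rightarrow> (nat \<Rightarrow> 'a) \<Rightarrow> 'a measure" where
  "weighted_empirical g N x =
     distr (point_measure {1..N} (\<lambda>i. ennreal (g (x i) / (\<Sum>j=1..N. g (x j))))) borel x"

definition empirical :: "nat \<Rightarrow> (nat \<Rightarrow> 'a::topological_space) \<Rightarrow> 'a measure" where
  "empirical N x = distr (uniform_count_measure {1..N}) borel x"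

definition config_space :: "nat \<Rightarrow> (nat \<Rightarrow> real \<times> real) measure" where
  "config_space N = (\<Pi>\<^sub>M i\<in>{1..N}. borel)"

definition particle_kernel ::
    "(nat \<Rightarrow> real \<Rightarrow> real) \<Rightarrow> (nat \<Rightarrow> real \<times> real \<Rightarrow> (real \<times> real) measure) \<Rightarrow> nat \<Rightarrow>
     nat \<Rightarrow> (nat \<Rightarrow> real \<times> real) \<Rightarrow> (nat \<Rightarrow> real \<times> real) measure" where
  "particle_kernel G Mc N p u =
     (\<Pi>\<^sub>M i\<in>{1..N}. wasserstein_step (Mc p)
        (weighted_empirical (G (p - 1)) N (\<lambda>j. fst (u j)))
        (weighted_empirical (G (p - 1)) N (\<lambda>j. snd (u j))))"

definition particle_law ::
    "(nat \<Rightarrow> real \<Rightarrow> real) \<Rightarrow> (real \<times> real) measure \<Rightarrow>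
     (nat \<Rightarrow> real \<times> real \<Rightarrow> (real \<times> real) measure) \<Rightarrow> nat \<Rightarrow> nat \<Rightarrow>
     (nat \<Rightarrow> nat \<Rightarrow> real \<times> real) measure" where
  "particle_law G \<eta>c0 Mc N n =
     chain_law (config_space N) (\<Pi>\<^sub>M i\<in>{1..N}. \<eta>c0) (particle_kernel G Mc N) n"

text \<open>Random variables \<open>u p i\<close> for \<open>p \<le> n\<close>, \<open>1 \<le> i \<le> N\<close>, on a probability space \<open>\<Omega>\<close> form a run of
  the algorithm up to time \<open>n\<close> if they have the prescribed joint law.\<close>

definition particle_system ::
    "(nat \<Rightarrow> real \<Rightarrow> real) \<Rightarrow> (real \<times> real) measure \<Rightarrow>
     (nat \<Rightarrow> real \<times> real \<Rightarrow> (real \<times> real) measure) \<Rightarrow> nat \<Rightarrow> nat \<Rightarrow>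
     '\<omega> measure \<Rightarrow> (nat \<Rightarrow> nat \<Rightarrow> '\<omega> \<Rightarrow> real \<times> real) \<Rightarrow> bool" where
  "particle_system G \<eta>c0 Mc N n \<Omega> u \<longleftrightarrow>
     prob_space \<Omega> \<and>
     (\<forall>p\<le>n. \<forall>i\<in>{1..N}. u p i \<in> borel_measurable \<Omega>) \<and>
     distr \<Omega> (\<Pi>\<^sub>M p\<in>{0..<Suc n}. config_space N) (\<lambda>\<omega>. \<lambda>p\<in>{0..<Suc n}. \<lambda>i\<in>{1..N}. u p i \<omega>)
       = particle_law G \<eta>c0 Mc N n"


definition Q_kernel ::
    "(nat \<Rightarrow> real \<Rightarrow> real) \<Rightarrow> (nat \<Rightarrow> real \<Rightarrow> real measure) \<Rightarrow> nat \<Rightarrow> real \<Rightarrow> real measure" where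
  "Q_kernel G M n x = density (M n x) (\<lambda>_. ennreal (G (n - 1) x))"

text \<open>The fold unfolds to \<open>Q\<^bsub>p+1\<^esub>(Q\<^bsub>p+2\<^esub>(\<dots>Q\<^sub>n(\<phi>)))\<close>, and to \<open>\<phi>\<close> if \<open>p = n\<close>.\<close>

definition Q_semigroup ::
    "(nat \<Rightarrow> real \<Rightarrow> real) \<Rightarrow> (nat \<Rightarrow> real \<Rightarrow> real measure) \<Rightarrow> nat \<Rightarrow> nat \<Rightarrow> (real \<Rightarrow> real) \<Rightarrow> real \<Rightarrow> real" where
  "Q_semigroup G M p n \<phi> = foldr (\<lambda>q. kernel_op (Q_kernel G M (Suc q))) [p..<n] \<phi>"

definition D_op ::
    "(nat \<Rightarrow> real \<Rightarrow> real) \<Rightarrow> real measure \<Rightarrow> (nat \<Rightarrow> real \<Rightarrow> real measure) \<Rightarrow> nat \<Rightarrow> nat \<Rightarrow>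
     (real \<Rightarrow> real) \<Rightarrow> real \<Rightarrow> real" where
  "D_op G \<eta>0 M p n \<phi> x =
     (let \<phi>c = (\<lambda>y. \<phi> y - (\<integral>z. \<phi> z \<partial>fk_eta G \<eta>0 M n)) in
      if p < n
      then Q_semigroup G M p n \<phi>c x / (\<integral>y. Q_semigroup G M p n (\<lambda>_. 1) y \<partial>fk_eta G \<eta>0 M p)
      else \<phi>c x)"

definition asymptotic_variance ::
    "(nat \<Rightarrow> real \<Rightarrow> real) \<Rightarrow> (level \<Rightarrow> real measure) \<Rightarrow> (level \<Rightarrow> nat \<Rightarrow> real \<Rightarrow> real measure) \<Rightarrow>
     (real \<times> real) measure \<Rightarrow> (nat \<Rightarrow> real \<times> real \<Rightarrow> (real \<times> real) measure) \<Rightarrow> nat \<Rightarrow>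
     (real \<Rightarrow> real) \<Rightarrow> (real \<Rightarrow> real) \<Rightarrow> real" where
  "asymptotic_variance G \<eta>0 M \<eta>c0 Mc n \<phi> \<psi> =
     (\<Sum>p=0..n. \<integral>u. (tensor (D_op G (\<eta>0 Fine) (M Fine) p n \<phi>) (\<lambda>_. 1) u
                   - tensor (\<lambda>_. 1) (D_op G (\<eta>0 Coarse) (M Coarse) p n \<psi>) u)\<^sup>2
        \<partial>eta_check G \<eta>0 M \<eta>c0 Mc p)"

end

theory Submission
  imports Defs
begin

text \<open>Why the theorem holds. Given the particles at time \<open>n\<close>, those at time \<open>n + 1\<close> are \<open>N\<close> independent
  draws from one random law, the Wasserstein step applied to the two weighted empirical measures. The
  fluctuation at time \<open>n + 1\<close> therefore splits into a sampling error, which is conditionally a normalised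
  sum of independent centred bounded variables, and the error of the conditional mean. Two facts make
  this split produce the Gaussian limit.

  First, the conditional variance converges to a constant. The weighted empirical measures converge to
  the updated laws because each marginal particle filter has mean square error \<open>O(1/N)\<close>
  (\<open>emean_mean_square\<close>, \<open>wemp_mean_square\<close>). Continuity of the limiting distribution functions and
  quantile functions, together with the Feller property of the coupled kernel, makes the Wasserstein
  step continuous at the limit (\<open>wasserstein_step_tendsto\<close>). To integrate over the randomness of the
  particles, this continuity is made into an explicit estimate in terms of finitely many test functions
  (\<open>wasserstein_step_modulus\<close>); a law of large numbers for the step follows
  (\<open>step_law_of_large_numbers\<close>).

  Secondly, the marginals of the coupled step are the ordinary mutation steps, so for a contrast
  \<open>\<phi> \<otimes> 1 - 1 \<otimes> \<psi>\<close> the conditional mean is a difference of two ratios of empirical means, one for each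
  level. Linearising the ratios gives the fluctuation at time \<open>n\<close> of another contrast, built from
  the derivative \<open>pullback\<close> of the Boltzmann-Gibbs map, up to an error with mean \<open>O(1/N)\<close>
  (\<open>linearization_error\<close>). The operators \<open>D\<close> satisfy the same recursion (\<open>D_op_Suc\<close>), so the
  conditional variances collected on the way down to time \<open>0\<close> add up to the asymptotic variance
  (\<open>asymptotic_variance_Suc\<close>).

  The induction runs on characteristic functions (\<open>fluctuation_char_Suc\<close>, \<open>fluctuation_char_tendsto\<close>).
  The conditional characteristic function of the sampling error is approximated with a bound that
  depends only on the supremum of the test function (\<open>char_emean_iid\<close>), hence uniformly over the random
  sampling laws. Levy's continuity theorem concludes.\<close>

section \<open>Bounded continuous test functions\<close>

lemma bounded_continuousI:
  assumes "continuous_on UNIV f" "\<And>x. \<bar>f x\<bar> \<le> B"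
  shows "bounded_continuous f"
  using assms unfolding bounded_continuous_def bounded_iff by auto

lemma bounded_continuous_bound:
  assumes "bounded_continuous f"
  obtains B where "B \<ge> 0" "\<And>x. \<bar>f x\<bar> \<le> B"
proof -
  from assms obtain B where B: "\<And>x. \<bar>f x\<bar> \<le> B"
    unfolding bounded_continuous_def bounded_iff by auto
  have "0 \<le> B" using B[of undefined] by linarith
  with B that show thesis by blast
qed

lemma bounded_continuous_measurable:
  "bounded_continuous f \<Longrightarrow> f \<in> borel_measurable borel"
  unfolding bounded_continuous_def by (intro borel_measurable_continuous_onI) simp

lemma bounded_continuous_const: "bounded_continuous (\<lambda>x. c)"
  by (rule bounded_continuousI[of _ "\<bar>c\<bar>"]) auto

lemma bounded_continuous_diff:
  assumes "bounded_continuous f" "bounded_continuous g"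
  shows "bounded_continuous (\<lambda>x. f x - g x)"
proof -
  obtain A B where "\<And>x. \<bar>f x\<bar> \<le> A" "\<And>x. \<bar>g x\<bar> \<le> B"
    using assms by (meson bounded_continuous_bound)
  then have "\<bar>f x - g x\<bar> \<le> A + B" for x
    using abs_triangle_ineq4[of "f x" "g x"] by (meson add_mono order_trans)
  then show ?thesis
    using assms by (intro bounded_continuousI[of _ "A + B"] continuous_on_diff)
      (auto simp: bounded_continuous_def)
qed

lemma bounded_continuous_mult:
  assumes "bounded_continuous f" "bounded_continuous g"
  shows "bounded_continuous (\<lambda>x. f x * g x)"
proof -
  obtain A B where A: "0 \<le> A" "\<And>x. \<bar>f x\<bar> \<le> A" and B: "\<And>x. \<bar>g x\<bar> \<le> B"
    using assms by (meson bounded_continuous_bound)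
  have "\<bar>f x * g x\<bar> \<le> A * B" for x
    unfolding abs_mult using A B by (intro mult_mono) auto
  then show ?thesis
    using assms by (intro bounded_continuousI[of _ "A * B"] continuous_on_mult)
      (auto simp: bounded_continuous_def)
qed

lemma bounded_continuous_fst:
  assumes "bounded_continuous f" shows "bounded_continuous (\<lambda>v. f (fst v))"
proof -
  obtain A where "\<And>x. \<bar>f x\<bar> \<le> A"
    using assms by (meson bounded_continuous_bound)
  then show ?thesis using assms
    by (intro bounded_continuousI[of _ A] continuous_on_compose2[of UNIV f UNIV fst])
      (auto simp: bounded_continuous_def intro: continuous_on_fst)
qed

lemma bounded_continuous_snd:
  assumes "bounded_continuous f" shows "bounded_continuous (\<lambda>v. f (snd v))"
proof -
  obtain A where "\<And>x. \<bar>f x\<bar> \<le> A"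
    using assms by (meson bounded_continuous_bound)
  then show ?thesis using assms
    by (intro bounded_continuousI[of _ A] continuous_on_compose2[of UNIV f UNIV snd])
      (auto simp: bounded_continuous_def intro: continuous_on_snd)
qed

lemmas bounded_continuous_intros =
  bounded_continuous_const bounded_continuous_diff bounded_continuous_mult
  bounded_continuous_fst bounded_continuous_snd

section \<open>Integration against Markov kernels\<close>

lemma (in prob_space) integrable_bounded:
  fixes f :: "'a \<Rightarrow> 'b :: {banach, second_countable_topology}"
  assumes "f \<in> borel_measurable M" "\<And>x. x \<in> space M \<Longrightarrow> norm (f x) \<le> B"
  shows "integrable M f"
  using assms by (intro integrable_const_bound[of _ B]) auto

lemma (in prob_space) integral_le_bound:
  fixes f :: "'a \<Rightarrow> real"
  assumes "\<And>x. x \<in> space M \<Longrightarrow> f x \<le> B" "0 \<le> B"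
  shows "(\<integral>x. f x \<partial>M) \<le> B"
proof (cases "integrable M f")
  case True
  then have "(\<integral>x. f x \<partial>M) \<le> (\<integral>x. B \<partial>M)"
    by (intro integral_mono) (auto simp: assms)
  then show ?thesis by (simp add: prob_space)
qed (simp add: not_integrable_integral_eq assms)

lemma (in prob_space) norm_integral_bounded:
  fixes f :: "'a \<Rightarrow> 'b :: {banach, second_countable_topology}"
  assumes "\<And>x. x \<in> space M \<Longrightarrow> norm (f x) \<le> B" "0 \<le> B"
  shows "norm (\<integral>x. f x \<partial>M) \<le> B"
  by (rule order_trans[OF integral_norm_bound integral_le_bound]) (use assms in auto)

lemma kernel_prob:
  assumes "K \<in> L \<rightarrow>\<^sub>M prob_algebra S" "x \<in> space L"
  shows "prob_space (K x)" "sets (K x) = sets S" "space (K x) = space S"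
  using measurable_space[OF assms] by (auto simp: space_prob_algebra dest: sets_eq_imp_space_eq)

lemma integral_bind_kernel:
  fixes f :: "'b \<Rightarrow> real"
  assumes M: "prob_space M" and K: "K \<in> M \<rightarrow>\<^sub>M prob_algebra S"
    and f: "f \<in> borel_measurable S" and B: "\<And>x. x \<in> space S \<Longrightarrow> \<bar>f x\<bar> \<le> B"
  shows "(\<integral>x. f x \<partial>(M \<bind> K)) = (\<integral>x. \<integral>y. f y \<partial>K x \<partial>M)"
proof (rule integral_bind[OF f B measurable_prob_algebraD[OF K], where B' = 1])
  show "finite_measure M" using M by (simp add: prob_space.finite_measure)
  show "AE x in M. emeasure (K x) (space (K x)) \<le> ennreal 1"
    by (rule AE_I2) (simp add: prob_space.emeasure_space_1[OF kernel_prob(1)[OF K]])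
qed

lemma measurable_integral_kernel:
  fixes f :: "'b \<Rightarrow> 'c::{banach, second_countable_topology}"
  assumes "K \<in> L \<rightarrow>\<^sub>M prob_algebra S" "f \<in> borel_measurable S"
  shows "(\<lambda>x. \<integral>y. f y \<partial>K x) \<in> borel_measurable L"
  using measurable_compose[OF measurable_prob_algebraD[OF assms(1)]
      integral_measurable_subprob_algebra[OF assms(2)]] .

text \<open>For conditioning in characteristic functions; the real case is applied to real and imaginary parts.\<close>

lemma integral_bind_kernel_complex:
  fixes f :: "'b \<Rightarrow> complex"
  assumes M: "prob_space M" and K: "K \<in> M \<rightarrow>\<^sub>M prob_algebra S"
    and f: "f \<in> borel_measurable S" and B: "\<And>x. x \<in> space S \<Longrightarrow> norm (f x) \<le> B"
    and B0: "0 \<le> B"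
  shows "(\<integral>x. f x \<partial>(M \<bind> K)) = (\<integral>x. \<integral>y. f y \<partial>K x \<partial>M)"
proof -
  interpret M: prob_space M by fact
  have ne: "space M \<noteq> {}" by (rule M.not_empty)
  have sets: "sets (M \<bind> K) = sets S"
    by (rule sets_bind_measurable[OF measurable_prob_algebraD[OF K] ne])
  have "prob_space (M \<bind> K)"
    by (rule M.prob_space_bind[OF _ measurable_prob_algebraD[OF K]])
      (use kernel_prob[OF K] in auto)
  then interpret MK: prob_space "M \<bind> K" .
  have int: "integrable (M \<bind> K) f"
    using f B sets sets_eq_imp_space_eq[OF sets] by (intro MK.integrable_bounded[of _ B])
      (auto cong: measurable_cong_sets)
  have intK: "integrable (K x) f" if "x \<in> space M" for x
  proof -
    interpret Kx: prob_space "K x" using kernel_prob[OF K that] by simp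
    show ?thesis using f B kernel_prob[OF K that] by (intro Kx.integrable_bounded[of _ B])
      (auto cong: measurable_cong_sets)
  qed
  have bK: "norm (\<integral>y. f y \<partial>K x) \<le> B" if "x \<in> space M" for x
  proof -
    interpret Kx: prob_space "K x" using kernel_prob[OF K that] by simp
    show ?thesis using B kernel_prob[OF K that] B0 by (intro Kx.norm_integral_bounded) auto
  qed
  have intM: "integrable M (\<lambda>x. \<integral>y. f y \<partial>K x)"
    by (intro M.integrable_bounded[of _ B] measurable_integral_kernel[OF K f] bK)
  have Re: "(\<integral>x. Re (f x) \<partial>(M \<bind> K)) = (\<integral>x. \<integral>y. Re (f y) \<partial>K x \<partial>M)"
    using f B by (intro integral_bind_kernel[OF M K, of _ B]) (auto intro: order_trans[OF abs_Re_le_cmod])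
  have Im: "(\<integral>x. Im (f x) \<partial>(M \<bind> K)) = (\<integral>x. \<integral>y. Im (f y) \<partial>K x \<partial>M)"
    using f B by (intro integral_bind_kernel[OF M K, of _ B]) (auto intro: order_trans[OF abs_Im_le_cmod])
  show ?thesis
  proof (rule complex_eqI)
    show "Re (\<integral>x. f x \<partial>(M \<bind> K)) = Re (\<integral>x. \<integral>y. f y \<partial>K x \<partial>M)"
      using Re by (simp add: integral_Re[OF int, symmetric] integral_Re[OF intM, symmetric])
        (intro Bochner_Integration.integral_cong, simp_all add: integral_Re[OF intK])
    show "Im (\<integral>x. f x \<partial>(M \<bind> K)) = Im (\<integral>x. \<integral>y. f y \<partial>K x \<partial>M)"
      using Im by (simp add: integral_Im[OF int, symmetric] integral_Im[OF intM, symmetric])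
        (intro Bochner_Integration.integral_cong, simp_all add: integral_Im[OF intK])
  qed
qed

text \<open>The law of \<open>N\<close> conditionally independent particles depends measurably on the conditioning
  configuration. The boxes generate the product \<open>\<sigma>\<close>-algebra, and on a box the product measure is a finite
  product of measurable functions.\<close>

lemma measurable_PiM_kernel:
  assumes K: "K \<in> L \<rightarrow>\<^sub>M prob_algebra S" and I: "finite I"
  shows "(\<lambda>x. PiM I (\<lambda>_. K x)) \<in> L \<rightarrow>\<^sub>M prob_algebra (PiM I (\<lambda>_. S))"
proof (rule measurable_prob_algebra_generated[OF sets_PiM Int_stable_prod_algebra prod_algebra_sets_into_space])
  fix x assume x: "x \<in> space L"
  show "prob_space (PiM I (\<lambda>_. K x))"
    using kernel_prob[OF K x] by (intro prob_space_PiM) simp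
  show "sets (PiM I (\<lambda>_. K x)) = sets (PiM I (\<lambda>_. S))"
    using kernel_prob[OF K x] by (intro sets_PiM_cong) auto
next
  fix A assume "A \<in> prod_algebra I (\<lambda>_. S)"
  then obtain X where A: "A = PiE I X" and X: "\<And>i. i \<in> I \<Longrightarrow> X i \<in> sets S"
    unfolding prod_algebra_eq_finite[OF I] by auto
  have eq: "emeasure (PiM I (\<lambda>_. K x)) A = (\<Prod>i\<in>I. emeasure (K x) (X i))" if x: "x \<in> space L" for x
  proof -
    interpret Kx: prob_space "K x" using kernel_prob[OF K x] by simp
    interpret P: product_prob_space "\<lambda>_. K x" I by standard
    show ?thesis unfolding A using X kernel_prob[OF K x] I by (intro P.emeasure_PiM) auto
  qed
  have "(\<lambda>x. \<Prod>i\<in>I. emeasure (K x) (X i)) \<in> borel_measurable L"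
    using X by (intro borel_measurable_prod_ennreal measurable_emeasure_kernel[OF measurable_prob_algebraD[OF K]])
  then show "(\<lambda>x. emeasure (PiM I (\<lambda>_. K x)) A) \<in> borel_measurable L"
    by (subst measurable_cong[OF eq]) auto
qed

section \<open>Empirical means of independent samples\<close>

definition emean :: "nat \<Rightarrow> ('a \<Rightarrow> real) \<Rightarrow> (nat \<Rightarrow> 'a) \<Rightarrow> real" where
  "emean N f v = (\<Sum>i=1..N. f (v i)) / real N"

lemma emean_measurable:
  assumes "f \<in> borel_measurable S" "sets K = sets S"
  shows "emean N f \<in> borel_measurable (\<Pi>\<^sub>M i\<in>{1..N}. K)"
proof -
  have [measurable]: "f \<in> borel_measurable K" using assms by (simp cong: measurable_cong_sets)
  show ?thesis unfolding emean_def[abs_def] by measurable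
qed

lemma emean_bound:
  assumes "\<And>x. \<bar>f x\<bar> \<le> B" "0 \<le> B"
  shows "\<bar>emean N f v\<bar> \<le> B"
proof (cases "N = 0")
  case False
  have "\<bar>\<Sum>i=1..N. f (v i)\<bar> \<le> (\<Sum>i=1..N. B)"
    by (rule order_trans[OF sum_abs sum_mono]) (rule assms)
  with False show ?thesis
    by (simp add: emean_def abs_divide divide_le_eq mult.commute)
qed (simp add: emean_def assms)

lemma emean_diff: "emean N (\<lambda>x. f x - g x) v = emean N f v - emean N g v"
  by (simp add: emean_def sum_subtractf diff_divide_distrib)

lemma emean_cmult: "emean N (\<lambda>x. c * f x) v = c * emean N f v"
  by (simp add: emean_def sum_distrib_left)

text \<open>The centred summands have pairwise vanishing covariances, so of the \<open>N\<^sup>2\<close> terms in the expanded square only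
  the \<open>N\<close> diagonal ones survive, and the normalisation divides by \<open>N\<^sup>2\<close>.\<close>

lemma (in prob_space) emean_iid_variance:
  fixes f :: "'a \<Rightarrow> real"
  assumes f: "f \<in> borel_measurable M" and B: "\<And>x. \<bar>f x\<bar> \<le> B" and N: "N \<ge> 1"
  shows "(\<integral>v. (emean N f v - expectation f)\<^sup>2 \<partial>(\<Pi>\<^sub>M i\<in>{1..N}. M)) \<le> 4 * B\<^sup>2 / real N"
proof -
  interpret P: product_prob_space "\<lambda>_. M" "{1..N}" by standard
  define g where "g x = f x - expectation f" for x
  have B0: "0 \<le> B" using B[of undefined] by linarith
  have m: "\<bar>expectation f\<bar> \<le> B"
    using norm_integral_bounded[of f B] B B0 by auto
  have g: "\<bar>g x\<bar> \<le> 2 * B" for x using B[of x] m by (simp add: g_def)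
  have gm[measurable]: "g \<in> borel_measurable M" using f unfolding g_def by measurable
  have intf: "integrable M f" using f B by (intro integrable_bounded[of _ B]) auto
  have intg: "integrable M g" using gm g by (intro integrable_bounded[of _ "2*B"]) auto
  have g0: "expectation g = 0"
    unfolding g_def using intf by (simp add: prob_space)
  have bnd: "\<bar>g x * g y\<bar> \<le> 4 * B\<^sup>2" for x y
    using mult_mono[OF g[of x] g[of y]] B0 by (simp add: abs_mult power2_eq_square algebra_simps)
  have off: "(\<integral>v. g (v i) * g (v j) \<partial>PiM {1..N} (\<lambda>_. M)) = 0"
    if ij: "i \<in> {1..N}" "j \<in> {1..N}" "i \<noteq> j" for i j
  proof -
    (* g (v i) * g (v j) as a product over all coordinates, so that the product rule applies *)
    define h where "h k = (if k \<in> {i, j} then g else (\<lambda>_. 1))" for k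
    have inth: "integrable M (h k)" for k using intg by (simp add: h_def)
    have "(\<Prod>k\<in>{1..N}. h k (v k)) = g (v i) * g (v j)" for v
    proof -
      have "(\<Prod>k\<in>{1..N}. h k (v k)) = (\<Prod>k\<in>{1..N}. if k \<in> {i, j} then g (v k) else 1)"
        by (intro prod.cong) (auto simp: h_def)
      also have "\<dots> = (\<Prod>k\<in>{1..N} \<inter> {i, j}. g (v k))"
        by (rule prod.inter_restrict[symmetric]) simp
      also have "{1..N} \<inter> {i, j} = {i, j}" using ij by auto
      finally show ?thesis using ij by simp
    qed
    then have "(\<integral>v. g (v i) * g (v j) \<partial>PiM {1..N} (\<lambda>_. M)) = (\<integral>v. (\<Prod>k\<in>{1..N}. h k (v k)) \<partial>PiM {1..N} (\<lambda>_. M))"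
      by simp
    also have "\<dots> = (\<Prod>k\<in>{1..N}. integral\<^sup>L M (h k))"
      using inth by (intro P.product_integral_prod) auto
    also have "\<dots> = 0"
      using ij g0 by (intro prod_zero) (auto simp: h_def intro!: bexI[of _ i])
    finally show ?thesis .
  qed
  have diag: "(\<integral>v. g (v i) * g (v i) \<partial>PiM {1..N} (\<lambda>_. M)) \<le> 4 * B\<^sup>2" for i
    using bnd by (intro P.integral_le_bound) (auto intro: order_trans[OF abs_ge_self])
  have gi[measurable]: "(\<lambda>v. g (v i)) \<in> borel_measurable (PiM {1..N} (\<lambda>_. M))" if "i \<in> {1..N}" for i
    using that by measurable
  have int2: "integrable (PiM {1..N} (\<lambda>_. M)) (\<lambda>v. g (v i) * g (v j))" if "i \<in> {1..N}" "j \<in> {1..N}" for i j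
    using bnd that by (intro P.integrable_bounded[of _ "4*B\<^sup>2"]) auto
  have "emean N f v - expectation f = (\<Sum>i=1..N. g (v i)) / real N" for v
    using N by (simp add: emean_def g_def sum_subtractf diff_divide_distrib)
  then have "(emean N f v - expectation f)\<^sup>2 = (\<Sum>i=1..N. \<Sum>j=1..N. g (v i) * g (v j)) / (real N)\<^sup>2" for v
    by (simp add: power_divide power2_eq_square sum_product)
  moreover have "(\<integral>v. (\<Sum>i=1..N. \<Sum>j=1..N. g (v i) * g (v j)) \<partial>PiM {1..N} (\<lambda>_. M))
    = (\<Sum>i=1..N. \<Sum>j=1..N. \<integral>v. g (v i) * g (v j) \<partial>PiM {1..N} (\<lambda>_. M))"
    using int2 by (subst Bochner_Integration.integral_sum)
      (auto simp: Bochner_Integration.integral_sum intro!: Bochner_Integration.integrable_sum sum.cong)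
  ultimately have "(\<integral>v. (emean N f v - expectation f)\<^sup>2 \<partial>(\<Pi>\<^sub>M i\<in>{1..N}. M))
    = (\<Sum>i=1..N. \<Sum>j=1..N. \<integral>v. g (v i) * g (v j) \<partial>PiM {1..N} (\<lambda>_. M)) / (real N)\<^sup>2"
    by simp
  also have "\<dots> \<le> (\<Sum>i=1..N. 4 * B\<^sup>2) / (real N)\<^sup>2"
  proof (intro divide_right_mono sum_mono)
    fix i assume i: "i \<in> {1..N}"
    have "(\<Sum>j=1..N. \<integral>v. g (v i) * g (v j) \<partial>PiM {1..N} (\<lambda>_. M))
      = (\<Sum>j\<in>{i}. \<integral>v. g (v i) * g (v j) \<partial>PiM {1..N} (\<lambda>_. M))"
      using i off by (intro sum.mono_neutral_right) auto
    then show "(\<Sum>j=1..N. \<integral>v. g (v i) * g (v j) \<partial>PiM {1..N} (\<lambda>_. M)) \<le> 4 * B\<^sup>2"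
      using diag[of i] by simp
  qed simp
  also have "\<dots> = 4 * B\<^sup>2 / real N" using N by (simp add: power2_eq_square)
  finally show ?thesis .
qed

lemma exp_minus_quadratic:
  fixes y :: real
  assumes "0 \<le> y"
  shows "\<bar>exp (- y) - (1 - y)\<bar> \<le> y\<^sup>2 / 2"
proof -
  have "1 \<le> (1 - y + y\<^sup>2 / 2) * (1 + y + y\<^sup>2 / 2)"
    using zero_le_power[of "y\<^sup>2" 2] by (simp add: algebra_simps power2_eq_square)
  also have "\<dots> \<le> (1 - y + y\<^sup>2 / 2) * exp y"
  proof (rule mult_left_mono[OF exp_lower_Taylor_quadratic[OF assms]])
    have "0 \<le> (1 - y)\<^sup>2 + 1" by simp
    then show "0 \<le> 1 - y + y\<^sup>2 / 2" by (simp add: power2_eq_square algebra_simps)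
  qed
  finally have "exp (- y) \<le> 1 - y + y\<^sup>2 / 2"
    by (simp add: exp_minus divide_simps mult.commute)
  moreover have "1 + (- y) \<le> exp (- y)" by (rule exp_ge_add_one_self)
  ultimately show ?thesis by linarith
qed

text \<open>A central limit theorem with a rate. Expanding the characteristic function of one centred summand to
  second order at \<open>t / sqrt N\<close> leaves an error of order \<open>N\<close> to the power \<open>-3/2\<close>, and taking \<open>N\<close>-th powers of
  numbers in the unit disc multiplies it by at most \<open>N\<close>. The constant involves only \<open>t\<close> and the bound \<open>B\<close>:
  the law that is sampled will itself be random, and the estimate has to be uniform in it.\<close>

lemma (in prob_space) char_emean_iid:
  fixes f :: "'a \<Rightarrow> real" and t :: real
  assumes f: "f \<in> borel_measurable M" and B: "\<And>x. \<bar>f x\<bar> \<le> B" and N: "N \<ge> 1"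
  shows "norm ((\<integral>v. iexp (t * (sqrt (real N) * (emean N f v - expectation f))) \<partial>(\<Pi>\<^sub>M i\<in>{1..N}. M))
      - of_real (exp (- (t\<^sup>2 * variance f / 2)))) \<le> (2 * \<bar>t\<bar>^3 * B^3 + 2 * t^4 * B^4) / sqrt (real N)"
proof -
  interpret P: product_prob_space "\<lambda>_. M" "{1..N}" by standard
  define g where "g x = f x - expectation f" for x
  define s where "s = t / sqrt (real N)"
  define V where "V = variance f"
  have B0: "0 \<le> B" using B[of undefined] by linarith
  have m: "\<bar>expectation f\<bar> \<le> B"
    using norm_integral_bounded[of f B] B B0 by auto
  have g: "\<bar>g x\<bar> \<le> 2 * B" for x using B[of x] m by (simp add: g_def)
  have gm[measurable]: "g \<in> borel_measurable M" using f unfolding g_def by measurable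
  have intf: "integrable M f" using f B by (intro integrable_bounded[of _ B]) auto
  have intg: "integrable M g" using gm g by (intro integrable_bounded[of _ "2*B"]) auto
  have g0: "expectation g = 0"
    unfolding g_def using intf by (simp add: prob_space)
  have g2: "(g x)\<^sup>2 \<le> 4 * B\<^sup>2" for x
    using power_mono[OF g[of x] abs_ge_zero, of 2] by (simp add: power_mult_distrib)
  have intg2: "integrable M (\<lambda>x. (g x)\<^sup>2)" using g2 by (intro integrable_bounded[of _ "4*B\<^sup>2"]) auto
  have V: "V = expectation (\<lambda>x. (g x)\<^sup>2)" by (simp add: V_def g_def)
  have V0: "0 \<le> V" unfolding V by simp
  have VB: "V \<le> 4 * B\<^sup>2" unfolding V using g2 by (intro integral_le_bound) auto
  define D where "D = char (distr M borel g) s"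
  have varg: "variance g = V" unfolding g0 V by simp
  have "(\<integral>v. iexp (t * (sqrt (real N) * (emean N f v - expectation f))) \<partial>(\<Pi>\<^sub>M i\<in>{1..N}. M))
    = (\<integral>v. (\<Prod>i=1..N. iexp (s * g (v i))) \<partial>(\<Pi>\<^sub>M i\<in>{1..N}. M))"
  proof (intro Bochner_Integration.integral_cong refl)
    fix v :: "nat \<Rightarrow> 'a"
    have "t * (sqrt (real N) * (emean N f v - expectation f)) = (\<Sum>i=1..N. s * g (v i))"
    proof -
      have "(\<Sum>i=1..N. s * g (v i)) = s * (\<Sum>i=1..N. g (v i))" by (simp add: sum_distrib_left)
      also have "(\<Sum>i=1..N. g (v i)) = real N * (emean N f v - expectation f)"
        using N by (simp add: emean_def g_def sum_subtractf field_simps)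
      also have "s * \<dots> = t * ((real N / sqrt (real N)) * (emean N f v - expectation f))"
        by (simp add: s_def)
      also have "real N / sqrt (real N) = sqrt (real N)" by (simp add: real_div_sqrt)
      finally show ?thesis by simp
    qed
    then show "iexp (t * (sqrt (real N) * (emean N f v - expectation f))) = (\<Prod>i=1..N. iexp (s * g (v i)))"
      by (simp add: exp_sum sum_distrib_left)
  qed
  also have "\<dots> = (\<Prod>i=1..N. \<integral>x. iexp (s * g x) \<partial>M)"
    by (intro P.product_integral_prod integrable_iexp) auto
  also have "\<dots> = D ^ N"
    by (simp add: D_def char_def integral_distr)
  finally have eq: "(\<integral>v. iexp (t * (sqrt (real N) * (emean N f v - expectation f))) \<partial>(\<Pi>\<^sub>M i\<in>{1..N}. M)) = D ^ N" .
  define y where "y = s\<^sup>2 * V / 2"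
  have y0: "0 \<le> y" using V0 by (simp add: y_def)
  have sN: "real N * s\<^sup>2 = t\<^sup>2" using N by (simp add: s_def power_divide)
  have e: "exp (- (t\<^sup>2 * V / 2)) = exp (- y) ^ N"
    by (simp add: exp_of_nat_mult[symmetric] y_def sN[symmetric])
  interpret gd: real_distribution "distr M borel g" by (rule real_distribution_distr[OF gm])
  have D1: "norm D \<le> 1" unfolding D_def by (rule gd.cmod_char_le_1)
  have "norm (D - of_real (1 - y)) \<le> (s\<^sup>2 / 6) * expectation (\<lambda>x. min (6 * (g x)\<^sup>2) (\<bar>s\<bar> * \<bar>g x\<bar>^3))"
    unfolding D_def y_def of_real_diff of_real_1
    using char_approx3'[OF gm intg intg2 g0 varg refl, of s] by simp
  also have "\<dots> \<le> (s\<^sup>2 / 6) * (\<bar>s\<bar> * (2 * B)^3)"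
  proof (intro mult_left_mono integral_le_bound)
    fix x show "min (6 * (g x)\<^sup>2) (\<bar>s\<bar> * \<bar>g x\<bar> ^ 3) \<le> \<bar>s\<bar> * (2 * B) ^ 3"
      using power_mono[OF g[of x] abs_ge_zero, of 3] by (intro min.coboundedI2 mult_left_mono) auto
  qed (use B0 in auto)
  finally have a1: "norm (D - of_real (1 - y)) \<le> \<bar>s\<bar>^3 * (8 * B^3) / 6"
    by (simp add: power3_eq_cube power2_eq_square mult_ac)
  have "y \<le> s\<^sup>2 * (4 * B\<^sup>2) / 2" unfolding y_def using VB
    by (intro divide_right_mono mult_left_mono) auto
  then have "y\<^sup>2 \<le> (s\<^sup>2 * (4 * B\<^sup>2) / 2)\<^sup>2" using y0 by (rule power_mono)
  then have "y\<^sup>2 / 2 \<le> 2 * s^4 * B^4" by (simp add: power2_eq_square power4_eq_xxxx mult_ac)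
  with exp_minus_quadratic[OF y0] have "\<bar>exp (- y) - (1 - y)\<bar> \<le> 2 * s^4 * B^4" by linarith
  then have a2: "norm (complex_of_real (1 - y) - of_real (exp (- y))) \<le> 2 * s^4 * B^4"
    by (metis abs_minus_commute norm_of_real of_real_diff)
  have "norm (D ^ N - of_real (exp (- (t\<^sup>2 * V / 2)))) = norm (D ^ N - (of_real (exp (- y))) ^ N)"
    unfolding e by simp
  also have "\<dots> \<le> real N * norm (D - of_real (exp (- y)))"
    using D1 y0 by (intro norm_power_diff) auto
  also have "\<dots> \<le> real N * (\<bar>s\<bar>^3 * (8 * B^3) / 6 + 2 * s^4 * B^4)"
    using norm_triangle_ineq[of "D - of_real (1 - y)" "of_real (1 - y) - of_real (exp (- y))"] a1 a2
    by (intro mult_left_mono) auto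
  also have "\<dots> = (real N * s\<^sup>2) * (\<bar>s\<bar> * (8 * B^3) / 6 + 2 * s\<^sup>2 * B^4)"
    by (simp add: power3_eq_cube power2_eq_square power4_eq_xxxx algebra_simps abs_mult_self_eq)
  also have "\<dots> = t\<^sup>2 * (\<bar>s\<bar> * (8 * B^3) / 6 + 2 * s\<^sup>2 * B^4)" by (simp only: sN)
  also have "\<dots> \<le> t\<^sup>2 * ((\<bar>t\<bar> / sqrt (real N)) * (2 * B^3) + 2 * (t\<^sup>2 / sqrt (real N)) * B^4)"
  proof (intro mult_left_mono add_mono mult_right_mono)
    have "(\<bar>t\<bar> / sqrt (real N)) * (8 * B^3 / 6) \<le> (\<bar>t\<bar> / sqrt (real N)) * (2 * B^3)"
      using B0 by (intro mult_left_mono) auto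
    then show "\<bar>s\<bar> * (8 * B^3) / 6 \<le> (\<bar>t\<bar> / sqrt (real N)) * (2 * B^3)"
      by (simp add: s_def abs_divide)
    have "sqrt (real N) \<le> real N"
      using N by (intro real_le_lsqrt) (auto simp: power2_eq_square)
    then show "s\<^sup>2 \<le> t\<^sup>2 / sqrt (real N)"
      unfolding s_def power_divide using N by (simp add: frac_le)
  qed (use B0 in auto)
  also have "\<dots> = (2 * \<bar>t\<bar>^3 * B^3 + 2 * t^4 * B^4) / sqrt (real N)"
    by (simp add: power3_eq_cube power2_eq_square power4_eq_xxxx add_divide_distrib algebra_simps)
  finally show ?thesis unfolding eq V_def .
qed

section \<open>The quantile coupling\<close>

abbreviation unif :: "real measure" where
  "unif \<equiv> restrict_space lborel {0<..<1}"

lemma prob_space_unif: "prob_space unif"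
  by (auto simp: emeasure_restrict_space space_restrict_space intro!: prob_spaceI)

lemma space_unif: "space unif = {0<..<1}"
  by (simp add: space_restrict_space)

lemma real_distribution_prob_algebra:
  "\<mu> \<in> space (prob_algebra borel) \<Longrightarrow> real_distribution \<mu>"
  by (simp add: space_prob_algebra real_distribution_def real_distribution_axioms_def)

text \<open>The Galois connection between quantile function and distribution function. It turns every statement
  about quantiles below into one about distribution functions.\<close>

lemma quantile_le_iff:
  assumes "real_distribution \<mu>" "0 < w" "w < 1"
  shows "quantile \<mu> w \<le> x \<longleftrightarrow> w \<le> cdf \<mu> x"
proof -
  interpret cdf_distribution \<mu> using assms(1) by (simp add: cdf_distribution_def)
  show ?thesis using pseudoinverse[OF assms(2,3), of x] by (simp add: quantile_def)
qed

lemma quantile_measurable: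
  assumes "real_distribution \<mu>"
  shows "quantile \<mu> \<in> borel_measurable unif"
proof -
  interpret cdf_distribution \<mu> using assms(1) by (simp add: cdf_distribution_def)
  have "sets (restrict_space borel {0<..<1::real}) = sets unif"
    by (rule sets_restrict_space_cong) simp
  with measurable_CI show ?thesis by (simp add: quantile_def[abs_def] cong: measurable_cong_sets)
qed

lemma distr_quantile:
  assumes "real_distribution \<mu>"
  shows "distr unif borel (quantile \<mu>) = \<mu>"
proof -
  interpret cdf_distribution \<mu> using assms(1) by (simp add: cdf_distribution_def)
  show ?thesis using distr_I_eq_M by (simp add: quantile_def[abs_def])
qed

text \<open>Joint measurability in the parameter and the level: by the Galois connection a sublevel set of the
  quantile is the set where the level lies below a distribution function.\<close>

lemma quantile_kernel_measurable:
  assumes \<mu>: "\<mu> \<in> L \<rightarrow>\<^sub>M prob_algebra borel"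
  shows "(\<lambda>(a, w). quantile (\<mu> a) w) \<in> borel_measurable (L \<Otimes>\<^sub>M unif)"
proof (rule borel_measurableI_le)
  fix x :: real
  have F: "(\<lambda>a. measure (\<mu> a) {..x}) \<in> borel_measurable L"
    by (rule measurable_compose[OF measurable_prob_algebraD[OF \<mu>] measurable_measure_subprob_algebra]) simp
  have id: "(\<lambda>w::real. w) \<in> borel_measurable unif"
    by (intro measurable_restrict_space1) simp
  have "{p \<in> space (L \<Otimes>\<^sub>M unif). (case p of (a, w) \<Rightarrow> quantile (\<mu> a) w) \<le> x}
    = {p \<in> space (L \<Otimes>\<^sub>M unif). snd p \<le> measure (\<mu> (fst p)) {..x}}"
    using quantile_le_iff[OF real_distribution_prob_algebra[OF measurable_space[OF \<mu>]]]
    by (auto simp: space_pair_measure space_unif cdf_def)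
  moreover have "\<dots> \<in> sets (L \<Otimes>\<^sub>M unif)"
    using measurable_compose[OF measurable_fst F] measurable_compose[OF measurable_snd id]
    by measurable
  ultimately show "{p \<in> space (L \<Otimes>\<^sub>M unif). (case p of (a, w) \<Rightarrow> quantile (\<mu> a) w) \<le> x} \<in> sets (L \<Otimes>\<^sub>M unif)"
    by simp
qed

lemma wasserstein_step_measurable:
  assumes K: "K \<in> borel \<rightarrow>\<^sub>M prob_algebra borel"
    and \<mu>: "\<mu> \<in> L \<rightarrow>\<^sub>M prob_algebra borel" and \<nu>: "\<nu> \<in> L \<rightarrow>\<^sub>M prob_algebra borel"
  shows "(\<lambda>a. wasserstein_step K (\<mu> a) (\<nu> a)) \<in> L \<rightarrow>\<^sub>M prob_algebra borel"
  unfolding wasserstein_step_def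
proof (rule measurable_bind_prob_space2)
  show "(\<lambda>a. unif) \<in> L \<rightarrow>\<^sub>M prob_algebra unif"
    by (rule measurable_const) (simp add: space_prob_algebra prob_space_unif)
  have "(\<lambda>p. (case p of (a, w) \<Rightarrow> quantile (\<mu> a) w, case p of (a, w) \<Rightarrow> quantile (\<nu> a) w))
      \<in> borel_measurable (L \<Otimes>\<^sub>M unif)"
    using quantile_kernel_measurable[OF \<mu>] quantile_kernel_measurable[OF \<nu>]
    by (rule borel_measurable_Pair)
  from measurable_compose[OF this K]
  show "(\<lambda>(a, w). K (quantile (\<mu> a) w, quantile (\<nu> a) w)) \<in> L \<Otimes>\<^sub>M unif \<rightarrow>\<^sub>M prob_algebra borel"
    by (simp add: case_prod_beta)
qed

lemma quantile_kernel:
  assumes K: "K \<in> borel \<rightarrow>\<^sub>M prob_algebra borel"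
    and \<mu>: "real_distribution \<mu>" and \<nu>: "real_distribution \<nu>"
  shows "(\<lambda>w. K (quantile \<mu> w, quantile \<nu> w)) \<in> unif \<rightarrow>\<^sub>M prob_algebra borel"
  by (rule measurable_compose[OF borel_measurable_Pair K])
    (rule quantile_measurable[OF \<mu>] quantile_measurable[OF \<nu>])+

lemma wasserstein_step_prob:
  assumes K: "K \<in> borel \<rightarrow>\<^sub>M prob_algebra borel"
    and \<mu>: "real_distribution \<mu>" and \<nu>: "real_distribution \<nu>"
  shows "wasserstein_step K \<mu> \<nu> \<in> space (prob_algebra borel)"
proof -
  have u: "unif \<in> space (prob_algebra unif)" by (simp add: space_prob_algebra prob_space_unif)
  show ?thesis unfolding wasserstein_step_def space_prob_algebra
    using prob_space_bind'[OF u quantile_kernel[OF assms]] sets_bind'[OF u quantile_kernel[OF assms]]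
    by simp
qed

lemma wasserstein_step_integral:
  assumes K: "K \<in> borel \<rightarrow>\<^sub>M prob_algebra borel"
    and \<mu>: "real_distribution \<mu>" and \<nu>: "real_distribution \<nu>"
    and f: "f \<in> borel_measurable borel" "\<And>x. \<bar>f x\<bar> \<le> B"
  shows "(\<integral>v. f v \<partial>wasserstein_step K \<mu> \<nu>) = (\<integral>w. kernel_op K f (quantile \<mu> w, quantile \<nu> w) \<partial>unif)"
  unfolding wasserstein_step_def kernel_op_def
  using prob_space_unif quantile_kernel[OF K \<mu> \<nu>] f by (rule integral_bind_kernel)

text \<open>The first marginal of the step is \<open>\<mu>\<close> moved by the marginal kernel: the quantile function
  pushes the uniform law forward to \<open>\<mu>\<close>, whatever \<open>\<nu>\<close> is.\<close>

lemma wasserstein_step_fst: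
  assumes K: "K \<in> borel \<rightarrow>\<^sub>M prob_algebra borel"
    and \<mu>: "real_distribution \<mu>" and \<nu>: "real_distribution \<nu>"
    and f: "f \<in> borel_measurable borel" "\<And>x. \<bar>f x\<bar> \<le> B"
    and k: "k \<in> borel_measurable borel" "\<And>x x'. kernel_op K (\<lambda>v. f (fst v)) (x, x') = k x"
  shows "(\<integral>v. f (fst v) \<partial>wasserstein_step K \<mu> \<nu>) = (\<integral>x. k x \<partial>\<mu>)"
proof -
  have "(\<lambda>v :: real \<times> real. f (fst v)) \<in> borel_measurable (borel \<Otimes>\<^sub>M borel)"
    by (rule measurable_compose[OF measurable_fst f(1)])
  then have m: "(\<lambda>v :: real \<times> real. f (fst v)) \<in> borel_measurable borel" unfolding borel_prod .
  have "(\<integral>v. f (fst v) \<partial>wasserstein_step K \<mu> \<nu>) = (\<integral>w. k (quantile \<mu> w) \<partial>unif)"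
    by (subst wasserstein_step_integral[OF K \<mu> \<nu> m f(2)]) (simp add: k(2))
  also have "\<dots> = (\<integral>x. k x \<partial>distr unif borel (quantile \<mu>))"
    by (rule integral_distr[OF quantile_measurable[OF \<mu>] k(1), symmetric])
  finally show ?thesis by (simp add: distr_quantile[OF \<mu>])
qed

lemma wasserstein_step_snd:
  assumes K: "K \<in> borel \<rightarrow>\<^sub>M prob_algebra borel"
    and \<mu>: "real_distribution \<mu>" and \<nu>: "real_distribution \<nu>"
    and f: "f \<in> borel_measurable borel" "\<And>x. \<bar>f x\<bar> \<le> B"
    and k: "k \<in> borel_measurable borel" "\<And>x x'. kernel_op K (\<lambda>v. f (snd v)) (x, x') = k x'"
  shows "(\<integral>v. f (snd v) \<partial>wasserstein_step K \<mu> \<nu>) = (\<integral>x. k x \<partial>\<nu>)"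
proof -
  have "(\<lambda>v :: real \<times> real. f (snd v)) \<in> borel_measurable (borel \<Otimes>\<^sub>M borel)"
    by (rule measurable_compose[OF measurable_snd f(1)])
  then have m: "(\<lambda>v :: real \<times> real. f (snd v)) \<in> borel_measurable borel" unfolding borel_prod .
  have "(\<integral>v. f (snd v) \<partial>wasserstein_step K \<mu> \<nu>) = (\<integral>w. k (quantile \<nu> w) \<partial>unif)"
    by (subst wasserstein_step_integral[OF K \<mu> \<nu> m f(2)]) (simp add: k(2))
  also have "\<dots> = (\<integral>x. k x \<partial>distr unif borel (quantile \<nu>))"
    by (rule integral_distr[OF quantile_measurable[OF \<nu>] k(1), symmetric])
  finally show ?thesis by (simp add: distr_quantile[OF \<nu>])
qed

text \<open>The lower bound is the Galois connection applied just below the limiting quantile. The upper bound needs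
  a level above \<open>w\<close> whose quantile is still close to that of \<open>w\<close>, and this is where continuity of the limiting
  quantile function enters.\<close>

lemma quantile_tendsto:
  assumes \<mu>s: "\<And>k. real_distribution (\<mu>s k)" and \<mu>: "real_distribution \<mu>"
    and conv: "\<And>x. (\<lambda>k. cdf (\<mu>s k) x) \<longlonglongrightarrow> cdf \<mu> x"
    and cont: "continuous_on {0<..<1} (quantile \<mu>)" and w: "w \<in> {0<..<1}"
  shows "(\<lambda>k. quantile (\<mu>s k) w) \<longlonglongrightarrow> quantile \<mu> w"
proof (rule order_tendstoI)
  fix a assume a: "a < quantile \<mu> w"
  obtain b where b: "a < b" "b < quantile \<mu> w" using dense[OF a] by blast
  then have "cdf \<mu> b < w" using quantile_le_iff[OF \<mu>, of w b] w by auto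
  then have "\<forall>\<^sub>F k in sequentially. cdf (\<mu>s k) b < w" by (rule order_tendstoD(2)[OF conv])
  then show "\<forall>\<^sub>F k in sequentially. a < quantile (\<mu>s k) w"
  proof eventually_elim
    case (elim k)
    then have "\<not> quantile (\<mu>s k) w \<le> b" using quantile_le_iff[OF \<mu>s, of w k b] w by auto
    with b show ?case by linarith
  qed
next
  fix a assume a: "quantile \<mu> w < a"
  have "isCont (quantile \<mu>) w"
    using cont w by (simp add: continuous_on_eq_continuous_at)
  then have "((quantile \<mu>) \<longlongrightarrow> quantile \<mu> w) (at_right w)"
    by (simp add: isCont_def filterlim_at_split)
  from order_tendstoD(2)[OF this a] have "\<forall>\<^sub>F w' in at_right w. quantile \<mu> w' < a" .
  moreover have "\<forall>\<^sub>F w' in at_right w. w < w' \<and> w' < 1"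
    using w by (auto simp: eventually_at_right[of w 1])
  ultimately have "\<forall>\<^sub>F w' in at_right w. quantile \<mu> w' < a \<and> w < w' \<and> w' < 1"
    by eventually_elim auto
  then obtain w' where w': "quantile \<mu> w' < a" "w < w'" "w' < 1"
    using eventually_happens'[OF trivial_limit_at_right_real] by blast
  obtain b where b: "quantile \<mu> w' < b" "b < a" using dense[OF w'(1)] by blast
  then have "w < cdf \<mu> b" using quantile_le_iff[OF \<mu>, of w' b] w w' by auto
  then have "\<forall>\<^sub>F k in sequentially. w < cdf (\<mu>s k) b" by (rule order_tendstoD(1)[OF conv])
  then show "\<forall>\<^sub>F k in sequentially. quantile (\<mu>s k) w < a"
  proof eventually_elim
    case (elim k)
    then have "quantile (\<mu>s k) w \<le> b" using quantile_le_iff[OF \<mu>s, of w k b] w by auto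
    with b show ?case by linarith
  qed
qed

text \<open>The integral against the step is a uniform average over \<open>w\<close> of a bounded continuous function (Feller) of
  two quantiles, which converge for every \<open>w\<close>; dominated convergence applies.\<close>

lemma wasserstein_step_tendsto:
  assumes K: "K \<in> borel \<rightarrow>\<^sub>M prob_algebra borel" and feller: "feller K"
    and \<mu>s: "\<And>k. real_distribution (\<mu>s k)" and \<mu>: "real_distribution \<mu>"
    and \<nu>s: "\<And>k. real_distribution (\<nu>s k)" and \<nu>: "real_distribution \<nu>"
    and \<mu>conv: "\<And>x. (\<lambda>k. cdf (\<mu>s k) x) \<longlonglongrightarrow> cdf \<mu> x"
    and \<nu>conv: "\<And>x. (\<lambda>k. cdf (\<nu>s k) x) \<longlonglongrightarrow> cdf \<nu> x"
    and \<mu>cont: "continuous_on {0<..<1} (quantile \<mu>)"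
    and \<nu>cont: "continuous_on {0<..<1} (quantile \<nu>)"
    and f: "bounded_continuous f"
  shows "(\<lambda>k. \<integral>v. f v \<partial>wasserstein_step K (\<mu>s k) (\<nu>s k)) \<longlonglongrightarrow> (\<integral>v. f v \<partial>wasserstein_step K \<mu> \<nu>)"
proof -
  interpret U: prob_space unif by (rule prob_space_unif)
  obtain B where B: "\<And>x. \<bar>f x\<bar> \<le> B" using f bounded_continuous_bound by blast
  note fm = bounded_continuous_measurable[OF f]
  have Kf: "bounded_continuous (kernel_op K f)" using feller f by (simp add: feller_def)
  then obtain C where C: "\<And>x. \<bar>kernel_op K f x\<bar> \<le> C" using bounded_continuous_bound by blast
  note Kfm = bounded_continuous_measurable[OF Kf]
  have meas: "(\<lambda>w. kernel_op K f (quantile \<alpha> w, quantile \<beta> w)) \<in> borel_measurable unif"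
    if "real_distribution \<alpha>" "real_distribution \<beta>" for \<alpha> \<beta>
    by (rule measurable_compose[OF borel_measurable_Pair Kfm])
      (rule quantile_measurable[OF that(1)] quantile_measurable[OF that(2)])+
  have "(\<lambda>k. \<integral>w. kernel_op K f (quantile (\<mu>s k) w, quantile (\<nu>s k) w) \<partial>unif)
     \<longlonglongrightarrow> (\<integral>w. kernel_op K f (quantile \<mu> w, quantile \<nu> w) \<partial>unif)"
  proof (rule integral_dominated_convergence[where w = "\<lambda>_. C"])
    show "AE w in unif. (\<lambda>k. kernel_op K f (quantile (\<mu>s k) w, quantile (\<nu>s k) w))
        \<longlonglongrightarrow> kernel_op K f (quantile \<mu> w, quantile \<nu> w)"
    proof (rule AE_I2)
      fix w assume "w \<in> space unif"
      then have w: "w \<in> {0<..<1}" by (simp add: space_unif)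
      have "(\<lambda>k. (quantile (\<mu>s k) w, quantile (\<nu>s k) w)) \<longlonglongrightarrow> (quantile \<mu> w, quantile \<nu> w)"
        by (intro tendsto_Pair quantile_tendsto assms w)
      moreover have "isCont (kernel_op K f) (quantile \<mu> w, quantile \<nu> w)"
        using Kf by (simp add: bounded_continuous_def continuous_on_eq_continuous_at)
      ultimately show "(\<lambda>k. kernel_op K f (quantile (\<mu>s k) w, quantile (\<nu>s k) w))
        \<longlonglongrightarrow> kernel_op K f (quantile \<mu> w, quantile \<nu> w)"
        by (rule isCont_tendsto_compose[rotated])
    qed
  qed (use C meas \<mu>s \<nu>s \<mu> \<nu> in auto)
  then show ?thesis
    by (simp add: wasserstein_step_integral[OF K \<mu>s \<nu>s fm B] wasserstein_step_integral[OF K \<mu> \<nu> fm B])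
qed

lemma cts_step_bounded_continuous:
  assumes "a < b" shows "bounded_continuous (cts_step a b)"
proof (rule bounded_continuousI[of _ 1])
  show "continuous_on UNIV (cts_step a b)"
    by (intro uniformly_continuous_imp_continuous cts_step_uniformly_continuous assms)
  fix x
  have "(b - x) / (b - a) \<le> 1" if "a < x" using assms that by (simp add: divide_le_eq)
  moreover have "0 \<le> (b - x) / (b - a)" if "x < b" using assms that by simp
  ultimately show "\<bar>cts_step a b x\<bar> \<le> 1" unfolding cts_step_def by (cases "x \<le> a"; cases "b \<le> x") simp_all
qed

text \<open>Continuous steps with rational corners bracket indicators of half-lines, so this countable family of test
  functions determines convergence to a law with continuous distribution function.\<close>

lemma cdf_tendsto_of_rational_steps:
  assumes \<mu>s: "\<And>k. real_distribution (\<mu>s k)" and \<mu>: "real_distribution \<mu>"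
    and conv: "\<And>a b. a \<in> \<rat> \<Longrightarrow> b \<in> \<rat> \<Longrightarrow> a < b \<Longrightarrow>
      (\<lambda>k. \<integral>x. cts_step a b x \<partial>\<mu>s k) \<longlonglongrightarrow> (\<integral>x. cts_step a b x \<partial>\<mu>)"
    and cont: "continuous_on UNIV (cdf \<mu>)"
  shows "(\<lambda>k. cdf (\<mu>s k) x) \<longlonglongrightarrow> cdf \<mu> x"
proof (rule order_tendstoI)
  have F: "isCont (cdf \<mu>) x" using cont by (simp add: continuous_on_eq_continuous_at)
  interpret real_distribution \<mu> by fact
  have F_right: "((cdf \<mu>) \<longlongrightarrow> cdf \<mu> x) (at_right x)" and F_left: "((cdf \<mu>) \<longlongrightarrow> cdf \<mu> x) (at_left x)"
    using F by (simp_all add: isCont_def filterlim_at_split)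
  {
    fix c assume "cdf \<mu> x < c"
    from eventually_conj[OF eventually_at_right_less order_tendstoD(2)[OF F_right this]]
    obtain y where y: "x < y" "cdf \<mu> y < c"
      using eventually_happens'[OF trivial_limit_at_right_real] by blast
    obtain a where a: "a \<in> \<rat>" "x < a" "a < y" using Rats_dense_in_real[OF y(1)] by auto
    obtain b where b: "b \<in> \<rat>" "a < b" "b < y" using Rats_dense_in_real[OF a(3)] by auto
    have "(\<integral>x. cts_step a b x \<partial>\<mu>) \<le> cdf \<mu> b" using b by (simp add: cdf_cts_step)
    also have "\<dots> \<le> cdf \<mu> y" using b by (intro cdf_nondecreasing) simp
    finally have "\<forall>\<^sub>F k in sequentially. (\<integral>x. cts_step a b x \<partial>\<mu>s k) < c"
      using y by (intro order_tendstoD(2)[OF conv[OF a(1) b(1,2)]]) simp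
    then show "\<forall>\<^sub>F k in sequentially. cdf (\<mu>s k) x < c"
    proof eventually_elim
      case (elim k)
      interpret k: real_distribution "\<mu>s k" by fact
      have "cdf (\<mu>s k) x \<le> cdf (\<mu>s k) a" using a by (intro k.cdf_nondecreasing) simp
      also have "\<dots> \<le> (\<integral>x. cts_step a b x \<partial>\<mu>s k)" using b by (simp add: k.cdf_cts_step)
      finally show ?case using elim by simp
    qed
  next
    fix c assume "c < cdf \<mu> x"
    moreover have "\<forall>\<^sub>F y in at_left x. y < x" by (simp add: eventually_at_filter)
    ultimately have "\<forall>\<^sub>F y in at_left x. y < x \<and> c < cdf \<mu> y"
      using eventually_conj order_tendstoD(1)[OF F_left] by blast
    then obtain y where y: "y < x" "c < cdf \<mu> y"
      using eventually_happens'[OF trivial_limit_at_left_real] by blast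
    obtain b where b: "b \<in> \<rat>" "y < b" "b < x" using Rats_dense_in_real[OF y(1)] by auto
    obtain a where a: "a \<in> \<rat>" "y < a" "a < b" using Rats_dense_in_real[OF b(2)] by auto
    have "cdf \<mu> y \<le> cdf \<mu> a" using a by (intro cdf_nondecreasing) simp
    also have "\<dots> \<le> (\<integral>x. cts_step a b x \<partial>\<mu>)" using a by (simp add: cdf_cts_step)
    finally have "\<forall>\<^sub>F k in sequentially. c < (\<integral>x. cts_step a b x \<partial>\<mu>s k)"
      using y by (intro order_tendstoD(1)[OF conv[OF a(1) b(1) a(3)]]) simp
    then show "\<forall>\<^sub>F k in sequentially. c < cdf (\<mu>s k) x"
    proof eventually_elim
      case (elim k)
      interpret k: real_distribution "\<mu>s k" by fact
      have "(\<integral>x. cts_step a b x \<partial>\<mu>s k) \<le> cdf (\<mu>s k) b" using a by (simp add: k.cdf_cts_step)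
      also have "\<dots> \<le> cdf (\<mu>s k) x" using b by (intro k.cdf_nondecreasing) simp
      finally show ?case using elim by simp
    qed
  }
qed

text \<open>A quantitative form of continuity of the step at \<open>(\<mu>, \<nu>)\<close>. Unlike convergence along a sequence it
  holds pointwise for random arguments, so that expectations can be taken on both sides. The proof is by
  contradiction: otherwise there would be laws that agree with \<open>\<mu>\<close> and \<open>\<nu>\<close> ever better on the first \<open>k\<close>
  rational steps but keep the integrals apart, against \<open>wasserstein_step_tendsto\<close>. When one of the
  finitely many deviations exceeds \<open>1 / (k + 1)\<close>, the trivial bound \<open>2 B\<close> is absorbed by choosing
  \<open>C = 2 B (k + 1)\<close>.\<close>

lemma wasserstein_step_modulus:
  assumes K: "K \<in> borel \<rightarrow>\<^sub>M prob_algebra borel" and feller: "feller K"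
    and \<mu>: "real_distribution \<mu>" and \<nu>: "real_distribution \<nu>"
    and \<mu>F: "continuous_on UNIV (cdf \<mu>)" and \<nu>F: "continuous_on UNIV (cdf \<nu>)"
    and \<mu>q: "continuous_on {0<..<1} (quantile \<mu>)" and \<nu>q: "continuous_on {0<..<1} (quantile \<nu>)"
    and f: "bounded_continuous f" and e: "0 < e"
  shows "\<exists>(g :: nat \<Rightarrow> real \<Rightarrow> real) m C. (\<forall>j. bounded_continuous (g j)) \<and> 0 \<le> C \<and>
    (\<forall>\<mu>' \<nu>'. real_distribution \<mu>' \<longrightarrow> real_distribution \<nu>' \<longrightarrow>
      \<bar>(\<integral>v. f v \<partial>wasserstein_step K \<mu>' \<nu>') - (\<integral>v. f v \<partial>wasserstein_step K \<mu> \<nu>)\<bar>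
      \<le> e + C * (\<Sum>j<m. \<bar>(\<integral>x. g j x \<partial>\<mu>') - (\<integral>x. g j x \<partial>\<mu>)\<bar> + \<bar>(\<integral>x. g j x \<partial>\<nu>') - (\<integral>x. g j x \<partial>\<nu>)\<bar>))"
proof -
  define P where "P = {p :: real \<times> real. fst p \<in> \<rat> \<and> snd p \<in> \<rat> \<and> fst p < snd p}"
  have "P \<subseteq> \<rat> \<times> \<rat>" by (auto simp: P_def)
  then have cP: "countable P" by (rule countable_subset) (intro countable_SIGMA countable_rat)
  have "(0, 1) \<in> P" by (simp add: P_def)
  then have neP: "P \<noteq> {}" by auto
  define g where "g j = (case from_nat_into P j of (a, b) \<Rightarrow> cts_step a b)" for j
  have g: "bounded_continuous (g j)" for j
    using from_nat_into[OF neP, of j]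
    by (auto simp: g_def P_def case_prod_beta intro: cts_step_bounded_continuous)
  obtain B where B: "0 \<le> B" "\<And>x. \<bar>f x\<bar> \<le> B" using f bounded_continuous_bound by blast
  let ?d = "\<lambda>\<mu>' \<nu>'. \<bar>(\<integral>v. f v \<partial>wasserstein_step K \<mu>' \<nu>') - (\<integral>v. f v \<partial>wasserstein_step K \<mu> \<nu>)\<bar>"
  let ?s = "\<lambda>\<mu>' \<nu>' j. \<bar>(\<integral>x. g j x \<partial>\<mu>') - (\<integral>x. g j x \<partial>\<mu>)\<bar> + \<bar>(\<integral>x. g j x \<partial>\<nu>') - (\<integral>x. g j x \<partial>\<nu>)\<bar>"
  have int: "\<bar>\<integral>v. f v \<partial>wasserstein_step K \<alpha> \<beta>\<bar> \<le> B" if "real_distribution \<alpha>" "real_distribution \<beta>" for \<alpha> \<beta>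
  proof -
    interpret prob_space "wasserstein_step K \<alpha> \<beta>"
      using wasserstein_step_prob[OF K that] by (simp add: space_prob_algebra)
    show ?thesis using norm_integral_bounded[of f B] B by auto
  qed
  have "\<exists>k. \<forall>\<mu>' \<nu>'. real_distribution \<mu>' \<longrightarrow> real_distribution \<nu>' \<longrightarrow>
     (\<forall>j<k. ?s \<mu>' \<nu>' j \<le> 1 / real (Suc k)) \<longrightarrow> ?d \<mu>' \<nu>' \<le> e"
  proof (rule ccontr)
    assume "\<not> ?thesis"
    then have "\<forall>k. \<exists>\<mu>' \<nu>'. real_distribution \<mu>' \<and> real_distribution \<nu>' \<and>
     (\<forall>j<k. ?s \<mu>' \<nu>' j \<le> 1 / real (Suc k)) \<and> e < ?d \<mu>' \<nu>'"
      by (simp add: not_le)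
    then obtain \<mu>s \<nu>s where \<mu>s: "\<And>k. real_distribution (\<mu>s k)" and \<nu>s: "\<And>k. real_distribution (\<nu>s k)"
      and small: "\<And>k j. j < k \<Longrightarrow> ?s (\<mu>s k) (\<nu>s k) j \<le> 1 / real (Suc k)"
      and large: "\<And>k. e < ?d (\<mu>s k) (\<nu>s k)"
      by metis
    have lim: "(\<lambda>k. 1 / real (Suc k)) \<longlonglongrightarrow> 0"
      using LIMSEQ_inverse_real_of_nat by (simp add: inverse_eq_divide)
    have ev: "\<forall>\<^sub>F k in sequentially. ?s (\<mu>s k) (\<nu>s k) j \<le> 1 / real (Suc k)" for j
      using eventually_gt_at_top[of j] by eventually_elim (rule small)
    have g1: "(\<lambda>k. \<integral>x. g j x \<partial>\<mu>s k) \<longlonglongrightarrow> (\<integral>x. g j x \<partial>\<mu>)" for j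
      by (rule LIM_zero_cancel, rule Lim_null_comparison[OF eventually_mono[OF ev[of j]] lim]) auto
    have g2: "(\<lambda>k. \<integral>x. g j x \<partial>\<nu>s k) \<longlonglongrightarrow> (\<integral>x. g j x \<partial>\<nu>)" for j
      by (rule LIM_zero_cancel, rule Lim_null_comparison[OF eventually_mono[OF ev[of j]] lim]) auto
    have steps: "\<exists>j. g j = cts_step a b" if "a \<in> \<rat>" "b \<in> \<rat>" "a < b" for a b
    proof -
      have "(a, b) \<in> P" using that by (simp add: P_def)
      then show ?thesis using from_nat_into_surj[OF cP] by (metis g_def case_prod_conv)
    qed
    have "(\<lambda>k. \<integral>v. f v \<partial>wasserstein_step K (\<mu>s k) (\<nu>s k)) \<longlonglongrightarrow> (\<integral>v. f v \<partial>wasserstein_step K \<mu> \<nu>)"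
    proof (rule wasserstein_step_tendsto[OF K feller \<mu>s \<mu> \<nu>s \<nu> _ _ \<mu>q \<nu>q f])
      show "(\<lambda>k. cdf (\<mu>s k) x) \<longlonglongrightarrow> cdf \<mu> x" for x
        using g1 steps by (intro cdf_tendsto_of_rational_steps[OF \<mu>s \<mu> _ \<mu>F]) metis
      show "(\<lambda>k. cdf (\<nu>s k) x) \<longlonglongrightarrow> cdf \<nu> x" for x
        using g2 steps by (intro cdf_tendsto_of_rational_steps[OF \<nu>s \<nu> _ \<nu>F]) metis
    qed
    from tendstoD[OF this e] have "\<forall>\<^sub>F k in sequentially. ?d (\<mu>s k) (\<nu>s k) < e"
      by (simp add: dist_real_def)
    then obtain k where "?d (\<mu>s k) (\<nu>s k) < e"
      using eventually_happens'[OF sequentially_bot] by blast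
    with large[of k] show False by simp
  qed
  then obtain k where k: "\<And>\<mu>' \<nu>'. real_distribution \<mu>' \<Longrightarrow> real_distribution \<nu>' \<Longrightarrow>
     (\<And>j. j < k \<Longrightarrow> ?s \<mu>' \<nu>' j \<le> 1 / real (Suc k)) \<Longrightarrow> ?d \<mu>' \<nu>' \<le> e"
    by auto
  show ?thesis
  proof (intro exI[of _ g] exI[of _ k] exI[of _ "2 * B * real (Suc k)"] conjI allI impI)
    fix \<mu>' \<nu>' assume r: "real_distribution \<mu>'" "real_distribution \<nu>'"
    show "?d \<mu>' \<nu>' \<le> e + 2 * B * real (Suc k) * (\<Sum>j<k. ?s \<mu>' \<nu>' j)"
    proof (cases "\<forall>j<k. ?s \<mu>' \<nu>' j \<le> 1 / real (Suc k)")
      case True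
      then have "?d \<mu>' \<nu>' \<le> e" using k[OF r] by blast
      moreover have "0 \<le> 2 * B * real (Suc k) * (\<Sum>j<k. ?s \<mu>' \<nu>' j)"
        using B(1) by (intro mult_nonneg_nonneg sum_nonneg) auto
      ultimately show ?thesis by linarith
    next
      case False
      then obtain j where j: "j < k" "1 / real (Suc k) < ?s \<mu>' \<nu>' j" by auto
      have "?s \<mu>' \<nu>' j \<le> (\<Sum>j<k. ?s \<mu>' \<nu>' j)"
        by (rule member_le_sum) (use j in auto)
      with j have "1 / real (Suc k) \<le> (\<Sum>j<k. ?s \<mu>' \<nu>' j)" by linarith
      then have "2 * B * real (Suc k) * (1 / real (Suc k)) \<le> 2 * B * real (Suc k) * (\<Sum>j<k. ?s \<mu>' \<nu>' j)"
        using B(1) by (intro mult_left_mono) auto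
      moreover have "?d \<mu>' \<nu>' \<le> 2 * B" using int[OF r] int[OF \<mu> \<nu>] by linarith
      ultimately show ?thesis using e by simp
    qed
  qed (use g B in auto)
qed

section \<open>Empirical and weighted empirical measures\<close>

lemma point_measure_integral_distr:
  fixes f :: "'b::topological_space \<Rightarrow> real" and x :: "nat \<Rightarrow> 'b"
  assumes w: "\<And>i. i \<in> {1..N} \<Longrightarrow> 0 \<le> w i" and f: "f \<in> borel_measurable borel"
  shows "(\<integral>z. f z \<partial>distr (point_measure {1..N} (\<lambda>i. ennreal (w i))) borel x) = (\<Sum>i=1..N. w i * f (x i))"
proof -
  have "(\<integral>z. f z \<partial>distr (point_measure {1..N} (\<lambda>i. ennreal (w i))) borel x)
    = (\<integral>i. f (x i) \<partial>point_measure {1..N} (\<lambda>i. ennreal (w i)))"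
    by (rule integral_distr[OF _ f]) (simp add: measurable_point_measure_eq1)
  also have "\<dots> = (\<Sum>i=1..N. w i *\<^sub>R f (x i))"
    by (rule lebesgue_integral_point_measure_finite[OF _ w]) simp_all
  finally show ?thesis by simp
qed

lemma empirical_integral:
  assumes f: "f \<in> borel_measurable borel"
  shows "(\<integral>z. f z \<partial>empirical N x) = emean N f x"
proof -
  have "(\<integral>z. f z \<partial>empirical N x) = (\<Sum>i=1..N. (1 / real N) * f (x i))"
    using point_measure_integral_distr[of N "\<lambda>_. 1 / real N" f x] f
    by (simp add: empirical_def uniform_count_measure_def)
  then show ?thesis by (simp add: emean_def sum_divide_distrib)
qed

lemma weighted_empirical_integral:
  assumes f: "f \<in> borel_measurable borel" and g: "\<And>x. 0 < g x" and N: "N \<ge> 1"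
  shows "(\<integral>z. f z \<partial>weighted_empirical g N x) = emean N (\<lambda>z. g z * f z) x / emean N g x"
proof -
  let ?S = "\<Sum>j=1..N. g (x j)"
  have S: "0 \<le> ?S" using g by (intro sum_nonneg) (auto intro: less_imp_le)
  have "(\<integral>z. f z \<partial>weighted_empirical g N x) = (\<Sum>i=1..N. (g (x i) / ?S) * f (x i))"
    unfolding weighted_empirical_def
    by (rule point_measure_integral_distr[OF _ f]) (use S g in \<open>auto intro: divide_nonneg_nonneg less_imp_le\<close>)
  also have "\<dots> = (\<Sum>i=1..N. g (x i) * f (x i)) / ?S" by (simp add: sum_divide_distrib)
  finally show ?thesis using N by (simp add: emean_def)
qed

lemma weighted_empirical_emeasure:
  assumes A: "A \<in> sets borel"
  shows "emeasure (weighted_empirical g N x) A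
    = (\<Sum>i=1..N. ennreal (g (x i) / (\<Sum>j=1..N. g (x j))) * indicator A (x i))"
proof -
  have "emeasure (weighted_empirical g N x) A = (\<integral>\<^sup>+z. indicator A z \<partial>weighted_empirical g N x)"
    using A by (simp add: weighted_empirical_def)
  also have "\<dots> = (\<Sum>i=1..N. ennreal (g (x i) / (\<Sum>j=1..N. g (x j))) * indicator A (x i))"
    unfolding weighted_empirical_def using A
    by (subst nn_integral_distr) (auto simp: measurable_point_measure_eq1 nn_integral_point_measure_finite)
  finally show ?thesis .
qed

lemma weighted_empirical_prob:
  assumes g: "\<And>x. 0 < g x" and N: "N \<ge> 1"
  shows "weighted_empirical g N x \<in> space (prob_algebra borel)"
proof -
  have pos: "0 < (\<Sum>j=1..N. g (x j))" using g N by (intro sum_pos) auto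
  have "emeasure (weighted_empirical g N x) UNIV = 1"
    using pos g N
    by (simp add: weighted_empirical_emeasure sum_ennreal divide_nonneg_nonneg less_imp_le
       sum_divide_distrib[symmetric])
  then show ?thesis
    by (auto simp: space_prob_algebra weighted_empirical_def intro!: prob_spaceI)
qed

lemma weighted_empirical_measurable:
  assumes g: "\<And>x. 0 < g x" "g \<in> borel_measurable borel" and N: "N \<ge> 1"
    and c: "c \<in> borel_measurable borel"
  shows "(\<lambda>u. weighted_empirical g N (\<lambda>j. c (u j))) \<in> (\<Pi>\<^sub>M i\<in>{1..N}. borel) \<rightarrow>\<^sub>M prob_algebra borel"
proof (rule measurable_prob_algebraI[OF _ measurable_subprob_algebra])
  note we = weighted_empirical_prob[of g, OF g(1) N, unfolded space_prob_algebra]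
  show "prob_space (weighted_empirical g N (\<lambda>j. c (u j)))" for u using we by simp
  show "subprob_space (weighted_empirical g N (\<lambda>j. c (u j)))" for u
    using we by (simp add: prob_space_imp_subprob_space)
  show "sets (weighted_empirical g N (\<lambda>j. c (u j))) = sets borel" for u using we by simp
  fix A :: "'a set" assume [measurable]: "A \<in> sets borel"
  note g(2)[measurable] c[measurable]
  show "(\<lambda>u. emeasure (weighted_empirical g N (\<lambda>j. c (u j))) A) \<in> borel_measurable (\<Pi>\<^sub>M i\<in>{1..N}. borel)"
    by (subst weighted_empirical_emeasure) measurable
qed

section \<open>Path laws of Markov chains\<close>

text \<open>Two recursions are extracted from the path law: integrating out the last coordinate, for the weighted
  flow, and the evolution of the law of the last coordinate, for the particles.\<close>

locale markov_chain =
  fixes S :: "'a measure" and \<mu> :: "'a measure" and K :: "nat \<Rightarrow> 'a \<Rightarrow> 'a measure"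
  assumes initial: "\<mu> \<in> space (prob_algebra S)"
    and kernel: "\<And>k. k \<ge> 1 \<Longrightarrow> K k \<in> S \<rightarrow>\<^sub>M prob_algebra S"
begin

abbreviation paths :: "nat \<Rightarrow> (nat \<Rightarrow> 'a) measure" where
  "paths n \<equiv> \<Pi>\<^sub>M p\<in>{0..<n}. S"

lemma coordinate_kernel:
  "(\<lambda>x. if p = 0 then \<mu> else K p (x (p - 1))) \<in> paths p \<rightarrow>\<^sub>M prob_algebra S"
proof (cases "p = 0")
  case False
  then have "(\<lambda>x. x (p - 1)) \<in> paths p \<rightarrow>\<^sub>M S" by (intro measurable_component_singleton) auto
  from measurable_compose[OF this kernel[of p]] False show ?thesis by simp
qed (simp add: initial)

sublocale IT: Ionescu_Tulcea "\<lambda>p x. if p = 0 then \<mu> else K p (x (p - 1))" "\<lambda>_. S"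
  by (rule Ionescu_Tulcea.intro)
    (rule measurable_prob_algebraD[OF coordinate_kernel], rule kernel_prob(1)[OF coordinate_kernel])

lemma chain_law_IT: "chain_law S \<mu> K n = IT.C 0 (Suc n) (\<lambda>_. undefined)"
  by (simp add: chain_law_def)

lemma chain_law_prob: "prob_space (chain_law S \<mu> K n)"
  unfolding chain_law_IT by (rule IT.prob_space_C) simp

lemma chain_law_sets: "sets (chain_law S \<mu> K n) = sets (paths (Suc n))"
  unfolding chain_law_IT by (subst IT.sets_C) simp_all

lemma initial_prob: "prob_space \<mu>" "sets \<mu> = sets S" "space \<mu> = space S"
  using initial by (auto simp: space_prob_algebra dest: sets_eq_imp_space_eq)

lemma path_upd: "fun_upd (\<lambda>_. undefined) 0 \<in> S \<rightarrow>\<^sub>M paths 1"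
proof -
  have "(\<lambda>x. fun_upd (\<lambda>_. undefined) (0::nat) x) \<in> S \<rightarrow>\<^sub>M paths 1"
    by (rule measurable_fun_upd[where J="{}"]) (auto simp: space_PiM)
  then show ?thesis .
qed

lemma chain_law_0:
  "chain_law S \<mu> K 0 = distr \<mu> (paths 1) (fun_upd (\<lambda>_. undefined) 0)"
proof -
  have "chain_law S \<mu> K 0 = IT.eP 0 (\<lambda>_. undefined)"
    unfolding chain_law_IT IT.C.simps add_0_left
    by (rule bind_return[OF IT.measurable_eP]) (simp add: space_PiM)
  then show ?thesis by (simp add: IT.eP_def)
qed

lemma eP_kernel: "IT.eP (Suc n) \<in> paths (Suc n) \<rightarrow>\<^sub>M prob_algebra (paths (Suc (Suc n)))"
  by (intro measurable_prob_algebraI IT.prob_space_eP IT.measurable_eP)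

lemma chain_law_Suc: "chain_law S \<mu> K (Suc n) = chain_law S \<mu> K n \<bind> IT.eP (Suc n)"
  unfolding chain_law_IT by simp

lemma chain_law_0_integral:
  fixes F :: "(nat \<Rightarrow> 'a) \<Rightarrow> real"
  assumes F: "F \<in> borel_measurable (paths 1)"
  shows "(\<integral>x. F x \<partial>chain_law S \<mu> K 0) = (\<integral>y. F (fun_upd (\<lambda>_. undefined) 0 y) \<partial>\<mu>)"
  unfolding chain_law_0 using path_upd F initial_prob
  by (intro integral_distr) (auto cong: measurable_cong_sets)

lemma chain_law_Suc_integral:
  fixes F :: "(nat \<Rightarrow> 'a) \<Rightarrow> real"
  assumes F: "F \<in> borel_measurable (paths (Suc (Suc n)))" and B: "\<And>x. \<bar>F x\<bar> \<le> B"
  shows "(\<integral>x. F x \<partial>chain_law S \<mu> K (Suc n))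
    = (\<integral>x. \<integral>y. F (fun_upd x (Suc n) y) \<partial>K (Suc n) (x n) \<partial>chain_law S \<mu> K n)"
proof -
  have k: "IT.eP (Suc n) \<in> chain_law S \<mu> K n \<rightarrow>\<^sub>M prob_algebra (paths (Suc (Suc n)))"
    using eP_kernel by (simp add: measurable_cong_sets[OF chain_law_sets refl])
  have sp: "space (chain_law S \<mu> K n) = space (paths (Suc n))"
    by (rule sets_eq_imp_space_eq[OF chain_law_sets])
  have "(\<integral>x. F x \<partial>chain_law S \<mu> K (Suc n)) = (\<integral>x. \<integral>y. F y \<partial>IT.eP (Suc n) x \<partial>chain_law S \<mu> K n)"
    unfolding chain_law_Suc by (rule integral_bind_kernel[OF chain_law_prob k F B])
  also have "\<dots> = (\<integral>x. \<integral>y. F (fun_upd x (Suc n) y) \<partial>K (Suc n) (x n) \<partial>chain_law S \<mu> K n)"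
  proof (intro Bochner_Integration.integral_cong refl)
    fix x assume "x \<in> space (chain_law S \<mu> K n)"
    then have x: "x \<in> space (paths (Suc n))" by (simp add: sp)
    have "fun_upd x (Suc n) \<in> K (Suc n) (x n) \<rightarrow>\<^sub>M paths (Suc (Suc n))"
    proof -
      have "(\<lambda>y. fun_upd x (Suc n) y) \<in> S \<rightarrow>\<^sub>M paths (Suc (Suc n))"
        using x by (intro measurable_fun_upd[where J="{0..<Suc n}"]) auto
      moreover have "x n \<in> space S" using x by (auto simp: space_PiM)
      ultimately show ?thesis
        using kernel_prob[OF kernel[of "Suc n"], of "x n"] by (simp cong: measurable_cong_sets)
    qed
    then show "(\<integral>y. F y \<partial>IT.eP (Suc n) x) = (\<integral>y. F (fun_upd x (Suc n) y) \<partial>K (Suc n) (x n))"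
      unfolding IT.eP_def using F by (subst integral_distr) auto
  qed
  finally show ?thesis .
qed

lemma chain_law_marginal_0: "distr (chain_law S \<mu> K 0) S (\<lambda>x. x 0) = \<mu>"
proof -
  have "(\<lambda>x. x 0) \<in> paths 1 \<rightarrow>\<^sub>M S" by (intro measurable_component_singleton) simp
  moreover have "fun_upd (\<lambda>_. undefined) 0 \<in> \<mu> \<rightarrow>\<^sub>M paths 1"
    using path_upd initial_prob by (simp cong: measurable_cong_sets)
  ultimately have "distr (chain_law S \<mu> K 0) S (\<lambda>x. x 0) = distr \<mu> S (\<lambda>x. x)"
    unfolding chain_law_0 by (subst distr_distr) (auto simp: comp_def)
  then show ?thesis using initial_prob by (simp add: distr_id2)
qed

lemma chain_law_marginal_Suc:
  "distr (chain_law S \<mu> K (Suc n)) S (\<lambda>x. x (Suc n)) = distr (chain_law S \<mu> K n) S (\<lambda>x. x n) \<bind> K (Suc n)"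
proof -
  have sp: "space (chain_law S \<mu> K n) = space (paths (Suc n))"
    by (rule sets_eq_imp_space_eq[OF chain_law_sets])
  have ne: "space (chain_law S \<mu> K n) \<noteq> {}"
    by (rule prob_space.not_empty[OF chain_law_prob])
  have k: "IT.eP (Suc n) \<in> chain_law S \<mu> K n \<rightarrow>\<^sub>M subprob_algebra (paths (Suc (Suc n)))"
    using IT.measurable_eP by (simp add: measurable_cong_sets[OF chain_law_sets refl])
  have "distr (chain_law S \<mu> K (Suc n)) S (\<lambda>x. x (Suc n))
    = chain_law S \<mu> K n \<bind> (\<lambda>x. distr (IT.eP (Suc n) x) S (\<lambda>x. x (Suc n)))"
    unfolding chain_law_Suc
    by (rule distr_bind[OF k ne]) (intro measurable_component_singleton, simp)
  also have "\<dots> = chain_law S \<mu> K n \<bind> (\<lambda>x. K (Suc n) (x n))"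
  proof (rule bind_cong[OF refl])
    fix x assume "x \<in> space (chain_law S \<mu> K n)"
    then have x: "x \<in> space (paths (Suc n))" by (simp add: sp)
    have xn: "x n \<in> space S" using x by (auto simp: space_PiM)
    have sK: "sets (K (Suc n) (x n)) = sets S" using kernel_prob[OF kernel[of "Suc n"] xn] by simp
    have "(\<lambda>y. fun_upd x (Suc n) y) \<in> S \<rightarrow>\<^sub>M paths (Suc (Suc n))"
      using x by (intro measurable_fun_upd[where J="{0..<Suc n}"]) auto
    then have "fun_upd x (Suc n) \<in> K (Suc n) (x n) \<rightarrow>\<^sub>M paths (Suc (Suc n))"
      using sK by (simp cong: measurable_cong_sets)
    moreover have "(\<lambda>x. x (Suc n)) \<in> paths (Suc (Suc n)) \<rightarrow>\<^sub>M S"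
      by (intro measurable_component_singleton) simp
    ultimately have "distr (IT.eP (Suc n) x) S (\<lambda>x. x (Suc n)) = distr (K (Suc n) (x n)) S (\<lambda>y. y)"
      unfolding IT.eP_def by (subst distr_distr) (auto simp: comp_def)
    then show "distr (IT.eP (Suc n) x) S (\<lambda>x. x (Suc n)) = K (Suc n) (x n)"
      using sK by (simp add: distr_id2)
  qed
  also have "\<dots> = distr (chain_law S \<mu> K n) S (\<lambda>x. x n) \<bind> K (Suc n)"
  proof (rule bind_distr[symmetric, OF _ measurable_prob_algebraD[OF kernel] ne])
    have "(\<lambda>x. x n) \<in> paths (Suc n) \<rightarrow>\<^sub>M S" by (intro measurable_component_singleton) simp
    then show "(\<lambda>x. x n) \<in> chain_law S \<mu> K n \<rightarrow>\<^sub>M S"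
      by (simp add: measurable_cong_sets[OF chain_law_sets refl])
  qed simp
  finally show ?thesis .
qed

end

section \<open>The Feynman-Kac flow\<close>

lemma normalize_measure_integral:
  fixes f :: "'a \<Rightarrow> real"
  assumes Z: "emeasure \<mu> (space \<mu>) = ennreal Z" "0 < Z" and f: "f \<in> borel_measurable \<mu>"
  shows "(\<integral>x. f x \<partial>normalize_measure \<mu>) = (\<integral>x. f x \<partial>\<mu>) / Z"
proof -
  have "normalize_measure \<mu> = density \<mu> (\<lambda>_. ennreal (1 / Z))"
    using Z by (simp add: normalize_measure_def divide_ennreal[symmetric] ennreal_1[symmetric] del: ennreal_1)
  then show ?thesis using f Z by (simp add: integral_real_density)
qed

lemma normalize_measure_prob:
  assumes Z: "emeasure \<mu> (space \<mu>) = ennreal Z" "0 < Z"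
  shows "prob_space (normalize_measure \<mu>)"
proof (rule prob_spaceI)
  have "emeasure (normalize_measure \<mu>) (space (normalize_measure \<mu>)) = (\<integral>\<^sup>+x. ennreal (1 / Z) \<partial>\<mu>)"
    using Z by (simp add: normalize_measure_def emeasure_density divide_ennreal[symmetric] cong: nn_integral_cong)
  also have "\<dots> = ennreal (1 / Z) * ennreal Z" using Z by simp
  also have "\<dots> = 1" using Z by (subst ennreal_mult[symmetric]) auto
  finally show "emeasure (normalize_measure \<mu>) (space (normalize_measure \<mu>)) = 1" .
qed

lemma sets_normalize_measure: "sets (normalize_measure \<mu>) = sets \<mu>"
  by (simp add: normalize_measure_def)

lemma (in prob_space) integral_pos:
  fixes f :: "'a \<Rightarrow> real"
  assumes "integrable M f" "\<And>x. 0 < f x"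
  shows "0 < (\<integral>x. f x \<partial>M)"
proof -
  have "(\<integral>x. 0 \<partial>M) < (\<integral>x. f x \<partial>M)"
    using assms by (intro integral_less_AE_space) (auto simp: emeasure_space_1)
  then show ?thesis by simp
qed

locale feynman_kac =
  fixes G :: "nat \<Rightarrow> real \<Rightarrow> real" and \<eta>0 :: "real measure" and M :: "nat \<Rightarrow> real \<Rightarrow> real measure"
  assumes G_pos: "\<And>k x. 0 < G k x"
    and G_continuous: "\<And>k. bounded_continuous (G k)"
    and eta0: "\<eta>0 \<in> space (prob_algebra borel)"
    and M_kernel: "\<And>k. k \<ge> 1 \<Longrightarrow> M k \<in> borel \<rightarrow>\<^sub>M prob_algebra borel"
    and M_feller: "\<And>k. k \<ge> 1 \<Longrightarrow> feller (M k)"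
begin

sublocale chain: markov_chain borel \<eta>0 M
  by standard (rule eta0 M_kernel)+

definition gamma :: "nat \<Rightarrow> (real \<Rightarrow> real) \<Rightarrow> real" where
  "gamma n f = (\<integral>x. f x \<partial>fk_gamma G \<eta>0 M n)"

definition eta :: "nat \<Rightarrow> (real \<Rightarrow> real) \<Rightarrow> real" where
  "eta n f = (\<integral>x. f x \<partial>fk_eta G \<eta>0 M n)"

definition eta_bar :: "nat \<Rightarrow> (real \<Rightarrow> real) \<Rightarrow> real" where
  "eta_bar n f = (\<integral>x. f x \<partial>fk_eta_bar G \<eta>0 M n)"

lemma G_meas[measurable]: "G k \<in> borel_measurable borel"
  by (rule bounded_continuous_measurable[OF G_continuous])

lemma kernel_op_bounded_continuous:
  "bounded_continuous f \<Longrightarrow> bounded_continuous (kernel_op (M (Suc n)) f)"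
  using M_feller[of "Suc n"] by (simp add: feller_def)

text \<open>A fixed choice of bound for each potential, so that a bound for a product of potentials can be written
  down as a product.\<close>

definition G_bound :: "nat \<Rightarrow> real" where
  "G_bound k = (SOME B. 0 \<le> B \<and> (\<forall>x. \<bar>G k x\<bar> \<le> B))"

lemma G_bound: "0 \<le> G_bound k" "\<bar>G k x\<bar> \<le> G_bound k"
proof -
  have "\<exists>B. 0 \<le> B \<and> (\<forall>x. \<bar>G k x\<bar> \<le> B)"
    using bounded_continuous_bound[OF G_continuous[of k]] by metis
  from someI_ex[OF this] show "0 \<le> G_bound k" "\<bar>G k x\<bar> \<le> G_bound k" by (auto simp: G_bound_def)
qed

lemma weight_bound: "\<bar>\<Prod>p<n. G p (x p)\<bar> \<le> (\<Prod>p<n. G_bound p)"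
  unfolding abs_prod by (intro prod_mono) (auto simp: G_bound)

lemma coordinate_measurable:
  assumes "p < n" "f \<in> borel_measurable borel"
  shows "(\<lambda>x. f (x p)) \<in> borel_measurable (chain.paths n)"
proof -
  have "(\<lambda>x. x p) \<in> chain.paths n \<rightarrow>\<^sub>M borel" using assms by (intro measurable_component_singleton) simp
  from measurable_compose[OF this assms(2)] show ?thesis .
qed

lemma weight_meas: "m \<le> n \<Longrightarrow> (\<lambda>x. \<Prod>p<m. G p (x p)) \<in> borel_measurable (chain.paths n)"
  by (intro borel_measurable_prod coordinate_measurable G_meas) auto

lemma gamma_path:
  assumes f: "f \<in> borel_measurable borel"
  shows "gamma n f = (\<integral>x. (\<Prod>p<n. G p (x p)) * f (x n) \<partial>chain_law borel \<eta>0 M n)"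
proof -
  note m = measurable_cong_sets[OF chain.chain_law_sets refl]
  have xn: "(\<lambda>x. x n) \<in> borel_measurable (chain_law borel \<eta>0 M n)"
    unfolding m by (intro measurable_component_singleton) simp
  have w: "(\<lambda>x. \<Prod>p<n. G p (x p)) \<in> borel_measurable (chain_law borel \<eta>0 M n)"
    unfolding m by (rule weight_meas) simp
  show ?thesis
    unfolding gamma_def fk_gamma_def using xn w f G_pos
    by (subst integral_distr, simp, simp, subst integral_real_density)
      (auto simp: measurable_compose[OF xn f] intro!: prod_nonneg intro: less_imp_le)
qed

lemma gamma_0: "f \<in> borel_measurable borel \<Longrightarrow> gamma 0 f = (\<integral>x. f x \<partial>\<eta>0)"
proof -
  assume f: "f \<in> borel_measurable borel"
  have "(\<lambda>x. f (x 0)) \<in> borel_measurable (chain.paths 1)"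
    by (rule coordinate_measurable[OF _ f]) simp
  then show ?thesis using f by (simp add: gamma_path chain.chain_law_0_integral)
qed

text \<open>Integrating out the last coordinate, on which the weight \<open>G 0 (x 0) \<cdots> G n (x n)\<close> does not depend, gives
  the one-step recursion from which the whole flow is computed.\<close>

lemma gamma_Suc:
  assumes f: "bounded_continuous f"
  shows "gamma (Suc n) f = gamma n (\<lambda>x. G n x * kernel_op (M (Suc n)) f x)"
proof -
  note fm = bounded_continuous_measurable[OF f]
  obtain B where B: "0 \<le> B" "\<And>x. \<bar>f x\<bar> \<le> B" using f bounded_continuous_bound by blast
  note km = bounded_continuous_measurable[OF kernel_op_bounded_continuous[OF f]]
  have "(\<lambda>x. (\<Prod>p<Suc n. G p (x p)) * f (x (Suc n))) \<in> borel_measurable (chain.paths (Suc (Suc n)))"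
    by (intro borel_measurable_times weight_meas coordinate_measurable fm) auto
  moreover have "\<bar>(\<Prod>p<Suc n. G p (x p)) * f (x (Suc n))\<bar> \<le> (\<Prod>p<Suc n. G_bound p) * B" for x
    unfolding abs_mult using B weight_bound[where n = "Suc n" and x = x]
    by (intro mult_mono prod_nonneg) (auto simp: G_bound)
  ultimately have "gamma (Suc n) f = (\<integral>x. \<integral>y. (\<Prod>p<Suc n. G p (fun_upd x (Suc n) y p)) * f y
      \<partial>M (Suc n) (x n) \<partial>chain_law borel \<eta>0 M n)"
    unfolding gamma_path[OF fm] by (subst chain.chain_law_Suc_integral) auto
  also have "\<dots> = (\<integral>x. (\<Prod>p<n. G p (x p)) * (G n (x n) * kernel_op (M (Suc n)) f (x n)) \<partial>chain_law borel \<eta>0 M n)"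
  proof (intro Bochner_Integration.integral_cong refl)
    fix x :: "nat \<Rightarrow> real"
    have "(\<Prod>p<Suc n. G p (fun_upd x (Suc n) y p)) = (\<Prod>p<Suc n. G p (x p))" for y
      by (intro prod.cong) auto
    then show "(\<integral>y. (\<Prod>p<Suc n. G p (fun_upd x (Suc n) y p)) * f y \<partial>M (Suc n) (x n))
      = (\<Prod>p<n. G p (x p)) * (G n (x n) * kernel_op (M (Suc n)) f (x n))"
      by (simp add: kernel_op_def)
  qed
  also have "\<dots> = gamma n (\<lambda>x. G n x * kernel_op (M (Suc n)) f x)"
    using km by (intro gamma_path[symmetric]) simp
  finally show ?thesis .
qed

lemma gamma_mass: "emeasure (fk_gamma G \<eta>0 M n) (space (fk_gamma G \<eta>0 M n)) = ennreal (gamma n (\<lambda>_. 1))"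
  and gamma_pos: "0 < gamma n (\<lambda>_. 1)"
proof -
  interpret C: prob_space "chain_law borel \<eta>0 M n" by (rule chain.chain_law_prob)
  note m = measurable_cong_sets[OF chain.chain_law_sets refl]
  have xn: "(\<lambda>x. x n) \<in> borel_measurable (chain_law borel \<eta>0 M n)"
    unfolding m by (intro measurable_component_singleton) simp
  have w: "(\<lambda>x. \<Prod>p<n. G p (x p)) \<in> borel_measurable (chain_law borel \<eta>0 M n)"
    unfolding m by (rule weight_meas) simp
  have int: "integrable (chain_law borel \<eta>0 M n) (\<lambda>x. \<Prod>p<n. G p (x p))"
    using w weight_bound by (intro C.integrable_bounded) auto
  have pos: "0 < (\<Prod>p<n. G p (x p))" for x using G_pos by (intro prod_pos) auto
  have "emeasure (fk_gamma G \<eta>0 M n) (space (fk_gamma G \<eta>0 M n))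
    = (\<integral>\<^sup>+x. ennreal (\<Prod>p<n. G p (x p)) \<partial>chain_law borel \<eta>0 M n)"
    unfolding fk_gamma_def using xn w
    by (simp add: emeasure_distr emeasure_density cong: nn_integral_cong)
  also have "\<dots> = ennreal (\<integral>x. (\<Prod>p<n. G p (x p)) \<partial>chain_law borel \<eta>0 M n)"
    using int pos by (intro nn_integral_eq_integral) (auto intro: less_imp_le)
  finally show "emeasure (fk_gamma G \<eta>0 M n) (space (fk_gamma G \<eta>0 M n)) = ennreal (gamma n (\<lambda>_. 1))"
    by (simp add: gamma_path)
  show "0 < gamma n (\<lambda>_. 1)" using C.integral_pos[OF int pos] by (simp add: gamma_path)
qed

lemma sets_fk_eta: "sets (fk_eta G \<eta>0 M n) = sets borel"
  by (simp add: fk_eta_def sets_normalize_measure fk_gamma_def)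

lemma eta_real_distribution: "real_distribution (fk_eta G \<eta>0 M n)"
  using normalize_measure_prob[OF gamma_mass gamma_pos] sets_fk_eta
  by (simp add: real_distribution_def real_distribution_axioms_def fk_eta_def)

lemma eta_gamma: "f \<in> borel_measurable borel \<Longrightarrow> eta n f = gamma n f / gamma n (\<lambda>_. 1)"
  unfolding eta_def gamma_def[of n f] fk_eta_def
  by (rule normalize_measure_integral[OF gamma_mass gamma_pos]) (simp add: fk_gamma_def)

lemma eta_0: "f \<in> borel_measurable borel \<Longrightarrow> eta 0 f = (\<integral>x. f x \<partial>\<eta>0)"
  using prob_space.prob_space[OF chain.initial_prob(1)] by (simp add: eta_gamma gamma_0)

lemma integrable_eta: "bounded_continuous f \<Longrightarrow> integrable (fk_eta G \<eta>0 M n) f"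
proof -
  assume f: "bounded_continuous f"
  interpret real_distribution "fk_eta G \<eta>0 M n" by (rule eta_real_distribution)
  obtain B where "\<And>x. \<bar>f x\<bar> \<le> B" using f bounded_continuous_bound by blast
  with bounded_continuous_measurable[OF f] show ?thesis
    by (intro integrable_bounded[of _ B]) auto
qed

lemma eta_G_pos: "0 < eta n (G n)"
proof -
  interpret real_distribution "fk_eta G \<eta>0 M n" by (rule eta_real_distribution)
  show ?thesis unfolding eta_def by (intro integral_pos integrable_eta G_continuous G_pos)
qed

lemma eta_weighted_mass:
  "emeasure (density (fk_eta G \<eta>0 M n) (\<lambda>x. ennreal (G n x))) (space (density (fk_eta G \<eta>0 M n) (\<lambda>x. ennreal (G n x))))
    = ennreal (eta n (G n))"
proof -
  have "emeasure (density (fk_eta G \<eta>0 M n) (\<lambda>x. ennreal (G n x))) (space (density (fk_eta G \<eta>0 M n) (\<lambda>x. ennreal (G n x))))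
    = (\<integral>\<^sup>+x. ennreal (G n x) \<partial>fk_eta G \<eta>0 M n)"
  proof -
    have "(\<lambda>x. ennreal (G n x)) \<in> borel_measurable (fk_eta G \<eta>0 M n)"
      using sets_fk_eta[of n] by (simp cong: measurable_cong_sets)
    then show ?thesis by (simp add: emeasure_density cong: nn_integral_cong)
  qed
  then show ?thesis unfolding eta_def
    using integrable_eta[OF G_continuous, of n n] G_pos
    by (simp add: nn_integral_eq_integral less_imp_le)
qed

lemma eta_bar_real_distribution: "real_distribution (fk_eta_bar G \<eta>0 M n)"
  using normalize_measure_prob[OF eta_weighted_mass eta_G_pos] sets_fk_eta
  by (simp add: real_distribution_def real_distribution_axioms_def fk_eta_bar_def sets_normalize_measure)

lemma eta_bar_eta:
  assumes f: "f \<in> borel_measurable borel"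
  shows "eta_bar n f = eta n (\<lambda>x. G n x * f x) / eta n (G n)"
proof -
  have fm: "f \<in> borel_measurable (fk_eta G \<eta>0 M n)" "G n \<in> borel_measurable (fk_eta G \<eta>0 M n)"
    using f sets_fk_eta by (simp_all cong: measurable_cong_sets)
  have "eta_bar n f = (\<integral>x. f x \<partial>density (fk_eta G \<eta>0 M n) (\<lambda>x. ennreal (G n x))) / eta n (G n)"
    unfolding eta_bar_def fk_eta_bar_def
    by (rule normalize_measure_integral[OF eta_weighted_mass eta_G_pos]) (simp add: fm)
  also have "(\<integral>x. f x \<partial>density (fk_eta G \<eta>0 M n) (\<lambda>x. ennreal (G n x))) = eta n (\<lambda>x. G n x * f x)"
    unfolding eta_def using fm G_pos by (intro integral_real_density) (auto intro: less_imp_le)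
  finally show ?thesis .
qed

lemma kernel_op_one:  "kernel_op (M (Suc n)) (\<lambda>_. 1) x = 1"
  using prob_space.prob_space[OF kernel_prob(1)[OF M_kernel[of "Suc n"], of x]]
  by (simp add: kernel_op_def)

text \<open>Each step of the flow reweights by the potential and then mutates. The mass of \<open>gamma (Suc n)\<close> is
  \<open>gamma n (G n)\<close> since \<open>M\<close> is Markov, so the normalisations match.\<close>

lemma eta_Suc:
  assumes f: "bounded_continuous f"
  shows "eta (Suc n) f = eta_bar n (kernel_op (M (Suc n)) f)"
proof -
  have b: "bounded_continuous (\<lambda>x. G n x * kernel_op (M (Suc n)) f x)"
    by (intro bounded_continuous_mult G_continuous kernel_op_bounded_continuous f)
  have "eta (Suc n) f = gamma n (\<lambda>x. G n x * kernel_op (M (Suc n)) f x) / gamma n (G n)"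
    using f by (simp add: eta_gamma bounded_continuous_measurable gamma_Suc bounded_continuous_const kernel_op_one)
  also have "\<dots> = eta n (\<lambda>x. G n x * kernel_op (M (Suc n)) f x) / eta n (G n)"
    using gamma_pos[of n] by (simp add: eta_gamma bounded_continuous_measurable[OF b])
  finally show ?thesis
    using bounded_continuous_measurable[OF kernel_op_bounded_continuous[OF f]] by (simp add: eta_bar_eta)
qed

lemma eta_diff:
  "bounded_continuous f \<Longrightarrow> bounded_continuous g \<Longrightarrow> eta n (\<lambda>x. f x - g x) = eta n f - eta n g"
  unfolding eta_def by (intro Bochner_Integration.integral_diff integrable_eta)

lemma eta_cmult: "eta n (\<lambda>x. c * f x) = c * eta n f"
  unfolding eta_def by simp

lemma eta_const: "eta n (\<lambda>x. c) = c"
proof -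
  interpret real_distribution "fk_eta G \<eta>0 M n" by (rule eta_real_distribution)
  show ?thesis using prob_space by (simp add: eta_def)
qed

text \<open>The derivative at \<open>\<eta>\<^sub>n\<close> of the Boltzmann-Gibbs ratio \<open>\<mu> \<mapsto> \<mu>(G\<^sub>n f) / \<mu>(G\<^sub>n)\<close>, written as a test function: to
  first order the ratio at \<open>\<mu>\<close> exceeds its value at \<open>\<eta>\<^sub>n\<close> by \<open>\<mu>(pullback n f)\<close>.\<close>

definition pullback :: "nat \<Rightarrow> (real \<Rightarrow> real) \<Rightarrow> real \<Rightarrow> real" where
  "pullback n f x = G n x * (f x - eta_bar n f) / eta n (G n)"

lemma pullback_bounded_continuous:
  "bounded_continuous f \<Longrightarrow> bounded_continuous (pullback n f)"
  using bounded_continuous_mult[OF bounded_continuous_const[of "1 / eta n (G n)"]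
      bounded_continuous_mult[OF G_continuous[of n] bounded_continuous_diff[OF _ bounded_continuous_const[of "eta_bar n f"]]]]
  by (simp add: pullback_def[abs_def])

lemma eta_pullback:
  assumes f: "bounded_continuous f" shows "eta n (pullback n f) = 0"
proof -
  have "pullback n f = (\<lambda>x. (1 / eta n (G n)) * (G n x * f x - eta_bar n f * G n x))"
    by (auto simp: pullback_def diff_divide_distrib algebra_simps)
  then have "eta n (pullback n f) = (1 / eta n (G n)) * (eta n (\<lambda>x. G n x * f x) - eta_bar n f * eta n (G n))"
    using f by (simp only: eta_cmult)
      (subst eta_diff, auto intro!: bounded_continuous_intros G_continuous simp: eta_cmult)
  then show ?thesis using eta_G_pos[of n]
    by (simp add: eta_bar_eta[OF bounded_continuous_measurable[OF f]])
qed

lemma kernel_op_Q: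
  assumes f: "bounded_continuous f"
  shows "kernel_op (Q_kernel G M (Suc n)) f x = G n x * kernel_op (M (Suc n)) f x"
proof -
  have "f \<in> borel_measurable (M (Suc n) x)"
    using bounded_continuous_measurable[OF f] kernel_prob(2)[OF M_kernel[of "Suc n"], of x]
    by (simp cong: measurable_cong_sets)
  then show ?thesis
    using less_imp_le[OF G_pos[of n x]] by (simp add: kernel_op_def Q_kernel_def integral_real_density)
qed

lemma kernel_op_Q_bounded_continuous:
  assumes f: "bounded_continuous f" shows "bounded_continuous (kernel_op (Q_kernel G M (Suc n)) f)"
proof -
  have "kernel_op (Q_kernel G M (Suc n)) f = (\<lambda>x. G n x * kernel_op (M (Suc n)) f x)"
    using kernel_op_Q[OF f] by blast
  then show ?thesis
    by (simp add: bounded_continuous_mult G_continuous kernel_op_bounded_continuous f)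
qed

lemma Q_semigroup_refl: "Q_semigroup G M p p f = f"
  by (simp add: Q_semigroup_def)

lemma Q_semigroup_Suc:
  "p \<le> n \<Longrightarrow> Q_semigroup G M p (Suc n) f = Q_semigroup G M p n (kernel_op (Q_kernel G M (Suc n)) f)"
  by (simp add: Q_semigroup_def)

lemma Q_semigroup_cmult:
  "p \<le> n \<Longrightarrow> Q_semigroup G M p n (\<lambda>x. c * f x) x = c * Q_semigroup G M p n f x"
proof (induction n arbitrary: f x rule: dec_induct)
  case (step n)
  have "kernel_op (Q_kernel G M (Suc n)) (\<lambda>x. c * f x) = (\<lambda>x. c * kernel_op (Q_kernel G M (Suc n)) f x)"
    by (auto simp: kernel_op_def)
  with step show ?case by (simp add: Q_semigroup_Suc)
qed (simp add: Q_semigroup_refl)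

text \<open>The semigroup is dual to the recursion of the unnormalised flow. Hence the denominators in the operators
  \<open>D\<close> are quotients of total masses, which makes them cancel in \<open>D_op_Suc\<close>.\<close>

lemma gamma_Q_semigroup:
  "p \<le> n \<Longrightarrow> bounded_continuous f \<Longrightarrow> bounded_continuous (Q_semigroup G M p n f) \<and>
    gamma p (Q_semigroup G M p n f) = gamma n f"
proof (induction n arbitrary: f rule: dec_induct)
  case (step n)
  have "kernel_op (Q_kernel G M (Suc n)) f = (\<lambda>x. G n x * kernel_op (M (Suc n)) f x)"
    using kernel_op_Q[OF step.prems] by blast
  with step.IH[OF kernel_op_Q_bounded_continuous[OF step.prems, of n]] step.hyps(1) show ?case
    by (simp add: Q_semigroup_Suc gamma_Suc[OF step.prems])
qed (simp add: Q_semigroup_refl)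

lemma eta_Q_one:
  assumes "p \<le> n"
  shows "eta p (Q_semigroup G M p n (\<lambda>_. 1)) = gamma n (\<lambda>_. 1) / gamma p (\<lambda>_. 1)"
  using gamma_Q_semigroup[OF assms bounded_continuous_const]
  by (simp add: eta_gamma bounded_continuous_measurable)

lemma eta_G_gamma: "eta n (G n) = gamma (Suc n) (\<lambda>_. 1) / gamma n (\<lambda>_. 1)"
  by (simp add: eta_gamma gamma_Suc bounded_continuous_const kernel_op_one)

lemma D_op_refl: "D_op G \<eta>0 M n n f x = f x - eta n f"
  by (simp add: D_op_def eta_def Let_def)

text \<open>Prolonging the horizon by one step amounts to replacing the test function by its linearised image one time
  earlier. With \<open>c = \<eta>\<^sub>n\<^sub>+\<^sub>1(f)\<close>, the first factor of the semigroup turns \<open>f - c\<close> into \<open>\<eta>\<^sub>n(G\<^sub>n)\<close> times the pullback;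
  that pullback is already centred, and the factor \<open>\<eta>\<^sub>n(G\<^sub>n)\<close> is the quotient of the two denominators.\<close>

lemma D_op_Suc:
  assumes p: "p \<le> n" and f: "bounded_continuous f"
  shows "D_op G \<eta>0 M p (Suc n) f x = D_op G \<eta>0 M p n (pullback n (kernel_op (M (Suc n)) f)) x"
proof -
  let ?f' = "pullback n (kernel_op (M (Suc n)) f)"
  define c where "c = eta (Suc n) f"
  have fc: "bounded_continuous (\<lambda>y. f y - c)" by (intro bounded_continuous_intros f)
  have K: "kernel_op (M (Suc n)) (\<lambda>y. f y - c) y = kernel_op (M (Suc n)) f y - c" for y
  proof -
    interpret prob_space "M (Suc n) y" using kernel_prob(1)[OF M_kernel[of "Suc n"], of y] by simp
    obtain B where "\<And>x. \<bar>f x\<bar> \<le> B" using f bounded_continuous_bound by blast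
    then have "integrable (M (Suc n) y) f"
      using bounded_continuous_measurable[OF f] kernel_prob(2)[OF M_kernel[of "Suc n"], of y]
      by (intro integrable_bounded[of _ B]) (auto cong: measurable_cong_sets)
    then show ?thesis by (simp add: kernel_op_def prob_space)
  qed
  have "kernel_op (Q_kernel G M (Suc n)) (\<lambda>y. f y - c) = (\<lambda>y. eta n (G n) * ?f' y)"
  proof (rule ext)
    fix y show "kernel_op (Q_kernel G M (Suc n)) (\<lambda>y. f y - c) y = eta n (G n) * ?f' y"
      unfolding kernel_op_Q[OF fc] K using eta_G_pos[of n]
      by (simp add: pullback_def c_def eta_Suc[OF f])
  qed
  then have Q: "Q_semigroup G M p (Suc n) (\<lambda>y. f y - c) x = eta n (G n) * Q_semigroup G M p n ?f' x"
    by (simp add: Q_semigroup_Suc[OF p] Q_semigroup_cmult[OF p])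
  have "D_op G \<eta>0 M p (Suc n) f x = Q_semigroup G M p (Suc n) (\<lambda>y. f y - c) x / eta p (Q_semigroup G M p (Suc n) (\<lambda>_. 1))"
    using p by (simp add: D_op_def eta_def c_def Let_def)
  also have "\<dots> = Q_semigroup G M p n ?f' x / eta p (Q_semigroup G M p n (\<lambda>_. 1))"
    using p gamma_pos[of n] gamma_pos[of p] gamma_pos[of "Suc n"]
    by (simp add: Q eta_Q_one eta_G_gamma)
  also have "\<dots> = D_op G \<eta>0 M p n ?f' x"
  proof -
    have e: "(\<integral>z. ?f' z \<partial>fk_eta G \<eta>0 M n) = 0"
      using eta_pullback[OF kernel_op_bounded_continuous[OF f]] by (simp add: eta_def)
    show ?thesis
    proof (cases "p < n")
      case True then show ?thesis by (simp add: D_op_def e Let_def eta_def)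
    next
      case False
      then have "p = n" using p by simp
      then show ?thesis by (simp add: D_op_def e Let_def Q_semigroup_refl eta_const)
    qed
  qed
  finally show ?thesis .
qed

end

section \<open>The coupled particle system\<close>

lemma iexp_lipschitz: "cmod (iexp x - iexp y) \<le> \<bar>x - y\<bar>"
proof -
  have "iexp x - iexp y = iexp y * (iexp (x - y) - 1)"
    by (simp add: algebra_simps exp_add[symmetric])
  then have "cmod (iexp x - iexp y) = cmod (iexp (x - y) - 1)" by (simp add: norm_mult)
  also have "\<dots> \<le> \<bar>x - y\<bar>" using iexp_approx1[of "x - y" 0] by simp
  finally show ?thesis .
qed

lemma exp_minus_lipschitz:
  fixes a b :: real
  assumes "0 \<le> a" "0 \<le> b"
  shows "\<bar>exp (- a) - exp (- b)\<bar> \<le> \<bar>a - b\<bar>"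
proof -
  have *: "\<bar>exp (- a) - exp (- b)\<bar> \<le> b - a" if "0 \<le> a" "a \<le> b" for a b :: real
  proof -
    have "exp (- a) - exp (- b) = exp (- a) * (1 - exp (- (b - a)))"
      by (simp add: algebra_simps exp_add[symmetric])
    also have "\<dots> \<le> 1 * (b - a)"
    proof (rule mult_mono)
      show "1 - exp (- (b - a)) \<le> b - a" using exp_ge_add_one_self[of "- (b - a)"] by linarith
    qed (use that in auto)
    finally show ?thesis using that by simp
  qed
  show ?thesis using *[of a b] *[of b a] assms by (cases "a \<le> b") auto
qed

text \<open>Indexing the two projections by the level lets each statement about a marginal be made once.\<close>

fun proj :: "level \<Rightarrow> real \<times> real \<Rightarrow> real" where
  "proj Fine v = fst v"
| "proj Coarse v = snd v"

lemma proj_measurable: "proj s \<in> borel_measurable borel"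
proof -
  have "proj s \<in> borel_measurable (borel \<Otimes>\<^sub>M borel)"
    by (cases s) (simp_all add: proj.simps[abs_def])
  then show ?thesis unfolding borel_prod .
qed

lemma bounded_continuous_proj: "bounded_continuous f \<Longrightarrow> bounded_continuous (\<lambda>v. f (proj s v))"
  by (cases s) (simp_all add: bounded_continuous_fst bounded_continuous_snd)

text \<open>The coupling hypotheses are stated as image measures under the projections; the marginal flows enter as
  two instances of \<open>feynman_kac\<close>.\<close>

locale coupled_particle_filter =
  fixes G :: "nat \<Rightarrow> real \<Rightarrow> real"
    and \<eta>0 :: "level \<Rightarrow> real measure"
    and M :: "level \<Rightarrow> nat \<Rightarrow> real \<Rightarrow> real measure"
    and \<eta>c0 :: "(real \<times> real) measure"
    and Mc :: "nat \<Rightarrow> real \<times> real \<Rightarrow> (real \<times> real) measure"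
  assumes marginal_flow: "\<And>s. feynman_kac G (\<eta>0 s) (M s)"
    and F_continuous: "\<And>s k. continuous_on UNIV (cdf (fk_eta_bar G (\<eta>0 s) (M s) k))"
    and F_inv_continuous: "\<And>s k. continuous_on {0<..<1} (quantile (fk_eta_bar G (\<eta>0 s) (M s) k))"
    and coupling0: "\<eta>c0 \<in> space (prob_algebra borel)" "\<And>s. distr \<eta>c0 borel (proj s) = \<eta>0 s"
    and Mc_kernel: "\<And>k. k \<ge> 1 \<Longrightarrow> Mc k \<in> borel \<rightarrow>\<^sub>M prob_algebra borel"
    and Mc_coupling: "\<And>s k v. k \<ge> 1 \<Longrightarrow> distr (Mc k v) borel (proj s) = M s k (proj s v)"
    and Mc_feller: "\<And>k. k \<ge> 1 \<Longrightarrow> feller (Mc k)"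
begin

sublocale fk: feynman_kac G "\<eta>0 s" "M s" for s
  by (rule marginal_flow)

abbreviation eta_bar_law :: "level \<Rightarrow> nat \<Rightarrow> real measure" where
  "eta_bar_law s n \<equiv> fk_eta_bar G (\<eta>0 s) (M s) n"

definition etac :: "nat \<Rightarrow> (real \<times> real \<Rightarrow> real) \<Rightarrow> real" where
  "etac n f = (\<integral>v. f v \<partial>eta_check G \<eta>0 M \<eta>c0 Mc n)"

lemma kernel_op_proj:
  assumes f: "f \<in> borel_measurable borel"
  shows "kernel_op (Mc (Suc n)) (\<lambda>v. f (proj s v)) v = kernel_op (M s (Suc n)) f (proj s v)"
proof -
  have "proj s \<in> borel_measurable (Mc (Suc n) v)"
    using proj_measurable[of s] kernel_prob(2)[OF Mc_kernel[of "Suc n"], of v]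
    by (simp cong: measurable_cong_sets)
  then show ?thesis
    using integral_distr[of "proj s" "Mc (Suc n) v" borel f] f Mc_coupling[of "Suc n" v s]
    by (simp add: kernel_op_def)
qed

lemma wasserstein_step_proj:
  assumes \<mu>: "\<And>s. real_distribution (\<mu> s)" and f: "bounded_continuous f"
  shows "(\<integral>v. f (proj s v) \<partial>wasserstein_step (Mc (Suc n)) (\<mu> Fine) (\<mu> Coarse))
    = (\<integral>x. kernel_op (M s (Suc n)) f x \<partial>\<mu> s)"
proof -
  obtain B where B: "\<And>x. \<bar>f x\<bar> \<le> B" using f bounded_continuous_bound by blast
  note fm = bounded_continuous_measurable[OF f]
  note km = bounded_continuous_measurable[OF fk.kernel_op_bounded_continuous[OF f]]
  have K: "Mc (Suc n) \<in> borel \<rightarrow>\<^sub>M prob_algebra borel" by (rule Mc_kernel) simp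
  show ?thesis
  proof (cases s)
    case Fine
    show ?thesis unfolding Fine proj.simps
      by (rule wasserstein_step_fst[OF K \<mu> \<mu> fm B km]) (use kernel_op_proj[OF fm, of n Fine] in simp)
  next
    case Coarse
    show ?thesis unfolding Coarse proj.simps
      by (rule wasserstein_step_snd[OF K \<mu> \<mu> fm B km]) (use kernel_op_proj[OF fm, of n Coarse] in simp)
  qed
qed

lemma eta_check_prob: "eta_check G \<eta>0 M \<eta>c0 Mc n \<in> space (prob_algebra borel)"
  by (cases n) (simp_all add: coupling0 wasserstein_step_prob Mc_kernel fk.eta_bar_real_distribution)

lemma integrable_eta_check:
  assumes "bounded_continuous f" shows "integrable (eta_check G \<eta>0 M \<eta>c0 Mc n) f"
proof -
  interpret prob_space "eta_check G \<eta>0 M \<eta>c0 Mc n" using eta_check_prob[of n] by (simp add: space_prob_algebra)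
  obtain B where "\<And>x. \<bar>f x\<bar> \<le> B" using assms bounded_continuous_bound by blast
  with bounded_continuous_measurable[OF assms] eta_check_prob[of n] show ?thesis
    by (intro integrable_bounded[of _ B]) (auto simp: space_prob_algebra cong: measurable_cong_sets)
qed

lemma etac_proj:
  assumes f: "bounded_continuous f" shows "etac n (\<lambda>v. f (proj s v)) = fk.eta s n f"
proof (cases n)
  case 0
  note fm = bounded_continuous_measurable[OF f]
  have "proj s \<in> borel_measurable \<eta>c0"
    using proj_measurable coupling0(1) by (simp add: space_prob_algebra cong: measurable_cong_sets)
  then show ?thesis
    using integral_distr[of "proj s" \<eta>c0 borel f] fm coupling0(2)[of s]
    by (simp add: 0 etac_def fk.eta_0)
next
  case (Suc m)
  show ?thesis
    using wasserstein_step_proj[where \<mu> = "\<lambda>s. eta_bar_law s m", OF fk.eta_bar_real_distribution f]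
    by (simp add: Suc etac_def fk.eta_Suc[OF f] fk.eta_bar_def)
qed

definition contrast :: "(real \<Rightarrow> real) \<Rightarrow> (real \<Rightarrow> real) \<Rightarrow> real \<times> real \<Rightarrow> real" where
  "contrast \<phi> \<psi> v = \<phi> (proj Fine v) - \<psi> (proj Coarse v)"

lemma contrast_bounded_continuous:
  "bounded_continuous \<phi> \<Longrightarrow> bounded_continuous \<psi> \<Longrightarrow> bounded_continuous (contrast \<phi> \<psi>)"
  unfolding contrast_def[abs_def] by (intro bounded_continuous_diff bounded_continuous_proj)

lemma etac_contrast:
  assumes "bounded_continuous \<phi>" "bounded_continuous \<psi>"
  shows "etac n (contrast \<phi> \<psi>) = fk.eta Fine n \<phi> - fk.eta Coarse n \<psi>"
  using etac_proj[OF assms(1), of n Fine] etac_proj[OF assms(2), of n Coarse]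
    Bochner_Integration.integral_diff[OF integrable_eta_check[OF bounded_continuous_proj[OF assms(1), of Fine]]
      integrable_eta_check[OF bounded_continuous_proj[OF assms(2), of Coarse]]]
  unfolding etac_def contrast_def[abs_def] by metis

abbreviation pull :: "level \<Rightarrow> nat \<Rightarrow> (real \<Rightarrow> real) \<Rightarrow> real \<Rightarrow> real" where
  "pull s n f \<equiv> fk.pullback s n (kernel_op (M s (Suc n)) f)"

lemma pull_bounded_continuous: "bounded_continuous f \<Longrightarrow> bounded_continuous (pull s n f)"
  by (intro fk.pullback_bounded_continuous fk.kernel_op_bounded_continuous)

lemma variance_term:
  assumes "bounded_continuous \<phi>" "bounded_continuous \<psi>"
  shows "(\<integral>v. (tensor (D_op G (\<eta>0 Fine) (M Fine) n n \<phi>) (\<lambda>_. 1) v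
      - tensor (\<lambda>_. 1) (D_op G (\<eta>0 Coarse) (M Coarse) n n \<psi>) v)\<^sup>2 \<partial>eta_check G \<eta>0 M \<eta>c0 Mc n)
    = etac n (\<lambda>v. (contrast \<phi> \<psi> v - etac n (contrast \<phi> \<psi>))\<^sup>2)"
  unfolding etac_contrast[OF assms] unfolding etac_def
  by (intro Bochner_Integration.integral_cong refl)
    (simp add: tensor_def contrast_def case_prod_beta fk.D_op_refl[of "Fine"] fk.D_op_refl[of "Coarse"] algebra_simps)

lemma asymptotic_variance_0:
  assumes "bounded_continuous \<phi>" "bounded_continuous \<psi>"
  shows "asymptotic_variance G \<eta>0 M \<eta>c0 Mc 0 \<phi> \<psi> = etac 0 (\<lambda>v. (contrast \<phi> \<psi> v - etac 0 (contrast \<phi> \<psi>))\<^sup>2)"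
  using variance_term[OF assms, of 0] by (simp add: asymptotic_variance_def)

text \<open>The recursion that the induction over time mirrors: the last summand is the limiting conditional variance
  of the sampling error, the others form the variance of the linearised contrast one step earlier.\<close>

lemma asymptotic_variance_Suc:
  assumes "bounded_continuous \<phi>" "bounded_continuous \<psi>"
  shows "asymptotic_variance G \<eta>0 M \<eta>c0 Mc (Suc n) \<phi> \<psi>
    = asymptotic_variance G \<eta>0 M \<eta>c0 Mc n (pull Fine n \<phi>) (pull Coarse n \<psi>)
      + etac (Suc n) (\<lambda>v. (contrast \<phi> \<psi> v - etac (Suc n) (contrast \<phi> \<psi>))\<^sup>2)"
proof -
  have "(\<integral>v. (tensor (D_op G (\<eta>0 Fine) (M Fine) p (Suc n) \<phi>) (\<lambda>_. 1) v
      - tensor (\<lambda>_. 1) (D_op G (\<eta>0 Coarse) (M Coarse) p (Suc n) \<psi>) v)\<^sup>2 \<partial>eta_check G \<eta>0 M \<eta>c0 Mc p)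
    = (\<integral>v. (tensor (D_op G (\<eta>0 Fine) (M Fine) p n (pull Fine n \<phi>)) (\<lambda>_. 1) v
      - tensor (\<lambda>_. 1) (D_op G (\<eta>0 Coarse) (M Coarse) p n (pull Coarse n \<psi>)) v)\<^sup>2 \<partial>eta_check G \<eta>0 M \<eta>c0 Mc p)"
    if "p \<in> {0..n}" for p
  proof -
    have "D_op G (\<eta>0 Fine) (M Fine) p (Suc n) \<phi> = D_op G (\<eta>0 Fine) (M Fine) p n (pull Fine n \<phi>)"
      "D_op G (\<eta>0 Coarse) (M Coarse) p (Suc n) \<psi> = D_op G (\<eta>0 Coarse) (M Coarse) p n (pull Coarse n \<psi>)"
      using that assms by (auto intro!: ext fk.D_op_Suc)
    then show ?thesis by simp
  qed
  then show ?thesis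
    unfolding asymptotic_variance_def sum.atLeast0_atMost_Suc variance_term[OF assms] by simp
qed

lemma asymptotic_variance_nonneg: "0 \<le> asymptotic_variance G \<eta>0 M \<eta>c0 Mc n \<phi> \<psi>"
  unfolding asymptotic_variance_def by (intro sum_nonneg) simp

definition wemp :: "level \<Rightarrow> nat \<Rightarrow> nat \<Rightarrow> (nat \<Rightarrow> real \<times> real) \<Rightarrow> real measure" where
  "wemp s N n u = weighted_empirical (G n) N (\<lambda>j. proj s (u j))"

definition step :: "nat \<Rightarrow> nat \<Rightarrow> (nat \<Rightarrow> real \<times> real) \<Rightarrow> (real \<times> real) measure" where
  "step N n u = wasserstein_step (Mc (Suc n)) (wemp Fine N n u) (wemp Coarse N n u)"

lemma particle_kernel_Suc: "particle_kernel G Mc N (Suc n) u = (\<Pi>\<^sub>M i\<in>{1..N}. step N n u)"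
  by (simp add: particle_kernel_def step_def wemp_def)

text \<open>The law of the configuration at time \<open>n\<close>. The algorithm is a Markov chain and the theorem concerns its
  last state only, so the path law can be replaced by this recursion (\<open>particle_law_marginal\<close>).\<close>

primrec law :: "nat \<Rightarrow> nat \<Rightarrow> (nat \<Rightarrow> real \<times> real) measure" where
  "law N 0 = (\<Pi>\<^sub>M i\<in>{1..N}. \<eta>c0)"
| "law N (Suc n) = law N n \<bind> particle_kernel G Mc N (Suc n)"

context
  fixes N :: nat
  assumes N: "N \<ge> 1"
begin

lemma wemp_kernel: "wemp s N n \<in> config_space N \<rightarrow>\<^sub>M prob_algebra borel"
  unfolding wemp_def[abs_def] config_space_def
  by (rule weighted_empirical_measurable[OF fk.G_pos fk.G_meas N proj_measurable])

lemma wemp_real_distribution: "real_distribution (wemp s N n u)"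
  unfolding wemp_def by (rule real_distribution_prob_algebra[OF weighted_empirical_prob[OF fk.G_pos N]])

lemma wemp_integral:
  "f \<in> borel_measurable borel \<Longrightarrow> (\<integral>x. f x \<partial>wemp s N n u)
    = emean N (\<lambda>v. G n (proj s v) * f (proj s v)) u / emean N (\<lambda>v. G n (proj s v)) u"
  unfolding wemp_def by (subst weighted_empirical_integral[OF _ fk.G_pos N]) (simp_all add: emean_def)

lemma step_kernel: "step N n \<in> config_space N \<rightarrow>\<^sub>M prob_algebra borel"
  unfolding step_def[abs_def] by (intro wasserstein_step_measurable wemp_kernel Mc_kernel) simp

lemma step_prob: "prob_space (step N n u)" "sets (step N n u) = sets borel"
  using wasserstein_step_prob[OF Mc_kernel[of "Suc n"] wemp_real_distribution wemp_real_distribution]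
  by (simp_all add: step_def space_prob_algebra)

lemma step_proj:
  "bounded_continuous f \<Longrightarrow> (\<integral>v. f (proj s v) \<partial>step N n u) = (\<integral>x. kernel_op (M s (Suc n)) f x \<partial>wemp s N n u)"
  unfolding step_def using wasserstein_step_proj[where \<mu> = "\<lambda>s. wemp s N n u"] wemp_real_distribution by blast

lemma particle_kernel_measurable:
  "particle_kernel G Mc N (Suc n) \<in> config_space N \<rightarrow>\<^sub>M prob_algebra (config_space N)"
  unfolding particle_kernel_Suc[abs_def] config_space_def
  by (rule measurable_PiM_kernel[OF step_kernel[unfolded config_space_def]]) simp

lemma initial_law: "(\<Pi>\<^sub>M i\<in>{1..N}. \<eta>c0) \<in> space (prob_algebra (config_space N))"
  using coupling0(1) unfolding space_prob_algebra config_space_def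
  by (auto intro!: prob_space_PiM sets_PiM_cong)

lemma particle_chain: "markov_chain (config_space N) (\<Pi>\<^sub>M i\<in>{1..N}. \<eta>c0) (particle_kernel G Mc N)"
proof
  fix k :: nat assume "1 \<le> k"
  then show "particle_kernel G Mc N k \<in> config_space N \<rightarrow>\<^sub>M prob_algebra (config_space N)"
    using particle_kernel_measurable[of "k - 1"] by simp
qed (rule initial_law)

lemma particle_law_marginal: "distr (particle_law G \<eta>c0 Mc N n) (config_space N) (\<lambda>x. x n) = law N n"
proof -
  interpret markov_chain "config_space N" "\<Pi>\<^sub>M i\<in>{1..N}. \<eta>c0" "particle_kernel G Mc N"
    by (rule particle_chain)
  show ?thesis unfolding particle_law_def
    by (induction n) (simp_all only: law.simps chain_law_marginal_0 chain_law_marginal_Suc)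
qed

lemma law_prob: "prob_space (law N n)" and law_sets: "sets (law N n) = sets (config_space N)"
proof -
  have "law N n \<in> space (prob_algebra (config_space N))"
  proof (induction n)
    case (Suc n)
    show ?case using prob_space_bind'[OF Suc particle_kernel_measurable] sets_bind'[OF Suc particle_kernel_measurable]
      by (simp add: space_prob_algebra)
  qed (use initial_law in simp)
  then show "prob_space (law N n)" "sets (law N n) = sets (config_space N)"
    by (simp_all add: space_prob_algebra)
qed

lemma law_measurable: "borel_measurable (law N n) = borel_measurable (config_space N)"
  by (rule measurable_cong_sets[OF law_sets refl])

lemma law_Suc_integral:
  fixes F :: "(nat \<Rightarrow> real \<times> real) \<Rightarrow> real"
  assumes "F \<in> borel_measurable (config_space N)" "\<And>v. \<bar>F v\<bar> \<le> B"
  shows "(\<integral>v. F v \<partial>law N (Suc n)) = (\<integral>u. \<integral>v. F v \<partial>(\<Pi>\<^sub>M i\<in>{1..N}. step N n u) \<partial>law N n)"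
  using particle_kernel_measurable[of n] assms unfolding law.simps
  by (subst integral_bind_kernel[OF law_prob, where S = "config_space N" and B = B])
    (simp_all add: particle_kernel_Suc measurable_cong_sets[OF law_sets refl])

lemma law_Suc_integral_complex:
  fixes F :: "(nat \<Rightarrow> real \<times> real) \<Rightarrow> complex"
  assumes "F \<in> borel_measurable (config_space N)" "\<And>v. norm (F v) \<le> B" "0 \<le> B"
  shows "(\<integral>v. F v \<partial>law N (Suc n)) = (\<integral>u. \<integral>v. F v \<partial>(\<Pi>\<^sub>M i\<in>{1..N}. step N n u) \<partial>law N n)"
  using particle_kernel_measurable[of n] assms unfolding law.simps
  by (subst integral_bind_kernel_complex[OF law_prob, where S = "config_space N" and B = B])
    (simp_all add: particle_kernel_Suc measurable_cong_sets[OF law_sets refl])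

lemma law_Suc_inner_measurable:
  fixes F :: "(nat \<Rightarrow> real \<times> real) \<Rightarrow> 'c::{banach, second_countable_topology}"
  assumes "F \<in> borel_measurable (config_space N)"
  shows "(\<lambda>u. \<integral>v. F v \<partial>(\<Pi>\<^sub>M i\<in>{1..N}. step N n u)) \<in> borel_measurable (law N n)"
  using measurable_integral_kernel[OF particle_kernel_measurable assms, of n]
  by (simp add: particle_kernel_Suc law_measurable)

lemma emean_config:
  fixes f :: "real \<times> real \<Rightarrow> real"
  shows "bounded_continuous f \<Longrightarrow> emean N f \<in> borel_measurable (config_space N)"
  unfolding config_space_def by (intro emean_measurable[of f borel] bounded_continuous_measurable) simp_all

lemma integral_step_measurable:
  fixes f :: "real \<times> real \<Rightarrow> real"
  assumes "f \<in> borel_measurable borel" shows "(\<lambda>u. \<integral>v. f v \<partial>step N n u) \<in> borel_measurable (law N n)"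
  unfolding law_measurable by (rule measurable_integral_kernel[OF step_kernel assms])

lemma integral_wemp_measurable:
  fixes f :: "real \<Rightarrow> real"
  assumes "f \<in> borel_measurable borel" shows "(\<lambda>u. \<integral>x. f x \<partial>wemp s N n u) \<in> borel_measurable (law N n)"
  unfolding law_measurable by (rule measurable_integral_kernel[OF wemp_kernel assms])

lemma integral_step_bound:
  fixes f :: "real \<times> real \<Rightarrow> real"
  assumes "\<And>x. \<bar>f x\<bar> \<le> B" shows "\<bar>\<integral>v. f v \<partial>step N n u\<bar> \<le> B"
proof -
  interpret prob_space "step N n u" by (rule step_prob)
  have "0 \<le> B" using assms[of undefined] by linarith
  then show ?thesis using norm_integral_bounded[of f B] assms by auto
qed

lemma integral_wemp_bound:
  fixes f :: "real \<Rightarrow> real"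
  assumes "\<And>x. \<bar>f x\<bar> \<le> B" shows "\<bar>\<integral>v. f v \<partial>wemp s N n u\<bar> \<le> B"
proof -
  interpret real_distribution "wemp s N n u" by (rule wemp_real_distribution)
  have "0 \<le> B" using assms[of undefined] by linarith
  then show ?thesis using norm_integral_bounded[of f B] assms by auto
qed

text \<open>An exact expansion of a ratio of empirical means around its limit: the linear term, plus a product of two
  deviations. Keeping the deviation itself on the right-hand side avoids dividing by the empirical mean of
  \<open>G\<^sub>n\<close>, which is positive but not bounded away from zero.\<close>

lemma boltzmann_expansion:
  assumes f: "bounded_continuous f"
  shows "(\<integral>x. f x \<partial>wemp s N n u) - fk.eta_bar s n f
    = emean N (\<lambda>v. fk.pullback s n f (proj s v)) u
      + ((\<integral>x. f x \<partial>wemp s N n u) - fk.eta_bar s n f)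
        * (fk.eta s n (G n) - emean N (\<lambda>v. G n (proj s v)) u) / fk.eta s n (G n)"
proof -
  define a where "a = emean N (\<lambda>v. G n (proj s v)) u"
  define g where "g = fk.eta s n (G n)"
  define e where "e = fk.eta_bar s n f"
  define b where "b = emean N (\<lambda>v. G n (proj s v) * f (proj s v)) u"
  have g: "0 < g" unfolding g_def by (rule fk.eta_G_pos)
  have a: "0 < a" unfolding a_def emean_def using N fk.G_pos by (intro divide_pos_pos sum_pos) auto
  have we: "(\<integral>x. f x \<partial>wemp s N n u) = b / a"
    unfolding a_def b_def by (rule wemp_integral[OF bounded_continuous_measurable[OF f]])
  have "(\<lambda>v. fk.pullback s n f (proj s v)) = (\<lambda>v. (1 / g) * (G n (proj s v) * f (proj s v) - e * G n (proj s v)))"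
    by (auto simp: fk.pullback_def g_def e_def diff_divide_distrib algebra_simps)
  then have "emean N (\<lambda>v. fk.pullback s n f (proj s v)) u = (b - e * a) / g"
    by (simp only: emean_cmult emean_diff a_def b_def) simp
  then show ?thesis unfolding we using a g
    by (simp add: a_def[symmetric] g_def[symmetric] e_def[symmetric]) (simp add: field_simps)
qed

lemma law_integrable:
  fixes X :: "(nat \<Rightarrow> real \<times> real) \<Rightarrow> 'c::{banach, second_countable_topology}"
  assumes "X \<in> borel_measurable (law N n)" "\<And>u. norm (X u) \<le> B"
  shows "integrable (law N n) X"
  using prob_space.integrable_bounded[OF law_prob assms] .

lemma law_integrable_square:
  fixes X :: "(nat \<Rightarrow> real \<times> real) \<Rightarrow> real"
  assumes X: "X \<in> borel_measurable (law N n)" "\<And>u. \<bar>X u\<bar> \<le> B"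
  shows "integrable (law N n) (\<lambda>u. (X u - c)\<^sup>2)"
proof (rule law_integrable)
  show "norm ((X u - c)\<^sup>2) \<le> (B + \<bar>c\<bar>)\<^sup>2" for u
    using power_mono[of "\<bar>X u - c\<bar>" "B + \<bar>c\<bar>" 2] X(2)[of u] by simp
qed (use X in measurable)

lemma emean_integrable_square:
  assumes "bounded_continuous f"
  shows "integrable (law N n) (\<lambda>u. (emean N f u - c)\<^sup>2)"
proof -
  obtain B where B: "0 \<le> B" "\<And>x. \<bar>f x\<bar> \<le> B" using assms bounded_continuous_bound by blast
  show ?thesis
    by (rule law_integrable_square[of _ _ B]) (use emean_config[OF assms] emean_bound[OF B(2,1)] in \<open>auto simp: law_measurable\<close>)
qed

lemma wemp_integrable_square:
  assumes "bounded_continuous f"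
  shows "integrable (law N n) (\<lambda>u. ((\<integral>x. f x \<partial>wemp s N n u) - c)\<^sup>2)"
proof -
  obtain B where B: "0 \<le> B" "\<And>x. \<bar>f x\<bar> \<le> B" using assms bounded_continuous_bound by blast
  show ?thesis
    by (rule law_integrable_square[OF integral_wemp_measurable integral_wemp_bound])
      (rule bounded_continuous_measurable[OF assms] B)+
qed

text \<open>Passing from a second to a first moment by the arithmetic-geometric mean inequality
  \<open>\<bar>x\<bar> \<le> r x\<^sup>2 + 1/r\<close> at \<open>r = sqrt N\<close>.\<close>

lemma expectation_abs_le:
  assumes X: "X \<in> borel_measurable (law N n)" "\<And>u. \<bar>X u\<bar> \<le> B"
    and C: "(\<integral>u. (X u)\<^sup>2 \<partial>law N n) \<le> C / real N"
  shows "(\<integral>u. \<bar>X u\<bar> \<partial>law N n) \<le> (C + 1) / sqrt (real N)"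
proof -
  interpret prob_space "law N n" by (rule law_prob)
  define r where "r = sqrt (real N)"
  have r: "0 < r" "real N = r * r" using N by (auto simp: r_def)
  have "\<bar>X u\<bar> \<le> r * (X u)\<^sup>2 + 1 / r" for u
  proof -
    have "0 \<le> (r * \<bar>X u\<bar> - 1)\<^sup>2 + r * \<bar>X u\<bar>" using r by simp
    then have "r * \<bar>X u\<bar> \<le> r * (r * (X u)\<^sup>2 + 1 / r)"
      using r(1) by (simp add: power2_eq_square algebra_simps abs_mult_self_eq)
    then show ?thesis using r(1) by simp
  qed
  moreover have int: "integrable (law N n) (\<lambda>u. (X u)\<^sup>2)"
    using law_integrable_square[OF X, of 0] by simp
  moreover have "integrable (law N n) X" using X by (intro law_integrable[of _ _ B]) auto
  ultimately have "(\<integral>u. \<bar>X u\<bar> \<partial>law N n) \<le> (\<integral>u. r * (X u)\<^sup>2 + 1 / r \<partial>law N n)"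
    by (intro integral_mono) auto
  also have "\<dots> = r * (\<integral>u. (X u)\<^sup>2 \<partial>law N n) + 1 / r"
    using int by (simp add: prob_space)
  also have "\<dots> \<le> r * (C / real N) + 1 / r" using C r(1) by (intro add_right_mono mult_left_mono) auto
  also have "\<dots> = (C + 1) / r" unfolding r(2) using r(1) by (simp add: add_divide_distrib)
  finally show ?thesis by (simp add: r_def)
qed

end

end

section \<open>Mean square error and law of large numbers\<close>

lemma over_sqrt_tendsto_0: "(\<lambda>N. C / sqrt (real N)) \<longlonglongrightarrow> 0"
  by (intro tendsto_divide_0[OF tendsto_const] filterlim_at_top_imp_at_infinity
      filterlim_compose[OF sqrt_at_top] filterlim_real_sequentially)

context coupled_particle_filter
begin

lemma square_sum_le: "(x + y)\<^sup>2 \<le> 2 * x\<^sup>2 + 2 * y\<^sup>2" for x y :: real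
  using zero_le_power2[of "x - y"] by (simp add: power2_sum power2_diff)

lemma eta_bar_bound:
  assumes "\<And>x. \<bar>f x\<bar> \<le> B" "0 \<le> B" shows "\<bar>fk.eta_bar s n f\<bar> \<le> B"
proof -
  interpret real_distribution "eta_bar_law s n" by (rule fk.eta_bar_real_distribution)
  show ?thesis unfolding fk.eta_bar_def using norm_integral_bounded[of f B] assms by auto
qed

text \<open>Reweighting preserves the rate: in \<open>boltzmann_expansion\<close> the leading factor of the remainder is bounded by
  \<open>2 B\<close>, so the deviation is controlled by the deviations of two empirical means. The hypothesis is the bound
  for empirical means at the same time, as available in the induction of \<open>emean_mean_square\<close>.\<close>

lemma wemp_mean_square_aux:
  assumes A: "\<And>f. bounded_continuous f \<Longrightarrow> \<exists>C\<ge>0. \<forall>N\<ge>1.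
      (\<integral>u. (emean N (\<lambda>v. f (proj s v)) u - fk.eta s n f)\<^sup>2 \<partial>law N n) \<le> C / real N"
    and f: "bounded_continuous f"
  shows "\<exists>C\<ge>0. \<forall>N\<ge>1. (\<integral>u. ((\<integral>x. f x \<partial>wemp s N n u) - fk.eta_bar s n f)\<^sup>2 \<partial>law N n) \<le> C / real N"
proof -
  obtain B where B: "0 \<le> B" "\<And>x. \<bar>f x\<bar> \<le> B" using f bounded_continuous_bound by blast
  define g where "g = fk.eta s n (G n)"
  define k where "k = 2 * ((2 * B)\<^sup>2 / g\<^sup>2)"
  have g: "0 < g" unfolding g_def by (rule fk.eta_G_pos)
  note pb = fk.pullback_bounded_continuous[OF f, of s n]
  obtain C1 where C1: "0 \<le> C1" "\<And>N. N \<ge> 1 \<Longrightarrow>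
      (\<integral>u. (emean N (\<lambda>v. fk.pullback s n f (proj s v)) u)\<^sup>2 \<partial>law N n) \<le> C1 / real N"
    using A[OF pb] fk.eta_pullback[OF f, of s n] by auto
  obtain C2 where C2: "0 \<le> C2" "\<And>N. N \<ge> 1 \<Longrightarrow>
      (\<integral>u. (emean N (\<lambda>v. G n (proj s v)) u - g)\<^sup>2 \<partial>law N n) \<le> C2 / real N"
    using A[OF fk.G_continuous] unfolding g_def by blast
  have k: "0 \<le> k" unfolding k_def by simp
  have "(\<integral>u. ((\<integral>x. f x \<partial>wemp s N n u) - fk.eta_bar s n f)\<^sup>2 \<partial>law N n) \<le> (2 * C1 + k * C2) / real N"
    if N: "N \<ge> 1" for N
  proof -
    have pt: "((\<integral>x. f x \<partial>wemp s N n u) - fk.eta_bar s n f)\<^sup>2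
       \<le> 2 * (emean N (\<lambda>v. fk.pullback s n f (proj s v)) u)\<^sup>2 + k * (emean N (\<lambda>v. G n (proj s v)) u - g)\<^sup>2" for u
    proof -
      define D where "D = (\<integral>x. f x \<partial>wemp s N n u) - fk.eta_bar s n f"
      define x where "x = emean N (\<lambda>v. fk.pullback s n f (proj s v)) u"
      define y where "y = g - emean N (\<lambda>v. G n (proj s v)) u"
      have D: "D = x + D * y / g" using boltzmann_expansion[OF N f, of s n u]
        by (simp add: D_def x_def y_def g_def)
      have "\<bar>D\<bar> \<le> 2 * B" unfolding D_def
        using integral_wemp_bound[of N f B s n u, OF N B(2)] eta_bar_bound[of f B s n, OF B(2,1)] by linarith
      then have D2: "D\<^sup>2 \<le> (2 * B)\<^sup>2" using power_mono[of "\<bar>D\<bar>" "2 * B" 2] by simp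
      have "D\<^sup>2 \<le> 2 * x\<^sup>2 + 2 * (D * y / g)\<^sup>2" using square_sum_le[of x "D * y / g"] D by simp
      also have "(D * y / g)\<^sup>2 = D\<^sup>2 * (y\<^sup>2 / g\<^sup>2)" by (simp add: power_divide power_mult_distrib)
      also have "\<dots> \<le> (2 * B)\<^sup>2 * (y\<^sup>2 / g\<^sup>2)" using D2 by (intro mult_right_mono) auto
      finally have "D\<^sup>2 \<le> 2 * x\<^sup>2 + k * y\<^sup>2" by (simp add: k_def)
      then show ?thesis unfolding D_def x_def y_def by (simp add: power2_commute)
    qed
    have i1: "integrable (law N n) (\<lambda>u. (emean N (\<lambda>v. fk.pullback s n f (proj s v)) u)\<^sup>2)"
      using emean_integrable_square[OF N bounded_continuous_proj[OF pb], where n = n and c = 0] by simp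
    have i2: "integrable (law N n) (\<lambda>u. (emean N (\<lambda>v. G n (proj s v)) u - g)\<^sup>2)"
      by (rule emean_integrable_square[OF N bounded_continuous_proj[OF fk.G_continuous]])
    have "(\<integral>u. ((\<integral>x. f x \<partial>wemp s N n u) - fk.eta_bar s n f)\<^sup>2 \<partial>law N n)
      \<le> (\<integral>u. 2 * (emean N (\<lambda>v. fk.pullback s n f (proj s v)) u)\<^sup>2
          + k * (emean N (\<lambda>v. G n (proj s v)) u - g)\<^sup>2 \<partial>law N n)"
      using i1 i2 pt by (intro integral_mono wemp_integrable_square[OF N f]) auto
    also have "\<dots> = 2 * (\<integral>u. (emean N (\<lambda>v. fk.pullback s n f (proj s v)) u)\<^sup>2 \<partial>law N n)
        + k * (\<integral>u. (emean N (\<lambda>v. G n (proj s v)) u - g)\<^sup>2 \<partial>law N n)"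
      using i1 i2 by simp
    also have "\<dots> \<le> 2 * (C1 / real N) + k * (C2 / real N)"
      by (intro add_mono mult_left_mono C1(2)[OF N] C2(2)[OF N] k) simp
    finally show ?thesis by (simp add: add_divide_distrib)
  qed
  moreover have "0 \<le> 2 * C1 + k * C2" using C1 C2 k by simp
  ultimately show ?thesis by blast
qed

text \<open>The mean square error splits into the conditional variance of the fresh samples and the error of the
  conditional mean, which is a reweighted mean one step earlier.\<close>

lemma emean_mean_square:
  "bounded_continuous f \<Longrightarrow> \<exists>C\<ge>0. \<forall>N\<ge>1.
      (\<integral>u. (emean N (\<lambda>v. f (proj s v)) u - fk.eta s n f)\<^sup>2 \<partial>law N n) \<le> C / real N"
proof (induction n arbitrary: f)
  case 0
  obtain B where B: "0 \<le> B" "\<And>x. \<bar>f x\<bar> \<le> B" using 0 bounded_continuous_bound by blast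
  interpret prob_space \<eta>c0 using coupling0 by (simp add: space_prob_algebra)
  have "(\<lambda>v. f (proj s v)) \<in> borel_measurable \<eta>c0"
    using coupling0(1) bounded_continuous_measurable[OF bounded_continuous_proj[OF 0, of s]]
    by (simp add: space_prob_algebra cong: measurable_cong_sets)
  moreover have "expectation (\<lambda>v. f (proj s v)) = fk.eta s 0 f"
    using etac_proj[OF 0, of 0 s] by (simp add: etac_def)
  ultimately have "(\<integral>u. (emean N (\<lambda>v. f (proj s v)) u - fk.eta s 0 f)\<^sup>2 \<partial>law N 0) \<le> 4 * B\<^sup>2 / real N"
    if "N \<ge> 1" for N
    using emean_iid_variance[of "\<lambda>v. f (proj s v)" B N] B that by simp
  then show ?case by (intro exI[of _ "4 * B\<^sup>2"]) simp
next
  case (Suc n)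
  note f = Suc.prems
  obtain B where B: "0 \<le> B" "\<And>x. \<bar>f x\<bar> \<le> B" using f bounded_continuous_bound by blast
  note fm = bounded_continuous_measurable[OF bounded_continuous_proj[OF f, of s]]
  note Kf = fk.kernel_op_bounded_continuous[OF f, of s n]
  obtain C where C: "0 \<le> C" "\<And>N. N \<ge> 1 \<Longrightarrow>
      (\<integral>u. ((\<integral>x. kernel_op (M s (Suc n)) f x \<partial>wemp s N n u) - fk.eta s (Suc n) f)\<^sup>2 \<partial>law N n) \<le> C / real N"
    using wemp_mean_square_aux[OF Suc.IH Kf] unfolding fk.eta_Suc[OF f] by blast
  have "(\<integral>v. (emean N (\<lambda>v. f (proj s v)) v - fk.eta s (Suc n) f)\<^sup>2 \<partial>law N (Suc n)) \<le> (8 * B\<^sup>2 + 2 * C) / real N"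
    if N: "N \<ge> 1" for N
  proof -
    interpret L: prob_space "law N n" by (rule law_prob[OF N])
    define c where "c = fk.eta s (Suc n) f"
    define m where "m u = (\<integral>x. kernel_op (M s (Suc n)) f x \<partial>wemp s N n u)" for u
    define e where "e v = emean N (\<lambda>v. f (proj s v)) v" for v
    have em: "e \<in> borel_measurable (config_space N)"
      unfolding e_def by (rule emean_config[OF N bounded_continuous_proj[OF f]])
    have eb: "\<bar>e v\<bar> \<le> B" for v unfolding e_def using B by (intro emean_bound)
    have c: "\<bar>c\<bar> \<le> B"
    proof -
      interpret real_distribution "fk_eta G (\<eta>0 s) (M s) (Suc n)" by (rule fk.eta_real_distribution)
      show ?thesis unfolding c_def fk.eta_def using norm_integral_bounded[of f B] B by auto
    qed
    have inner: "(\<integral>v. (e v - c)\<^sup>2 \<partial>(\<Pi>\<^sub>M i\<in>{1..N}. step N n u)) \<le> 8 * B\<^sup>2 / real N + 2 * (m u - c)\<^sup>2" for u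
    proof -
      interpret S: prob_space "step N n u" by (rule step_prob[OF N])
      interpret P: prob_space "\<Pi>\<^sub>M i\<in>{1..N}. step N n u" by (rule prob_space_PiM) (rule S.prob_space_axioms)
      have fmS: "(\<lambda>v. f (proj s v)) \<in> borel_measurable (step N n u)"
        using fm step_prob(2)[OF N] by (simp cong: measurable_cong_sets)
      have mu: "S.expectation (\<lambda>v. f (proj s v)) = m u" unfolding m_def by (rule step_proj[OF N f])
      have mb: "\<bar>m u\<bar> \<le> B" unfolding mu[symmetric] using B by (intro integral_step_bound[OF N])
      have emS: "e \<in> borel_measurable (\<Pi>\<^sub>M i\<in>{1..N}. step N n u)"
        unfolding e_def by (rule emean_measurable[OF fmS refl])
      have sq: "(e v - d)\<^sup>2 \<le> (2 * B)\<^sup>2" if "\<bar>d\<bar> \<le> B" for v d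
        using power_mono[of "\<bar>e v - d\<bar>" "2 * B" 2] eb[of v] that by simp
      have int: "integrable (\<Pi>\<^sub>M i\<in>{1..N}. step N n u) (\<lambda>v. (e v - d)\<^sup>2)" if "\<bar>d\<bar> \<le> B" for d
        using emS sq[OF that] by (intro P.integrable_bounded[of _ "(2 * B)\<^sup>2"]) auto
      have "(\<integral>v. (e v - c)\<^sup>2 \<partial>(\<Pi>\<^sub>M i\<in>{1..N}. step N n u))
        \<le> (\<integral>v. 2 * (e v - m u)\<^sup>2 + 2 * (m u - c)\<^sup>2 \<partial>(\<Pi>\<^sub>M i\<in>{1..N}. step N n u))"
      proof (rule integral_mono)
        fix v show "(e v - c)\<^sup>2 \<le> 2 * (e v - m u)\<^sup>2 + 2 * (m u - c)\<^sup>2"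
          using square_sum_le[of "e v - m u" "m u - c"] by simp
      qed (intro Bochner_Integration.integrable_add integrable_mult_right P.integrable_const int c mb)+
      also have "\<dots> = 2 * (\<integral>v. (e v - m u)\<^sup>2 \<partial>(\<Pi>\<^sub>M i\<in>{1..N}. step N n u)) + 2 * (m u - c)\<^sup>2"
        by (subst Bochner_Integration.integral_add[OF integrable_mult_right[OF int[OF mb]] P.integrable_const])
          (simp add: P.prob_space[simplified])
      also have "(\<integral>v. (e v - m u)\<^sup>2 \<partial>(\<Pi>\<^sub>M i\<in>{1..N}. step N n u)) \<le> 4 * B\<^sup>2 / real N"
        using S.emean_iid_variance[OF fmS _ N, of B] B unfolding mu e_def by simp
      finally show ?thesis by simp
    qed
    have sq: "(e v - c)\<^sup>2 \<le> (2 * B)\<^sup>2" for v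
      using power_mono[of "\<bar>e v - c\<bar>" "2 * B" 2] eb[of v] c by simp
    have ecm: "(\<lambda>v. (e v - c)\<^sup>2) \<in> borel_measurable (config_space N)" using em by measurable
    have im: "integrable (law N n) (\<lambda>u. (m u - c)\<^sup>2)"
      unfolding m_def by (rule wemp_integrable_square[OF N Kf])
    have "(\<integral>v. (e v - c)\<^sup>2 \<partial>law N (Suc n)) = (\<integral>u. \<integral>v. (e v - c)\<^sup>2 \<partial>(\<Pi>\<^sub>M i\<in>{1..N}. step N n u) \<partial>law N n)"
      using sq by (intro law_Suc_integral[OF N ecm, where B = "(2 * B)\<^sup>2"]) auto
    also have "\<dots> \<le> (\<integral>u. 8 * B\<^sup>2 / real N + 2 * (m u - c)\<^sup>2 \<partial>law N n)"
    proof (intro integral_mono inner)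
      show "integrable (law N n) (\<lambda>u. \<integral>v. (e v - c)\<^sup>2 \<partial>(\<Pi>\<^sub>M i\<in>{1..N}. step N n u))"
      proof (rule law_integrable[OF N law_Suc_inner_measurable[OF N ecm]])
        fix u
        interpret P: prob_space "\<Pi>\<^sub>M i\<in>{1..N}. step N n u" by (rule prob_space_PiM) (rule step_prob[OF N])
        show "norm (\<integral>v. (e v - c)\<^sup>2 \<partial>(\<Pi>\<^sub>M i\<in>{1..N}. step N n u)) \<le> (2 * B)\<^sup>2"
          using sq by (intro P.norm_integral_bounded) auto
      qed
    qed (use im in auto)
    also have "\<dots> = 8 * B\<^sup>2 / real N + 2 * (\<integral>u. (m u - c)\<^sup>2 \<partial>law N n)"
      using im by (simp add: L.prob_space)
    also have "\<dots> \<le> 8 * B\<^sup>2 / real N + 2 * (C / real N)"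
      using C(2)[OF N] by (simp add: m_def c_def)
    finally show ?thesis by (simp add: e_def c_def add_divide_distrib)
  qed
  then show ?case using C(1) by (intro exI[of _ "8 * B\<^sup>2 + 2 * C"]) simp
qed

lemma wemp_mean_square:
  assumes f: "bounded_continuous f"
  shows "\<exists>C\<ge>0. \<forall>N\<ge>1. (\<integral>u. ((\<integral>x. f x \<partial>wemp s N n u) - fk.eta_bar s n f)\<^sup>2 \<partial>law N n) \<le> C / real N"
  by (rule wemp_mean_square_aux[OF _ f]) (rule emean_mean_square)

text \<open>The remainder of the expansion is a product of two deviations of root mean square order \<open>1 / sqrt N\<close>, so it
  still vanishes after multiplication by \<open>sqrt N\<close>.\<close>

lemma linearization_error:
  assumes f: "bounded_continuous f"
  shows "\<exists>C\<ge>0. \<forall>N\<ge>1. (\<integral>u. \<bar>(\<integral>x. f x \<partial>wemp s N n u) - fk.eta_bar s n f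
      - emean N (\<lambda>v. fk.pullback s n f (proj s v)) u\<bar> \<partial>law N n) \<le> C / real N"
proof -
  define g where "g = fk.eta s n (G n)"
  have g: "0 < g" unfolding g_def by (rule fk.eta_G_pos)
  obtain C1 where C1: "0 \<le> C1" "\<And>N. N \<ge> 1 \<Longrightarrow>
      (\<integral>u. ((\<integral>x. f x \<partial>wemp s N n u) - fk.eta_bar s n f)\<^sup>2 \<partial>law N n) \<le> C1 / real N"
    using wemp_mean_square[OF f] by blast
  obtain C2 where C2: "0 \<le> C2" "\<And>N. N \<ge> 1 \<Longrightarrow>
      (\<integral>u. (emean N (\<lambda>v. G n (proj s v)) u - g)\<^sup>2 \<partial>law N n) \<le> C2 / real N"
    using emean_mean_square[OF fk.G_continuous] unfolding g_def by blast
  have "(\<integral>u. \<bar>(\<integral>x. f x \<partial>wemp s N n u) - fk.eta_bar s n f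
      - emean N (\<lambda>v. fk.pullback s n f (proj s v)) u\<bar> \<partial>law N n) \<le> ((C1 + C2) / (2 * g)) / real N"
    if N: "N \<ge> 1" for N
  proof -
    let ?D = "\<lambda>u. (\<integral>x. f x \<partial>wemp s N n u) - fk.eta_bar s n f"
    let ?y = "\<lambda>u. emean N (\<lambda>v. G n (proj s v)) u - g"
    have pt: "\<bar>?D u - emean N (\<lambda>v. fk.pullback s n f (proj s v)) u\<bar> \<le> ((?D u)\<^sup>2 + (?y u)\<^sup>2) / (2 * g)" for u
    proof -
      define D where "D = ?D u"
      define y where "y = ?y u"
      have "D - emean N (\<lambda>v. fk.pullback s n f (proj s v)) u = - (D * y) / g"
        using boltzmann_expansion[OF N f, of s n u] by (simp add: D_def y_def g_def algebra_simps)
      then have "\<bar>D - emean N (\<lambda>v. fk.pullback s n f (proj s v)) u\<bar> = (\<bar>D\<bar> * \<bar>y\<bar>) / g"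
        using g by (simp add: abs_mult)
      also have "\<dots> \<le> ((D\<^sup>2 + y\<^sup>2) / 2) / g"
        using zero_le_power2[of "\<bar>D\<bar> - \<bar>y\<bar>"] g by (intro divide_right_mono) (auto simp: power2_diff)
      finally show ?thesis by (simp add: D_def y_def)
    qed
    have i1: "integrable (law N n) (\<lambda>u. (?D u)\<^sup>2)" by (rule wemp_integrable_square[OF N f])
    have i2: "integrable (law N n) (\<lambda>u. (?y u)\<^sup>2)"
      by (rule emean_integrable_square[OF N bounded_continuous_proj[OF fk.G_continuous]])
    have "(\<integral>u. \<bar>?D u - emean N (\<lambda>v. fk.pullback s n f (proj s v)) u\<bar> \<partial>law N n)
      \<le> (\<integral>u. ((?D u)\<^sup>2 + (?y u)\<^sup>2) / (2 * g) \<partial>law N n)"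
      using i1 i2 pt g by (intro integral_mono_AE') auto
    also have "\<dots> = ((\<integral>u. (?D u)\<^sup>2 \<partial>law N n) + (\<integral>u. (?y u)\<^sup>2 \<partial>law N n)) / (2 * g)"
      using i1 i2 by simp
    also have "\<dots> \<le> (C1 / real N + C2 / real N) / (2 * g)"
      using C1(2)[OF N] C2(2)[OF N] g by (intro divide_right_mono add_mono) auto
    finally show ?thesis by (simp add: add_divide_distrib mult.commute)
  qed
  moreover have "0 \<le> (C1 + C2) / (2 * g)" using C1 C2 g by simp
  ultimately show ?thesis by blast
qed

lemma wemp_deviation_integrable:
  assumes N: "N \<ge> 1" and f: "bounded_continuous f"
  shows "integrable (law N n) (\<lambda>u. \<bar>(\<integral>x. f x \<partial>wemp s N n u) - c\<bar>)"
proof -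
  obtain B where B: "\<And>x. \<bar>f x\<bar> \<le> B" using f bounded_continuous_bound by blast
  have "norm (\<integral>x. f x \<partial>wemp s N n u) \<le> B" for u
    using integral_wemp_bound[OF N B] by simp
  from law_integrable[OF N integral_wemp_measurable[OF N bounded_continuous_measurable[OF f]] this]
  have "integrable (law N n) (\<lambda>u. \<integral>x. f x \<partial>wemp s N n u)" .
  moreover have "integrable (law N n) (\<lambda>u. c)"
    by (rule law_integrable[OF N, of _ _ "\<bar>c\<bar>"]) auto
  ultimately show ?thesis by (intro integrable_abs Bochner_Integration.integrable_diff)
qed

lemma wemp_mean_deviation:
  assumes f: "bounded_continuous f"
  shows "\<exists>C. \<forall>N\<ge>1. (\<integral>u. \<bar>(\<integral>x. f x \<partial>wemp s N n u) - fk.eta_bar s n f\<bar> \<partial>law N n) \<le> C / sqrt (real N)"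
proof -
  obtain B where B: "0 \<le> B" "\<And>x. \<bar>f x\<bar> \<le> B" using f bounded_continuous_bound by blast
  obtain C where C: "\<And>N. N \<ge> 1 \<Longrightarrow>
      (\<integral>u. ((\<integral>x. f x \<partial>wemp s N n u) - fk.eta_bar s n f)\<^sup>2 \<partial>law N n) \<le> C / real N"
    using wemp_mean_square[OF f] by blast
  have "(\<integral>u. \<bar>(\<integral>x. f x \<partial>wemp s N n u) - fk.eta_bar s n f\<bar> \<partial>law N n) \<le> (C + 1) / sqrt (real N)"
    if N: "N \<ge> 1" for N
  proof (rule expectation_abs_le[OF N _ _ C[OF N]])
    show "(\<lambda>u. (\<integral>x. f x \<partial>wemp s N n u) - fk.eta_bar s n f) \<in> borel_measurable (law N n)"
      by (intro borel_measurable_diff integral_wemp_measurable[OF N] bounded_continuous_measurable[OF f]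
          borel_measurable_const)
    show "\<bar>(\<integral>x. f x \<partial>wemp s N n u) - fk.eta_bar s n f\<bar> \<le> 2 * B" for u
      using integral_wemp_bound[of N f B s n u, OF N B(2)] eta_bar_bound[of f B s n, OF B(2,1)]
      by linarith
  qed
  then show ?thesis by blast
qed

text \<open>For joint test functions there is no rate: the coupled step depends on the weighted empirical measures
  through their quantiles, and only the modulus estimate is available. Its right-hand side involves marginal
  test functions, whose deviations vanish in mean.\<close>

lemma step_law_of_large_numbers:
  assumes f: "bounded_continuous f"
  shows "(\<lambda>N. \<integral>u. \<bar>(\<integral>v. f v \<partial>step N n u) - etac (Suc n) f\<bar> \<partial>law N n) \<longlonglongrightarrow> 0"
proof (rule LIMSEQ_I)
  fix e :: real assume e: "0 < e"
  have e2: "0 < e / 2" using e by simp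
  have K: "Mc (Suc n) \<in> borel \<rightarrow>\<^sub>M prob_algebra borel" "feller (Mc (Suc n))"
    by (simp_all add: Mc_kernel Mc_feller)
  obtain g :: "nat \<Rightarrow> real \<Rightarrow> real" and m C where gmC: "(\<forall>j. bounded_continuous (g j)) \<and> 0 \<le> C \<and>
    (\<forall>\<mu>' \<nu>'. real_distribution \<mu>' \<longrightarrow> real_distribution \<nu>' \<longrightarrow>
      \<bar>(\<integral>v. f v \<partial>wasserstein_step (Mc (Suc n)) \<mu>' \<nu>')
        - (\<integral>v. f v \<partial>wasserstein_step (Mc (Suc n)) (eta_bar_law Fine n) (eta_bar_law Coarse n))\<bar>
      \<le> e / 2 + C * (\<Sum>j<m. \<bar>(\<integral>x. g j x \<partial>\<mu>') - (\<integral>x. g j x \<partial>eta_bar_law Fine n)\<bar>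
          + \<bar>(\<integral>x. g j x \<partial>\<nu>') - (\<integral>x. g j x \<partial>eta_bar_law Coarse n)\<bar>))"
    using wasserstein_step_modulus[OF K fk.eta_bar_real_distribution[of Fine n] fk.eta_bar_real_distribution[of Coarse n]
        F_continuous F_continuous F_inv_continuous F_inv_continuous f e2]
    by (elim exE) (rule that)
  have g: "bounded_continuous (g j)" for j using gmC by (elim conjE allE)
  have C: "0 \<le> C" using gmC by (elim conjE)
  let ?d = "\<lambda>s j N u. \<bar>(\<integral>x. g j x \<partial>wemp s N n u) - fk.eta_bar s n (g j)\<bar>"
  have mod: "\<bar>(\<integral>v. f v \<partial>step N n u) - etac (Suc n) f\<bar> \<le> e / 2 + C * (\<Sum>j<m. ?d Fine j N u + ?d Coarse j N u)"
    if N: "N \<ge> 1" for N u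
    using gmC[THEN conjunct2, THEN conjunct2, rule_format, OF wemp_real_distribution[OF N] wemp_real_distribution[OF N],
        of Fine n u Coarse n u]
    unfolding step_def etac_def fk.eta_bar_def eta_check.simps .
  define D where "D s j = (SOME C. \<forall>N\<ge>1. (\<integral>u. ?d s j N u \<partial>law N n) \<le> C / sqrt (real N))" for s j
  have D: "(\<integral>u. ?d s j N u \<partial>law N n) \<le> D s j / sqrt (real N)" if "N \<ge> 1" for s j N
    using someI_ex[OF wemp_mean_deviation[OF g[of j], of n s]] that unfolding D_def by simp
  define E where "E = C * (\<Sum>j<m. D Fine j + D Coarse j)"
  have bound: "(\<integral>u. \<bar>(\<integral>v. f v \<partial>step N n u) - etac (Suc n) f\<bar> \<partial>law N n) \<le> e / 2 + E / sqrt (real N)"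
    if N: "N \<ge> 1" for N
  proof -
    interpret L: prob_space "law N n" by (rule law_prob[OF N])
    have d_int: "integrable (law N n) (?d s j N)" for s j
      by (rule wemp_deviation_integrable[OF N g])
    have sum_int: "integrable (law N n) (\<lambda>u. \<Sum>j<m. ?d Fine j N u + ?d Coarse j N u)"
      by (intro Bochner_Integration.integrable_sum Bochner_Integration.integrable_add d_int)
    have bound_int: "integrable (law N n) (\<lambda>u. e / 2 + C * (\<Sum>j<m. ?d Fine j N u + ?d Coarse j N u))"
      by (intro Bochner_Integration.integrable_add integrable_mult_right L.integrable_const sum_int)
    have "(\<integral>u. \<bar>(\<integral>v. f v \<partial>step N n u) - etac (Suc n) f\<bar> \<partial>law N n)
      \<le> (\<integral>u. e / 2 + C * (\<Sum>j<m. ?d Fine j N u + ?d Coarse j N u) \<partial>law N n)"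
    proof (rule integral_mono_AE'[OF bound_int])
      show "AE u in law N n. \<bar>(\<integral>v. f v \<partial>step N n u) - etac (Suc n) f\<bar>
          \<le> e / 2 + C * (\<Sum>j<m. ?d Fine j N u + ?d Coarse j N u)"
        by (rule AE_I2) (rule mod[OF N])
      show "AE u in law N n. 0 \<le> e / 2 + C * (\<Sum>j<m. ?d Fine j N u + ?d Coarse j N u)"
        by (rule AE_I2) (intro add_nonneg_nonneg mult_nonneg_nonneg sum_nonneg C abs_ge_zero less_imp_le[OF e2])
    qed
    also have "\<dots> = e / 2 + C * (\<Sum>j<m. (\<integral>u. ?d Fine j N u \<partial>law N n) + (\<integral>u. ?d Coarse j N u \<partial>law N n))"
      by (simp only: Bochner_Integration.integral_add[OF L.integrable_const integrable_mult_right[OF sum_int]]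
          Bochner_Integration.integral_sum[OF Bochner_Integration.integrable_add[OF d_int d_int]]
          Bochner_Integration.integral_add[OF d_int d_int] integral_mult_right_zero
          lebesgue_integral_const L.prob_space scaleR_one)
    also have "\<dots> \<le> e / 2 + C * (\<Sum>j<m. D Fine j / sqrt (real N) + D Coarse j / sqrt (real N))"
      by (intro add_left_mono mult_left_mono sum_mono add_mono D N C)
    also have "\<dots> = e / 2 + E / sqrt (real N)"
      by (simp add: E_def add_divide_distrib[symmetric] sum_divide_distrib[symmetric])
    finally show ?thesis .
  qed
  have "\<forall>\<^sub>F N in sequentially. E / sqrt (real N) < e / 2"
    by (rule order_tendstoD(2)[OF over_sqrt_tendsto_0 e2])
  then have "\<forall>\<^sub>F N in sequentially. norm ((\<integral>u. \<bar>(\<integral>v. f v \<partial>step N n u) - etac (Suc n) f\<bar> \<partial>law N n) - 0) < e"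
    using eventually_ge_at_top[of 1]
  proof eventually_elim
    case (elim N)
    have "0 \<le> (\<integral>u. \<bar>(\<integral>v. f v \<partial>step N n u) - etac (Suc n) f\<bar> \<partial>law N n)" by simp
    moreover have "(\<integral>u. \<bar>(\<integral>v. f v \<partial>step N n u) - etac (Suc n) f\<bar> \<partial>law N n) < e"
      using bound[OF elim(2)] elim(1) by linarith
    ultimately show ?case by simp
  qed
  then show "\<exists>N0. \<forall>N\<ge>N0. norm ((\<integral>u. \<bar>(\<integral>v. f v \<partial>step N n u) - etac (Suc n) f\<bar> \<partial>law N n) - 0) < e"
    by (simp only: eventually_sequentially)
qed

end

section \<open>The central limit theorem\<close>

lemma norm_product_diff_le:
  fixes A B J c w :: complex
  assumes "norm A = 1" "norm c \<le> 1"
  shows "norm (A * J - c * B) \<le> norm (J - w) + norm (w - c) + norm (A - B)"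
proof -
  have "A * J - c * B = A * (J - w) + A * (w - c) + c * (A - B)" by (simp add: algebra_simps)
  also have "norm \<dots> \<le> norm (A * (J - w)) + norm (A * (w - c)) + norm (c * (A - B))"
    by (intro norm_triangle_le add_right_mono norm_triangle_ineq)
  also have "\<dots> \<le> norm (J - w) + norm (w - c) + norm (A - B)"
    using assms mult_right_mono[of "norm c" 1 "norm (A - B)"] by (simp add: norm_mult)
  finally show ?thesis .
qed

context coupled_particle_filter
begin

definition fluctuation_char :: "nat \<Rightarrow> (real \<Rightarrow> real) \<Rightarrow> (real \<Rightarrow> real) \<Rightarrow> real \<Rightarrow> nat \<Rightarrow> complex" where
  "fluctuation_char n \<phi> \<psi> t N
    = (\<integral>u. iexp (t * (sqrt (real N) * (emean N (contrast \<phi> \<psi>) u - etac n (contrast \<phi> \<psi>)))) \<partial>law N n)"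

lemma fluctuation_char_0:
  assumes \<phi>: "bounded_continuous \<phi>" and \<psi>: "bounded_continuous \<psi>"
  shows "fluctuation_char 0 \<phi> \<psi> t
    \<longlonglongrightarrow> of_real (exp (- (t\<^sup>2 * asymptotic_variance G \<eta>0 M \<eta>c0 Mc 0 \<phi> \<psi> / 2)))"
proof -
  interpret prob_space \<eta>c0 using coupling0 by (simp add: space_prob_algebra)
  note h = contrast_bounded_continuous[OF \<phi> \<psi>]
  obtain B where B: "\<And>x. \<bar>contrast \<phi> \<psi> x\<bar> \<le> B" using h bounded_continuous_bound by blast
  have hm: "contrast \<phi> \<psi> \<in> borel_measurable \<eta>c0"
    using coupling0(1) bounded_continuous_measurable[OF h]
    by (simp add: space_prob_algebra cong: measurable_cong_sets)
  have "norm (fluctuation_char 0 \<phi> \<psi> t N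
      - of_real (exp (- (t\<^sup>2 * asymptotic_variance G \<eta>0 M \<eta>c0 Mc 0 \<phi> \<psi> / 2))))
    \<le> (2 * \<bar>t\<bar>^3 * B^3 + 2 * t^4 * B^4) / sqrt (real N)" if "N \<ge> 1" for N
    using char_emean_iid[OF hm B that, of t]
    by (simp add: fluctuation_char_def asymptotic_variance_0[OF \<phi> \<psi>] etac_def)
  then have "\<forall>\<^sub>F N in sequentially. norm (fluctuation_char 0 \<phi> \<psi> t N
      - of_real (exp (- (t\<^sup>2 * asymptotic_variance G \<eta>0 M \<eta>c0 Mc 0 \<phi> \<psi> / 2))))
    \<le> (2 * \<bar>t\<bar>^3 * B^3 + 2 * t^4 * B^4) / sqrt (real N)"
    using eventually_ge_at_top[of 1] by (rule eventually_mono[rotated])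
  from Lim_null_comparison[OF this over_sqrt_tendsto_0] show ?thesis by (rule LIM_zero_cancel)
qed

lemma step_mean_linearized:
  assumes \<phi>: "bounded_continuous \<phi>" and \<psi>: "bounded_continuous \<psi>" and N: "N \<ge> 1"
  shows "(\<integral>v. contrast \<phi> \<psi> v \<partial>step N n u) - etac (Suc n) (contrast \<phi> \<psi>)
      - emean N (contrast (pull Fine n \<phi>) (pull Coarse n \<psi>)) u
    = ((\<integral>x. kernel_op (M Fine (Suc n)) \<phi> x \<partial>wemp Fine N n u) - fk.eta_bar Fine n (kernel_op (M Fine (Suc n)) \<phi>)
        - emean N (\<lambda>v. pull Fine n \<phi> (proj Fine v)) u)
      - ((\<integral>x. kernel_op (M Coarse (Suc n)) \<psi> x \<partial>wemp Coarse N n u) - fk.eta_bar Coarse n (kernel_op (M Coarse (Suc n)) \<psi>)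
        - emean N (\<lambda>v. pull Coarse n \<psi> (proj Coarse v)) u)"
proof -
  interpret S: prob_space "step N n u" by (rule step_prob[OF N])
  have int: "integrable (step N n u) (\<lambda>v. f (proj s v))" if "bounded_continuous f" for s f
  proof -
    obtain B where "\<And>x. \<bar>f x\<bar> \<le> B" using bounded_continuous_bound \<open>bounded_continuous f\<close> by blast
    then show ?thesis
      using bounded_continuous_measurable[OF bounded_continuous_proj[OF that, of s]] step_prob(2)[OF N]
      by (intro S.integrable_bounded[of _ B]) (auto cong: measurable_cong_sets)
  qed
  have "(\<integral>v. contrast \<phi> \<psi> v \<partial>step N n u)
    = (\<integral>v. \<phi> (proj Fine v) \<partial>step N n u) - (\<integral>v. \<psi> (proj Coarse v) \<partial>step N n u)"
    unfolding contrast_def using int[OF \<phi>, of Fine] int[OF \<psi>, of Coarse] by (rule Bochner_Integration.integral_diff)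
  then show ?thesis
    unfolding step_proj[OF N \<phi>] step_proj[OF N \<psi>] etac_contrast[OF \<phi> \<psi>] fk.eta_Suc[OF \<phi>] fk.eta_Suc[OF \<psi>]
    by (simp add: contrast_def[abs_def] emean_diff del: proj.simps)
qed

text \<open>One induction step. Conditionally on the particles at time \<open>n\<close>, the characteristic function at time
  \<open>n + 1\<close> is \<open>exp (i a) J\<close>, where \<open>a\<close> comes from the conditional mean and \<open>J\<close> from the sampling error. Three
  replacements are made inside the expectation: \<open>J\<close> by the Gaussian factor with the conditional variance
  (uniform rate), the conditional variance by its limit \<open>V\<close> (law of large numbers), and \<open>a\<close> by the linearised
  fluctuation at time \<open>n\<close> (linearisation error).\<close>

lemma fluctuation_char_Suc:
  fixes n :: nat
  assumes \<phi>: "bounded_continuous \<phi>" and \<psi>: "bounded_continuous \<psi>"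
  defines "V \<equiv> etac (Suc n) (\<lambda>v. (contrast \<phi> \<psi> v - etac (Suc n) (contrast \<phi> \<psi>))\<^sup>2)"
  shows "(\<lambda>N. fluctuation_char (Suc n) \<phi> \<psi> t N
      - of_real (exp (- (t\<^sup>2 * V / 2))) * fluctuation_char n (pull Fine n \<phi>) (pull Coarse n \<psi>) t N) \<longlonglongrightarrow> 0"
proof -
  define h where "h = contrast \<phi> \<psi>"
  define h' where "h' = contrast (pull Fine n \<phi>) (pull Coarse n \<psi>)"
  define m where "m = etac (Suc n) h"
  define c where "c = complex_of_real (exp (- (t\<^sup>2 * V / 2)))"
  have h: "bounded_continuous h" unfolding h_def by (rule contrast_bounded_continuous[OF \<phi> \<psi>])
  have h': "bounded_continuous h'"
    unfolding h'_def by (intro contrast_bounded_continuous pull_bounded_continuous \<phi> \<psi>)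
  have h2: "bounded_continuous (\<lambda>v. (h v)\<^sup>2)"
    unfolding power2_eq_square by (rule bounded_continuous_mult[OF h h])
  have h'0: "etac n h' = 0"
    unfolding h'_def using \<phi> \<psi>
    by (simp add: etac_contrast pull_bounded_continuous fk.eta_pullback fk.kernel_op_bounded_continuous)
  obtain B where B: "0 \<le> B" "\<And>x. \<bar>h x\<bar> \<le> B" using h bounded_continuous_bound by blast
  have V: "V = etac (Suc n) (\<lambda>v. (h v)\<^sup>2) - m\<^sup>2" and mB: "\<bar>m\<bar> \<le> B"
  proof -
    interpret prob_space "eta_check G \<eta>0 M \<eta>c0 Mc (Suc n)"
      using eta_check_prob[of "Suc n"] by (simp add: space_prob_algebra)
    show "V = etac (Suc n) (\<lambda>v. (h v)\<^sup>2) - m\<^sup>2"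
      unfolding V_def h_def[symmetric] m_def unfolding etac_def
      by (rule variance_eq[OF integrable_eta_check[OF h] integrable_eta_check[OF h2]])
    show "\<bar>m\<bar> \<le> B" unfolding m_def etac_def using norm_integral_bounded[of h B] B by auto
  qed
  have V0: "0 \<le> V" unfolding V_def etac_def by simp
  have c1: "norm c \<le> 1" unfolding c_def using V0 by simp
  define C where "C = 2 * \<bar>t\<bar>^3 * B^3 + 2 * t^4 * B^4"
  let ?K = "\<lambda>s f. kernel_op (M s (Suc n)) f"
  let ?R = "\<lambda>s f N u. \<bar>(\<integral>x. ?K s f x \<partial>wemp s N n u) - fk.eta_bar s n (?K s f) - emean N (\<lambda>v. pull s n f (proj s v)) u\<bar>"
  let ?S = "\<lambda>f N u. \<bar>(\<integral>v. f v \<partial>step N n u) - etac (Suc n) f\<bar>"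
  have "\<forall>s f. bounded_continuous f \<longrightarrow> (\<exists>C\<ge>0. \<forall>N\<ge>1. (\<integral>u. ?R s f N u \<partial>law N n) \<le> C / real N)"
    using linearization_error[OF fk.kernel_op_bounded_continuous] by blast
  then obtain CF CC where CF: "\<And>N. N \<ge> 1 \<Longrightarrow> (\<integral>u. ?R Fine \<phi> N u \<partial>law N n) \<le> CF / real N"
    and CC: "\<And>N. N \<ge> 1 \<Longrightarrow> (\<integral>u. ?R Coarse \<psi> N u \<partial>law N n) \<le> CC / real N"
    using \<phi> \<psi> by meson
  (* one summand for each of the three replacements *)
  define bound where "bound N = C / sqrt (real N)
    + t\<^sup>2 / 2 * ((\<integral>u. ?S (\<lambda>v. (h v)\<^sup>2) N u \<partial>law N n) + 2 * B * (\<integral>u. ?S h N u \<partial>law N n))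
    + \<bar>t\<bar> * ((CF + CC) / sqrt (real N))" for N
  have main: "norm (fluctuation_char (Suc n) \<phi> \<psi> t N - c * fluctuation_char n (pull Fine n \<phi>) (pull Coarse n \<psi>) t N) \<le> bound N"
    if N: "N \<ge> 1" for N
  proof -
    interpret L: prob_space "law N n" by (rule law_prob[OF N])
    define F where "F u = (\<integral>v. iexp (t * (sqrt (real N) * (emean N h v - m))) \<partial>(\<Pi>\<^sub>M i\<in>{1..N}. step N n u))" for u
    define b where "b u = t * (sqrt (real N) * emean N h' u)" for u
    have em[measurable]: "emean N h \<in> borel_measurable (config_space N)" "emean N h' \<in> borel_measurable (config_space N)"
      by (rule emean_config[OF N h] emean_config[OF N h'])+
    have Fin: "(\<lambda>v. iexp (t * (sqrt (real N) * (emean N h v - m)))) \<in> borel_measurable (config_space N)"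
      by measurable
    have F_meas: "F \<in> borel_measurable (law N n)"
      unfolding F_def by (rule law_Suc_inner_measurable[OF N Fin])
    have b_meas: "(\<lambda>u. iexp (b u)) \<in> borel_measurable (law N n)"
      unfolding law_measurable[OF N] b_def by measurable
    have charS: "fluctuation_char (Suc n) \<phi> \<psi> t N = (\<integral>u. F u \<partial>law N n)"
      unfolding fluctuation_char_def F_def h_def[symmetric] m_def[symmetric]
      by (rule law_Suc_integral_complex[OF N Fin, of 1]) auto
    have charn: "fluctuation_char n (pull Fine n \<phi>) (pull Coarse n \<psi>) t N = (\<integral>u. iexp (b u) \<partial>law N n)"
      unfolding fluctuation_char_def h'_def[symmetric] h'0 b_def by simp
    have pt: "norm (F u - c * iexp (b u)) \<le> C / sqrt (real N)
        + t\<^sup>2 / 2 * (?S (\<lambda>v. (h v)\<^sup>2) N u + 2 * B * ?S h N u)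
        + (\<bar>t\<bar> * sqrt (real N)) * (?R Fine \<phi> N u + ?R Coarse \<psi> N u)" and F1: "norm (F u) \<le> 1" for u
    proof -
      interpret S: prob_space "step N n u" by (rule step_prob[OF N])
      interpret P: prob_space "\<Pi>\<^sub>M i\<in>{1..N}. step N n u" by (rule prob_space_PiM) (rule S.prob_space_axioms)
      show "norm (F u) \<le> 1" unfolding F_def by (rule P.norm_integral_bounded) auto
      have hS: "h \<in> borel_measurable (step N n u)"
        using bounded_continuous_measurable[OF h] step_prob(2)[OF N] by (simp cong: measurable_cong_sets)
      define \<mu> where "\<mu> = S.expectation h"
      define v where "v = S.variance h"
      define J where "J = (\<integral>v. iexp (t * (sqrt (real N) * (emean N h v - \<mu>))) \<partial>(\<Pi>\<^sub>M i\<in>{1..N}. step N n u))"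
      define a where "a = t * (sqrt (real N) * (\<mu> - m))"
      (* splitting off the conditional mean, which is constant for the inner integral *)
      have "iexp (t * (sqrt (real N) * (emean N h w - m))) = iexp a * iexp (t * (sqrt (real N) * (emean N h w - \<mu>)))" for w
        by (simp add: a_def exp_add[symmetric] algebra_simps)
      then have F: "F u = iexp a * J" unfolding F_def J_def by simp
      have \<mu>B: "\<bar>\<mu>\<bar> \<le> B" unfolding \<mu>_def by (rule integral_step_bound[OF N B(2)])
      have "integrable (step N n u) h" using hS B by (intro S.integrable_bounded[of _ B]) auto
      moreover have "integrable (step N n u) (\<lambda>v. (h v)\<^sup>2)"
        using hS power_mono[OF B(2) abs_ge_zero, of _ 2] by (intro S.integrable_bounded[of _ "B\<^sup>2"]) auto
      ultimately have v: "v = S.expectation (\<lambda>v. (h v)\<^sup>2) - \<mu>\<^sup>2" unfolding v_def \<mu>_def by (rule S.variance_eq)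
      have v0: "0 \<le> v" unfolding v_def by simp
      have "\<bar>\<mu>\<^sup>2 - m\<^sup>2\<bar> = \<bar>\<mu> + m\<bar> * \<bar>\<mu> - m\<bar>" by (simp add: power2_eq_square abs_mult[symmetric] algebra_simps)
      also have "\<dots> \<le> (2 * B) * \<bar>\<mu> - m\<bar>" using \<mu>B mB by (intro mult_right_mono) auto
      finally have vV: "\<bar>v - V\<bar> \<le> ?S (\<lambda>v. (h v)\<^sup>2) N u + 2 * B * ?S h N u"
        unfolding v V \<mu>_def m_def by linarith
      have J: "norm (J - of_real (exp (- (t\<^sup>2 * v / 2)))) \<le> C / sqrt (real N)"
        unfolding J_def v_def C_def \<mu>_def by (rule S.char_emean_iid[OF hS B(2) N])
      have "norm (complex_of_real (exp (- (t\<^sup>2 * v / 2))) - c) = \<bar>exp (- (t\<^sup>2 * v / 2)) - exp (- (t\<^sup>2 * V / 2))\<bar>"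
        unfolding c_def by (metis norm_of_real of_real_diff)
      also have "\<dots> \<le> \<bar>t\<^sup>2 * v / 2 - t\<^sup>2 * V / 2\<bar>" using v0 V0 by (intro exp_minus_lipschitz) auto
      also have "\<dots> = t\<^sup>2 / 2 * \<bar>v - V\<bar>"
        by (simp add: abs_mult right_diff_distrib[symmetric] diff_divide_distrib[symmetric])
      also have "\<dots> \<le> t\<^sup>2 / 2 * (?S (\<lambda>v. (h v)\<^sup>2) N u + 2 * B * ?S h N u)" using vV by (intro mult_left_mono) auto
      finally have w: "norm (complex_of_real (exp (- (t\<^sup>2 * v / 2))) - c)
          \<le> t\<^sup>2 / 2 * (?S (\<lambda>v. (h v)\<^sup>2) N u + 2 * B * ?S h N u)" .
      have "norm (iexp a - iexp (b u)) \<le> \<bar>a - b u\<bar>" by (rule iexp_lipschitz)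
      also have "a - b u = (t * sqrt (real N)) * (\<mu> - m - emean N h' u)"
        by (simp add: a_def b_def algebra_simps)
      also have "\<bar>\<dots>\<bar> = (\<bar>t\<bar> * sqrt (real N)) * \<bar>\<mu> - m - emean N h' u\<bar>"
        by (simp add: abs_mult)
      also have "\<dots> \<le> (\<bar>t\<bar> * sqrt (real N)) * (?R Fine \<phi> N u + ?R Coarse \<psi> N u)"
        unfolding \<mu>_def m_def h_def h'_def step_mean_linearized[OF \<phi> \<psi> N]
        by (intro mult_left_mono abs_triangle_ineq4) auto
      finally have ab: "norm (iexp a - iexp (b u)) \<le> (\<bar>t\<bar> * sqrt (real N)) * (?R Fine \<phi> N u + ?R Coarse \<psi> N u)" .
      show "norm (F u - c * iexp (b u)) \<le> C / sqrt (real N)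
        + t\<^sup>2 / 2 * (?S (\<lambda>v. (h v)\<^sup>2) N u + 2 * B * ?S h N u)
        + (\<bar>t\<bar> * sqrt (real N)) * (?R Fine \<phi> N u + ?R Coarse \<psi> N u)"
        unfolding F
        using norm_product_diff_le[of "iexp a" c J "iexp (b u)" "of_real (exp (- (t\<^sup>2 * v / 2)))"] c1 J w ab
        by simp
    qed
    have intF: "integrable (law N n) F" by (rule law_integrable[OF N F_meas F1])
    have intb: "integrable (law N n) (\<lambda>u. iexp (b u))" by (rule law_integrable[OF N b_meas, of 1]) simp
    have int_S: "integrable (law N n) (?S f N)" if f: "bounded_continuous f" for f
    proof -
      obtain B where B: "\<And>x. \<bar>f x\<bar> \<le> B" using f bounded_continuous_bound by blast
      have "integrable (law N n) (\<lambda>u. \<integral>v. f v \<partial>step N n u)"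
        using integral_step_bound[OF N B]
        by (intro law_integrable[OF N integral_step_measurable[OF N bounded_continuous_measurable[OF f]], where B = B]) auto
      then show ?thesis by simp
    qed
    have int_R: "integrable (law N n) (?R s f N)" if f: "bounded_continuous f" for s f
    proof -
      note Kf = fk.kernel_op_bounded_continuous[OF f, of s n]
      note pf = bounded_continuous_proj[OF pull_bounded_continuous[OF f, of s n], of s]
      obtain B where B: "\<And>x. \<bar>?K s f x\<bar> \<le> B" using Kf bounded_continuous_bound by blast
      obtain B' where B': "0 \<le> B'" "\<And>v. \<bar>pull s n f (proj s v)\<bar> \<le> B'" using pf bounded_continuous_bound by blast
      have "integrable (law N n) (\<lambda>u. \<integral>x. ?K s f x \<partial>wemp s N n u)"
        using integral_wemp_bound[OF N B]
        by (intro law_integrable[OF N integral_wemp_measurable[OF N bounded_continuous_measurable[OF Kf]], where B = B]) auto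
      moreover have "integrable (law N n) (\<lambda>u. emean N (\<lambda>v. pull s n f (proj s v)) u)"
        using emean_config[OF N pf] emean_bound[of "\<lambda>v. pull s n f (proj s v)" B', OF B'(2,1)]
        by (intro law_integrable[OF N, of _ _ B']) (auto simp: law_measurable[OF N])
      ultimately show ?thesis by simp
    qed
    define RF where "RF = ?R Fine \<phi> N"
    define RC where "RC = ?R Coarse \<psi> N"
    define S1 where "S1 = ?S h N"
    define S2 where "S2 = ?S (\<lambda>v. (h v)\<^sup>2) N"
    define k where "k = \<bar>t\<bar> * sqrt (real N)"
    have int: "integrable (law N n) RF" "integrable (law N n) RC"
      "integrable (law N n) S1" "integrable (law N n) S2"
      unfolding RF_def RC_def S1_def S2_def by (rule int_R[OF \<phi>] int_R[OF \<psi>] int_S[OF h] int_S[OF h2])+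
    have k0: "0 \<le> k" by (simp add: k_def)
    have pt': "norm (F u - c * iexp (b u))
      \<le> C / sqrt (real N) + t\<^sup>2 / 2 * (S2 u + 2 * B * S1 u) + k * (RF u + RC u)" for u
      unfolding RF_def RC_def S1_def S2_def k_def by (rule pt)
    have "fluctuation_char (Suc n) \<phi> \<psi> t N - c * fluctuation_char n (pull Fine n \<phi>) (pull Coarse n \<psi>) t N
        = (\<integral>u. F u - c * iexp (b u) \<partial>law N n)"
      unfolding charS charn using intF integrable_mult_right[OF intb, of c]
      by (simp only: Bochner_Integration.integral_diff integral_mult_right_zero)
    also have "norm \<dots> \<le> (\<integral>u. norm (F u - c * iexp (b u)) \<partial>law N n)"
      by (rule integral_norm_bound)
    also have "\<dots> \<le> (\<integral>u. C / sqrt (real N) + t\<^sup>2 / 2 * (S2 u + 2 * B * S1 u) + k * (RF u + RC u) \<partial>law N n)"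
    proof (rule integral_mono[OF _ _ pt'])
      show "integrable (law N n) (\<lambda>u. norm (F u - c * iexp (b u)))"
        by (rule integrable_norm[OF Bochner_Integration.integrable_diff[OF intF integrable_mult_right[OF intb]]])
      show "integrable (law N n) (\<lambda>u. C / sqrt (real N) + t\<^sup>2 / 2 * (S2 u + 2 * B * S1 u) + k * (RF u + RC u))"
        using int by simp
    qed
    also have "\<dots> = C / sqrt (real N)
      + t\<^sup>2 / 2 * ((\<integral>u. S2 u \<partial>law N n) + 2 * B * (\<integral>u. S1 u \<partial>law N n))
      + k * ((\<integral>u. RF u \<partial>law N n) + (\<integral>u. RC u \<partial>law N n))"
      using int by (simp add: L.prob_space)
    also have "\<dots> \<le> C / sqrt (real N)
      + t\<^sup>2 / 2 * ((\<integral>u. S2 u \<partial>law N n) + 2 * B * (\<integral>u. S1 u \<partial>law N n))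
      + k * (CF / real N + CC / real N)"
      using CF[OF N, folded RF_def] CC[OF N, folded RC_def] k0
      by (intro add_left_mono mult_left_mono add_mono)
    also have "k * (CF / real N + CC / real N) = \<bar>t\<bar> * ((CF + CC) * (sqrt (real N) / real N))"
      by (simp add: k_def add_divide_distrib[symmetric])
    also have "sqrt (real N) / real N = 1 / sqrt (real N)"
      using N by (simp add: field_simps)
    finally show ?thesis unfolding S1_def S2_def bound_def by simp
  qed
  have "bound \<longlonglongrightarrow> 0 + t\<^sup>2 / 2 * (0 + 2 * B * 0) + \<bar>t\<bar> * 0"
    unfolding bound_def
    by (intro tendsto_add tendsto_mult tendsto_const over_sqrt_tendsto_0 step_law_of_large_numbers h h2)
  then have lim: "bound \<longlonglongrightarrow> 0" by simp
  have "\<forall>\<^sub>F N in sequentially. norm (fluctuation_char (Suc n) \<phi> \<psi> t N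
      - c * fluctuation_char n (pull Fine n \<phi>) (pull Coarse n \<psi>) t N) \<le> bound N"
    using eventually_ge_at_top[of 1] by (rule eventually_mono) (rule main)
  from Lim_null_comparison[OF this lim] show ?thesis unfolding c_def .
qed

lemma fluctuation_char_tendsto:
  "bounded_continuous \<phi> \<Longrightarrow> bounded_continuous \<psi> \<Longrightarrow> fluctuation_char n \<phi> \<psi> t
    \<longlonglongrightarrow> of_real (exp (- (t\<^sup>2 * asymptotic_variance G \<eta>0 M \<eta>c0 Mc n \<phi> \<psi> / 2)))"
proof (induction n arbitrary: \<phi> \<psi>)
  case (Suc n)
  let ?V = "etac (Suc n) (\<lambda>v. (contrast \<phi> \<psi> v - etac (Suc n) (contrast \<phi> \<psi>))\<^sup>2)"
  let ?c = "complex_of_real (exp (- (t\<^sup>2 * ?V / 2)))"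
  let ?W = "asymptotic_variance G \<eta>0 M \<eta>c0 Mc n (pull Fine n \<phi>) (pull Coarse n \<psi>)"
  have "(\<lambda>N. (fluctuation_char (Suc n) \<phi> \<psi> t N - ?c * fluctuation_char n (pull Fine n \<phi>) (pull Coarse n \<psi>) t N)
      + ?c * fluctuation_char n (pull Fine n \<phi>) (pull Coarse n \<psi>) t N) \<longlonglongrightarrow> 0 + ?c * of_real (exp (- (t\<^sup>2 * ?W / 2)))"
    by (intro tendsto_add tendsto_mult tendsto_const fluctuation_char_Suc Suc.prems Suc.IH pull_bounded_continuous)
  moreover have "?c * of_real (exp (- (t\<^sup>2 * ?W / 2)))
      = of_real (exp (- (t\<^sup>2 * asymptotic_variance G \<eta>0 M \<eta>c0 Mc (Suc n) \<phi> \<psi> / 2)))"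
    unfolding asymptotic_variance_Suc[OF Suc.prems] of_real_mult[symmetric] exp_add[symmetric]
    by (simp add: algebra_simps add_divide_distrib)
  ultimately show ?case by simp
qed (rule fluctuation_char_0)

end

lemma real_distribution_centred_gaussian:
  assumes "0 \<le> v" shows "real_distribution (centred_gaussian v)"
  using assms prob_space_normal_density[of "sqrt v" 0]
  by (auto simp: centred_gaussian_def real_distribution_def real_distribution_axioms_def prob_space_return)

text \<open>For positive variance the law is the image of the standard normal law under scaling.\<close>

lemma char_centred_gaussian:
  assumes "0 \<le> v" shows "char (centred_gaussian v) t = of_real (exp (- (t\<^sup>2 * v / 2)))"
proof (cases "v = 0")
  case True
  then show ?thesis by (simp add: centred_gaussian_def char_def integral_return)
next
  case False
  define \<sigma> where "\<sigma> = sqrt v"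
  have \<sigma>: "0 < \<sigma>" "\<sigma>\<^sup>2 = v" using False assms by (simp_all add: \<sigma>_def)
  interpret std: prob_space std_normal_distribution by (rule prob_space_normal_density) simp
  have "distributed std_normal_distribution lborel (\<lambda>x. x) std_normal_density"
    by (simp add: distributed_def distr_id2)
  from std.normal_density_affine[OF this, of \<sigma> 0] \<sigma>
  have "distr std_normal_distribution lborel (\<lambda>x. \<sigma> * x) = density lborel (normal_density 0 \<sigma>)"
    by (simp add: distributed_def)
  then have "char (centred_gaussian v) t = (CLINT x|distr std_normal_distribution lborel (\<lambda>x. \<sigma> * x). iexp (t * x))"
    using False by (simp add: centred_gaussian_def char_def \<sigma>_def)
  also have "\<dots> = (CLINT x|std_normal_distribution. iexp (t * (\<sigma> * x)))"
    by (rule integral_distr) auto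
  also have "\<dots> = char std_normal_distribution (t * \<sigma>)" by (simp add: char_def mult.assoc)
  also have "\<dots> = of_real (exp (- (t\<^sup>2 * v / 2)))"
    by (simp add: char_std_normal_distribution power_mult_distrib \<sigma>(2)[symmetric] exp_of_real[symmetric])
  finally show ?thesis .
qed

theorem theorem3p1:
  fixes G :: "nat \<Rightarrow> real \<Rightarrow> real"
    and \<eta>0 :: "level \<Rightarrow> real measure"
    and M :: "level \<Rightarrow> nat \<Rightarrow> real \<Rightarrow> real measure"
    and \<eta>c0 :: "(real \<times> real) measure"
    and Mc :: "nat \<Rightarrow> real \<times> real \<Rightarrow> (real \<times> real) measure"
    and \<Omega> :: "nat \<Rightarrow> '\<omega> measure"
    and u :: "nat \<Rightarrow> nat \<Rightarrow> nat \<Rightarrow> '\<omega> \<Rightarrow> real \<times> real"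
    and n :: nat
    and \<phi> \<psi> :: "real \<Rightarrow> real"
  assumes G_pos: "\<And>k x. G k x > 0"
    and eta0: "\<And>s. \<eta>0 s \<in> space (prob_algebra borel)"
    and M_kernel: "\<And>s k. k \<ge> 1 \<Longrightarrow> M s k \<in> borel \<rightarrow>\<^sub>M prob_algebra borel"
    and F_continuous: "\<And>s k. continuous_on UNIV (cdf (fk_eta_bar G (\<eta>0 s) (M s) k))"
    and F_inv_continuous: "\<And>s k. continuous_on {0<..<1} (quantile (fk_eta_bar G (\<eta>0 s) (M s) k))"
    and coupling0: "\<eta>c0 \<in> space (prob_algebra borel)"
      "distr \<eta>c0 borel fst = \<eta>0 Fine" "distr \<eta>c0 borel snd = \<eta>0 Coarse"
    and Mc_kernel: "\<And>k. k \<ge> 1 \<Longrightarrow> Mc k \<in> borel \<rightarrow>\<^sub>M prob_algebra borel"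
    and Mc_coupling:
      "\<And>k A x x'. k \<ge> 1 \<Longrightarrow> A \<in> sets borel \<Longrightarrow>
         emeasure (Mc k (x, x')) (A \<times> UNIV) = emeasure (M Fine k x) A"
      "\<And>k A x x'. k \<ge> 1 \<Longrightarrow> A \<in> sets borel \<Longrightarrow>
         emeasure (Mc k (x, x')) (UNIV \<times> A) = emeasure (M Coarse k x') A"
    and particles: "\<And>N. N \<ge> 1 \<Longrightarrow> particle_system G \<eta>c0 Mc N n (\<Omega> N) (u N)"
    and Mc_feller: "\<And>k. k \<ge> 1 \<Longrightarrow> feller (Mc k)"
    and M_feller: "\<And>s k. k \<ge> 1 \<Longrightarrow> feller (M s k)"
    and G_continuous: "\<And>k. bounded_continuous (G k)"
    and phi_psi: "bounded_continuous \<phi>" "bounded_continuous \<psi>"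
  defines "h \<equiv> \<lambda>v. tensor \<phi> (\<lambda>_. 1) v - tensor (\<lambda>_. 1) \<psi> v"
  shows "weak_conv_m
    (\<lambda>N. distr (\<Omega> N) borel (\<lambda>\<omega>. sqrt (real N) *
       ((\<integral>v. h v \<partial>empirical N (\<lambda>i. u N n i \<omega>)) - (\<integral>v. h v \<partial>eta_check G \<eta>0 M \<eta>c0 Mc n))))
    (centred_gaussian (asymptotic_variance G \<eta>0 M \<eta>c0 Mc n \<phi> \<psi>))"
proof -
  (* the coupling hypotheses on rectangles, rewritten as image measures *)
  interpret coupled_particle_filter G \<eta>0 M \<eta>c0 Mc
  proof (rule coupled_particle_filter.intro)
    fix s
    show "feynman_kac G (\<eta>0 s) (M s)"
      by standard (rule G_pos G_continuous eta0 M_kernel M_feller, assumption?)+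
    show "distr \<eta>c0 borel (proj s) = \<eta>0 s"
      using coupling0 by (cases s) (simp_all add: proj.simps[abs_def])
    fix k :: nat and v :: "real \<times> real"
    assume k: "1 \<le> k"
    have sets: "sets (Mc k v) = sets borel" "space (Mc k v) = UNIV"
      using kernel_prob[OF Mc_kernel[OF k], of v] by simp_all
    show "distr (Mc k v) borel (proj s) = M s k (proj s v)"
    proof (rule measure_eqI)
      have sM: "sets (M s k (proj s v)) = sets borel" using kernel_prob[OF M_kernel[OF k], of "proj s v"] by simp
      then show "sets (distr (Mc k v) borel (proj s)) = sets (M s k (proj s v))" by simp
      fix A assume "A \<in> sets (distr (Mc k v) borel (proj s))"
      then have A: "A \<in> sets borel" by simp
      have pm: "proj s \<in> borel_measurable (Mc k v)"
        using proj_measurable[of s] sets by (simp cong: measurable_cong_sets)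
      obtain x x' where v: "v = (x, x')" by (cases v)
      have "proj s -` A = (case s of Fine \<Rightarrow> A \<times> UNIV | Coarse \<Rightarrow> UNIV \<times> A)"
        by (cases s) auto
      then show "emeasure (distr (Mc k v) borel (proj s)) A = emeasure (M s k (proj s v)) A"
        using Mc_coupling[OF k A, of x x'] A sets(2)
        unfolding emeasure_distr[OF pm A] by (cases s) (simp_all add: v)
    qed
  qed (fact F_continuous F_inv_continuous coupling0(1) Mc_kernel Mc_feller)+
  let ?v = "asymptotic_variance G \<eta>0 M \<eta>c0 Mc n \<phi> \<psi>"
  have h: "h = contrast \<phi> \<psi>" by (auto simp: h_def contrast_def tensor_def)
  note hc = contrast_bounded_continuous[OF phi_psi, folded h]
  define Y where "Y N w = sqrt (real N) * (emean N h w - etac n h)" for N and w :: "nat \<Rightarrow> real \<times> real"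
  define X where "X N \<omega> = sqrt (real N) *
       ((\<integral>v. h v \<partial>empirical N (\<lambda>i. u N n i \<omega>)) - (\<integral>v. h v \<partial>eta_check G \<eta>0 M \<eta>c0 Mc n))" for N \<omega>
  have Y_meas: "Y N \<in> borel_measurable (config_space N)" if "N \<ge> 1" for N
    unfolding Y_def using emean_config[OF that hc] by measurable
  (* the fluctuation is a function of the last configuration, so only its law matters *)
  have law: "distr (\<Omega> N) borel (X N) = distr (law N n) borel (Y N)" if N: "N \<ge> 1" for N
  proof -
    define paths where "paths = (\<Pi>\<^sub>M p\<in>{0..<Suc n}. config_space N)"
    define path where "path \<omega> = (\<lambda>p\<in>{0..<Suc n}. \<lambda>i\<in>{1..N}. u N p i \<omega>)" for \<omega>
    have u: "\<And>p i. p \<le> n \<Longrightarrow> i \<in> {1..N} \<Longrightarrow> u N p i \<in> borel_measurable (\<Omega> N)"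
      and path_law: "distr (\<Omega> N) paths path = particle_law G \<eta>c0 Mc N n"
      using particles[OF N] unfolding particle_system_def paths_def path_def by auto
    have path: "path \<in> \<Omega> N \<rightarrow>\<^sub>M paths"
      unfolding path_def paths_def config_space_def by (intro measurable_restrict u) auto
    have last: "(\<lambda>x. x n) \<in> paths \<rightarrow>\<^sub>M config_space N"
      unfolding paths_def by (intro measurable_component_singleton) simp
    have X: "X N \<omega> = Y N (path \<omega> n)" for \<omega>
    proof -
      have "emean N h (\<lambda>i. u N n i \<omega>) = emean N h (path \<omega> n)"
        by (simp add: emean_def path_def)
      then show ?thesis
        by (simp add: X_def Y_def etac_def empirical_integral[OF bounded_continuous_measurable[OF hc]])
    qed
    have "distr (law N n) borel (Y N)
        = distr (distr (distr (\<Omega> N) paths path) (config_space N) (\<lambda>x. x n)) borel (Y N)"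
      unfolding path_law particle_law_marginal[OF N] ..
    also have "\<dots> = distr (\<Omega> N) borel (\<lambda>\<omega>. Y N (path \<omega> n))"
      using path last Y_meas[OF N] by (simp add: distr_distr comp_def)
    finally show ?thesis by (simp add: X[abs_def])
  qed
  (* particle systems start at N = 1, so the continuity theorem is applied to the shifted sequence *)
  have "weak_conv_m (\<lambda>N. distr (\<Omega> (Suc N)) borel (X (Suc N))) (centred_gaussian ?v)"
  proof (rule levy_continuity)
    fix N
    interpret prob_space "law (Suc N) n" by (rule law_prob) simp
    have "Y (Suc N) \<in> borel_measurable (law (Suc N) n)" using Y_meas by (simp add: law_measurable)
    then show "real_distribution (distr (\<Omega> (Suc N)) borel (X (Suc N)))"
      by (simp add: law)
  next
    show "real_distribution (centred_gaussian ?v)"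
      by (rule real_distribution_centred_gaussian[OF asymptotic_variance_nonneg])
  next
    fix t
    have "char (distr (\<Omega> (Suc N)) borel (X (Suc N))) t = fluctuation_char n \<phi> \<psi> t (Suc N)" for N
      using Y_meas[of "Suc N"]
      by (simp add: law char_def integral_distr law_measurable) (simp add: Y_def fluctuation_char_def h)
    then show "(\<lambda>N. char (distr (\<Omega> (Suc N)) borel (X (Suc N))) t) \<longlonglongrightarrow> char (centred_gaussian ?v) t"
      using LIMSEQ_Suc[OF fluctuation_char_tendsto[OF phi_psi, of n t]]
      by (simp add: char_centred_gaussian[OF asymptotic_variance_nonneg])
  qed
  then have "weak_conv_m (\<lambda>N. distr (\<Omega> N) borel (X N)) (centred_gaussian ?v)"
    unfolding weak_conv_m_def weak_conv_def by (auto intro: LIMSEQ_imp_Suc)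
  then show ?thesis unfolding X_def[abs_def] .
qed

end
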